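(* Consider the strictly hyperbolic Cauchy problem described in the context, with characteristic roots $\tau_1(\xi),\dots,\tau_m(\xi)$ satisfying $\operatorname{Im}\tau_k(\xi)\ge0$ for all $\xi\in\mathbb R^n$ and all $k$, and amplitudes $A_j^k(t,\xi)$. Assume that the characteristic roots $\tau_1(\xi),\dots,\tau_L(\xi)$ intersect in the bounded $C^1$ set $\mathcal M\subset\mathbb R^n$ of codimension $\ell$, and that they do not intersect the other roots $\tau_{L+1}(\xi),\dots,\tau_m(\xi)$ in $\mathcal M^\varepsilon$ for small $\varepsilon>0$. Assume also that they meet the real axis in $\mathcal M$ with finite orders $\le s$, i.e. that $$c_0\operatorname{dist}(\xi,\mathcal M)^s\le\operatorname{Im}\tau_k(\xi)$$ for some $c_0>0$, all $k=1,\dots,L$ (and all $\xi$ near $\mathcal M$). Let $\chi\in C_0^\infty(\mathcal M^\varepsilon)$ for sufficiently small $\varepsilon>0$. Then for all $t\ge0$ we have $$\Big\|D_t^rD_x^\alpha\Big(\int_{\mathcal M^\varepsilon}e^{ix\cdot\xi}\Big(\sum_{k=1}^Le^{i\tau_k(\xi)t}A_j^k(t,\xi)\Big)\chi(\xi)\widehat f(\xi)\,d\xi\Big)\Big\|_{L^q(\mathbb R^n_x)}\le C(1+t)^{-\frac\ell s(\frac1p-\frac1q)+L-1}\|f\|_{L^p},$$ where $\frac1p+\frac1q=1$, $1\le p\le2$, for every $j=0,\dots,m-1$, integer $r\ge0$, multi-index $\alpha$ and $f\in C_0^\infty(\mathbb R^n)$, with $C$ independent of $t$ and $f$.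
   Context: $D_t=\frac1i\partial_t$, $D_{x_k}=\frac1i\partial_{x_k}$; $\widehat f(\xi)=\int e^{-ix\cdot\xi}f(x)\,dx$. For $\mathcal M\subset\mathbb R^n$, $\mathcal M^\varepsilon=\{\xi\in\mathbb R^n:\operatorname{dist}(\xi,\mathcal M)<\varepsilon\}$, and the codimension of $\mathcal M$ is the largest $\nu\in\mathbb N$ such that $\operatorname{meas}(\mathcal M^\varepsilon)\le C\varepsilon^\nu$ for all sufficiently small $\varepsilon>0$. The $C^1$ assumption on $\mathcal M$ provides $C^1$ coordinate systems adapted to $\mathcal M$. Cauchy problem: $L(D_t,D_x)u\equiv D_t^mu+\sum_{j=1}^mP_j(D_x)D_t^{m-j}u+\sum_{l=0}^{m-1}\sum_{|\alpha|+r=l}c_{\alpha,r}D_x^\alpha D_t^ru=0$ for $t>0$, $x\in\mathbb R^n$, with $D_t^lu(0,x)=f_l(x)\in C_0^\infty(\mathbb R^n)$, $l=0,\dots,m-1$; $P_j(\xi)$ is a constant coefficient homogeneous polynomial of degree $j$, $c_{\alpha,r}\in\mathbb C$. Full symbol $L(\tau,\xi)=\tau^m+\sum_jP_j(\xi)\tau^{m-j}+\sum_l\sum_{|\alpha|+r=l}c_{\alpha,r}\xi^\alpha\tau^r$, with roots in $\tau$ denoted $\tau_1(\xi),\dots,\tau_m(\xi)$. Strict hyperbolicity: for $\xi\ne0$ the principal part $\tau^m+\sum_jP_j(\xi)\tau^{m-j}$ has $m$ real pairwise distinct roots. Amplitudes: let $E_j(t,\xi)$ be the solution of the ODE $L(D_t,\xi)E_j(t,\xi)=0$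 with $D_t^lE_j(0,\xi)=\delta_{lj}$, $l=0,\dots,m-1$. Then $E_j(t,\xi)=\sum_{k=1}^me^{i\tau_k(\xi)t}A_j^k(t,\xi)$, where $A^k_j(t,\xi)$ are polynomials in $t$ with coefficients depending on $\xi$, and $u(t,x)=\sum_{j}(2\pi)^{-n}\int e^{ix\cdot\xi}E_j(t,\xi)\widehat f_j(\xi)\,d\xi$. For $\xi\in\mathcal M^\varepsilon$ the sum over $k\le L$ is the part of the exponential polynomial $E_j(\cdot,\xi)$ carried by the exponents $\tau_1(\xi),\dots,\tau_L(\xi)$.
   Formalization: The roots are assumed consistently labelled: near M the group τ_1,…,τ_L varies continuously in ξ as an unordered tuple (implied by continuity of each root); with arbitrary pointwise labelling the estimate can fail. *)

theory Defs
  imports "HOL-Analysis.Analysis" "HOL-Computational_Algebra.Polynomial"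
    "HOL-Probability.Essential_Supremum"
begin

section \<open>Derivatives, test functions and Lebesgue norms\<close>

definition Dt :: "(real \<Rightarrow> complex) \<Rightarrow> real \<Rightarrow> complex" where
  "Dt g t = (1 / \<i>) * vector_derivative g (at t)"

definition Dx :: "'n \<Rightarrow> (real ^ 'n \<Rightarrow> complex) \<Rightarrow> real ^ 'n \<Rightarrow> complex" where
  "Dx k g x = (1 / \<i>) * vector_derivative (\<lambda>h. g (x + h *\<^sub>R axis k 1)) (at 0)"

type_synonym 'n multi_index = "'n \<Rightarrow> nat"

definition mi_abs :: "'n::finite multi_index \<Rightarrow> nat" where
  "mi_abs \<alpha> = (\<Sum>k\<in>UNIV. \<alpha> k)"

definition mi_power :: "real ^ 'n \<Rightarrow> 'n::finite multi_index \<Rightarrow> complex" where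
  "mi_power \<xi> \<alpha> = (\<Prod>k\<in>UNIV. of_real (\<xi> $ k) ^ \<alpha> k)"

text \<open>The index type carries no order, so the coordinates are processed along a fixed but
  unspecified enumeration; the order is immaterial for smooth functions.\<close>

definition Dx_multi :: "'n::finite multi_index \<Rightarrow> (real ^ 'n \<Rightarrow> complex) \<Rightarrow> real ^ 'n \<Rightarrow> complex" where
  "Dx_multi \<alpha> g =
     foldr (\<lambda>k. Dx k ^^ \<alpha> k) (SOME ks. set ks = (UNIV :: 'n set) \<and> distinct ks) g"

primrec Ck :: "nat \<Rightarrow> (real ^ 'n \<Rightarrow> complex) \<Rightarrow> bool" where
  "Ck 0 f \<longleftrightarrow> continuous_on UNIV f"
| "Ck (Suc k) f \<longleftrightarrow> f differentiable_on UNIV \<and> (\<forall>i. Ck k (Dx i f))"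

definition test_functions :: "(real ^ 'n) set \<Rightarrow> (real ^ 'n \<Rightarrow> complex) set" where
  "test_functions U =
     {f. (\<forall>k. Ck k f) \<and> compact (closure {x. f x \<noteq> 0}) \<and> closure {x. f x \<noteq> 0} \<subseteq> U}"

definition fourier :: "(real ^ 'n \<Rightarrow> complex) \<Rightarrow> real ^ 'n \<Rightarrow> complex" where
  "fourier f \<xi> = (LINT x|lborel. exp (- \<i> * of_real (x \<bullet> \<xi>)) * f x)"

text \<open>The value is infinite for non-measurable functions, so finiteness of the norm means
  membership in the Lebesgue space with exponent p, where \<open>p = top\<close> is the exponent infinity.\<close>

definition Lp_norm :: "ennreal \<Rightarrow> (real ^ 'n \<Rightarrow> complex) \<Rightarrow> ennreal" where
  "Lp_norm p f =
     (if f \<notin> borel_measurable lborel then top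
      else if p = top then esssup lborel (\<lambda>x. ennreal (norm (f x)))
      else let I = (\<integral>\<^sup>+x. ennreal (norm (f x) powr enn2real p) \<partial>lborel)
           in if I = top then top else ennreal (enn2real I powr (1 / enn2real p)))"

section \<open>Neighbourhoods, codimension and continuously differentiable sets\<close>

text \<open>\<^const>\<open>infdist\<close> to the empty set is 0, whereas the distance to the empty set
  is meant to be infinite here.\<close>

definition nbhd :: "(real ^ 'n) set \<Rightarrow> real \<Rightarrow> (real ^ 'n) set" where
  "nbhd M \<epsilon> = {\<xi>. M \<noteq> {} \<and> infdist \<xi> M < \<epsilon>}"

definition codim_bound :: "(real ^ 'n) set \<Rightarrow> nat \<Rightarrow> bool" where
  "codim_bound M \<nu> \<longleftrightarrow>
     (\<exists>C. \<exists>\<epsilon>\<^sub>0>0. \<forall>\<epsilon>. 0 < \<epsilon> \<and> \<epsilon> < \<epsilon>\<^sub>0 \<longrightarrow> emeasure lborel (nbhd M \<epsilon>) \<le> ennreal (C * \<epsilon> ^ \<nu>))"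

definition has_codim :: "(real ^ 'n) set \<Rightarrow> nat \<Rightarrow> bool" where
  "has_codim M l \<longleftrightarrow> codim_bound M l \<and> (\<forall>\<nu>. codim_bound M \<nu> \<longrightarrow> \<nu> \<le> l)"

definition C1_map_on ::
    "'a::real_normed_vector set \<Rightarrow> ('a \<Rightarrow> 'b::real_normed_vector) \<Rightarrow> bool" where
  "C1_map_on U \<phi> \<longleftrightarrow>
     (\<exists>\<phi>' :: 'a \<Rightarrow> 'a \<Rightarrow>\<^sub>L 'b.
        (\<forall>x\<in>U. (\<phi> has_derivative blinfun_apply (\<phi>' x)) (at x)) \<and> continuous_on U \<phi>')"

text \<open>Embedded submanifolds of class one: near each of its points, the set is flattened to a
  linear subspace by a diffeomorphism of the ambient space. The dimension is locally constant,
  but components of different dimensions are allowed.\<close>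

definition C1_set :: "(real ^ 'n) set \<Rightarrow> bool" where
  "C1_set M \<longleftrightarrow>
     (\<forall>p\<in>M. \<exists>U V \<phi> \<psi>. \<exists>S :: (real ^ 'n) set.
        open U \<and> p \<in> U \<and> open V \<and> homeomorphism U V \<phi> \<psi> \<and>
        C1_map_on U \<phi> \<and> C1_map_on V \<psi> \<and> subspace S \<and> \<phi> ` (M \<inter> U) = S \<inter> V)"

section \<open>Symbols, characteristic roots and amplitudes\<close>

text \<open>Symbols are polynomials in the dual variable of t for each \<open>\<xi>\<close>. The homogeneous polynomial
  \<open>P\<^sub>j\<close> is given by its coefficients \<open>a j \<alpha>\<close> with \<open>\<bar>\<alpha>\<bar> = j\<close>; other values of \<open>a j\<close> are not used,
  and likewise for the lower order coefficients \<open>c \<alpha> r\<close> with \<open>\<bar>\<alpha>\<bar> + r \<ge> m\<close>.\<close>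

definition hom_poly :: "nat \<Rightarrow> ('n::finite multi_index \<Rightarrow> complex) \<Rightarrow> real ^ 'n \<Rightarrow> complex" where
  "hom_poly j b \<xi> = (\<Sum>\<alpha> | mi_abs \<alpha> = j. b \<alpha> * mi_power \<xi> \<alpha>)"

definition principal_symbol ::
    "nat \<Rightarrow> (nat \<Rightarrow> 'n::finite multi_index \<Rightarrow> complex) \<Rightarrow> real ^ 'n \<Rightarrow> complex poly" where
  "principal_symbol m a \<xi> = monom 1 m + (\<Sum>j=1..m. monom (hom_poly j (a j) \<xi>) (m - j))"

definition full_symbol ::
    "nat \<Rightarrow> (nat \<Rightarrow> 'n::finite multi_index \<Rightarrow> complex) \<Rightarrow> ('n::finite multi_index \<Rightarrow> nat \<Rightarrow> complex)
     \<Rightarrow> real ^ 'n \<Rightarrow> complex poly" where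
  "full_symbol m a c \<xi> = principal_symbol m a \<xi> +
     (\<Sum>l<m. \<Sum>(\<alpha>, r) \<in> {(\<alpha>, r). mi_abs \<alpha> + r = l}. monom (c \<alpha> r * mi_power \<xi> \<alpha>) r)"

definition strictly_hyperbolic ::
    "nat \<Rightarrow> (nat \<Rightarrow> 'n::finite multi_index \<Rightarrow> complex) \<Rightarrow> bool" where
  "strictly_hyperbolic m a \<longleftrightarrow>
     (\<forall>\<xi>. \<xi> \<noteq> 0 \<longrightarrow> card {x::real. poly (principal_symbol m a \<xi>) (of_real x) = 0} = m)"

text \<open>The roots \<open>\<tau> 1 \<xi>, \<dots>, \<tau> m \<xi>\<close> are listed with multiplicity.\<close>

definition char_roots ::
    "nat \<Rightarrow> (nat \<Rightarrow> 'n::finite multi_index \<Rightarrow> complex) \<Rightarrow> ('n::finite multi_index \<Rightarrow> nat \<Rightarrow> complex)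
     \<Rightarrow> (nat \<Rightarrow> real ^ 'n \<Rightarrow> complex) \<Rightarrow> bool" where
  "char_roots m a c \<tau> \<longleftrightarrow> (\<forall>\<xi>. full_symbol m a c \<xi> = (\<Prod>k=1..m. [:- \<tau> k \<xi>, 1:]))"

text \<open>The group \<open>\<tau> 1, \<dots>, \<tau> L\<close> varies continuously as an unordered tuple with multiplicities: the
  monic polynomial having these roots has continuous values (equivalently, coefficients). This
  follows from continuity of each single root, but it does not rule out monodromy inside the group,
  where no continuous numbering exists.\<close>

definition continuous_root_group ::
    "(real ^ 'n) set \<Rightarrow> nat \<Rightarrow> (nat \<Rightarrow> real ^ 'n \<Rightarrow> complex) \<Rightarrow> bool" where
  "continuous_root_group U L \<tau> \<longleftrightarrow>
     (\<forall>z. continuous_on U (\<lambda>\<xi>. poly (\<Prod>k=1..L. [:- \<tau> k \<xi>, 1:]) z))"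

text \<open>\<open>Q(D\<^sub>t)\<close> for a polynomial \<open>Q\<close>; with the full symbol this is \<open>L(D\<^sub>t, \<xi>)\<close>.\<close>

definition poly_Dt :: "complex poly \<Rightarrow> (real \<Rightarrow> complex) \<Rightarrow> real \<Rightarrow> complex" where
  "poly_Dt Q g t = (\<Sum>i\<le>degree Q. coeff Q i * (Dt ^^ i) g t)"

definition solves_mode ::
    "nat \<Rightarrow> (nat \<Rightarrow> 'n::finite multi_index \<Rightarrow> complex) \<Rightarrow> ('n::finite multi_index \<Rightarrow> nat \<Rightarrow> complex)
     \<Rightarrow> nat \<Rightarrow> real ^ 'n \<Rightarrow> (real \<Rightarrow> complex) \<Rightarrow> bool" where
  "solves_mode m a c j \<xi> e \<longleftrightarrow>
     (\<forall>l<m. (Dt ^^ l) e differentiable_on UNIV) \<and>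
     (\<forall>t. poly_Dt (full_symbol m a c \<xi>) e t = 0) \<and>
     (\<forall>l<m. (Dt ^^ l) e 0 = (if l = j then 1 else 0))"

text \<open>The exponential polynomial with amplitudes \<open>A j k \<xi>\<close> (polynomials in t) is the solution
  \<open>E\<^sub>j(t, \<xi>)\<close>, which is uniquely determined by its initial data. Where roots coincide, the single
  amplitudes are not unique. The partial sums over a group of roots disjoint from the remaining
  roots are, because exponential polynomials with disjoint exponents are linearly independent.\<close>

definition amplitudes ::
    "nat \<Rightarrow> (nat \<Rightarrow> 'n::finite multi_index \<Rightarrow> complex) \<Rightarrow> ('n::finite multi_index \<Rightarrow> nat \<Rightarrow> complex)
     \<Rightarrow> (nat \<Rightarrow> real ^ 'n \<Rightarrow> complex) \<Rightarrow> (nat \<Rightarrow> nat \<Rightarrow> real ^ 'n \<Rightarrow> complex poly) \<Rightarrow> bool" where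
  "amplitudes m a c \<tau> A \<longleftrightarrow>
     (\<forall>j<m. \<forall>\<xi>. solves_mode m a c j \<xi>
        (\<lambda>t. \<Sum>k=1..m. exp (\<i> * \<tau> k \<xi> * of_real t) * poly (A j k \<xi>) (of_real t)))"

definition localized_wave ::
    "(real ^ 'n) set \<Rightarrow> nat \<Rightarrow> (nat \<Rightarrow> real ^ 'n \<Rightarrow> complex) \<Rightarrow> (nat \<Rightarrow> real ^ 'n \<Rightarrow> complex poly)
     \<Rightarrow> (real ^ 'n \<Rightarrow> complex) \<Rightarrow> (real ^ 'n \<Rightarrow> complex) \<Rightarrow> real \<Rightarrow> real ^ 'n \<Rightarrow> complex" where
  "localized_wave U L \<tau> B \<eta> f t x =
     (LINT \<xi>:U|lborel. exp (\<i> * of_real (x \<bullet> \<xi>)) *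
        (\<Sum>k=1..L. exp (\<i> * \<tau> k \<xi> * of_real t) * poly (B k \<xi>) (of_real t)) *
        \<eta> \<xi> * fourier f \<xi>)"

end

theory Submission
  imports Defs "HOL-Computational_Algebra.Polynomial_Factorial"
    "HOL-Computational_Algebra.Field_as_Ring" "HOL-Probability.Probability"
    "HOL-Real_Asymp.Real_Asymp"
begin

text \<open>For fixed \<open>t\<close> the localized wave is the image of \<open>f\<close> under a Fourier multiplier operator. Its
  symbol is \<open>\<eta>(\<xi>) W(t, \<xi>)\<close>, where \<open>W\<close> is the part of the exponential polynomial \<open>E\<^sub>j\<close> carried by the
  group \<open>\<tau>\<^sub>1, \<dots>, \<tau>\<^sub>L\<close>, and derivatives in \<open>x\<close> and \<open>t\<close> only turn it into \<open>\<xi>\<^sup>\<alpha> \<eta> D\<^sub>t\<^sup>r W\<close>. A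
  multiplier operator is bounded on the space of exponent 2 by the supremum of its symbol
  (Plancherel), and from exponent 1 to exponent infinity by the integral of its symbol.
  Interpolation yields the norm \<open>C M\<^sub>0\<^bsup>1 - \<theta>\<^esup> M\<^sub>1\<^bsup>\<theta>\<^esup>\<close> with \<open>\<theta> = 1/p - 1/q\<close> (lemma
  \<open>multiplier_Lp_Lq\<close>). It is proved by truncating \<open>f\<close> in the style of Marcinkiewicz, which gives
  strong type because the second endpoint is an everywhere bound.

  Everything therefore follows from the pointwise bound \<open>\<bar>D\<^sub>t\<^sup>r W(t, \<xi>)\<bar> \<le> C (1 + t)\<^bsup>L - 1\<^esup> exp (-
  c\<^sub>0 dist(\<xi>, M)\<^sup>s t)\<close> on a compact tube around \<open>M\<close>. It bounds the supremum by \<open>(1 + t)\<^bsup>L - 1\<^esup>\<close>; and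
  because the tube of radius \<open>\<delta>\<close> has measure \<open>O(\<delta>\<^sup>l)\<close> while the exponential is concentrated on the
  tube of radius \<open>t\<^bsup>-1/s\<^esup>\<close>, the integral gains the factor \<open>(1 + t)\<^bsup>-l/s\<^esup>\<close> (lemma \<open>tube_integral\<close>).

  The roots of the group may coincide and need not admit a continuous numbering, and the single
  amplitudes are not unique and need not stay bounded near coinciding roots, so the bound is derived
  from the polynomials \<open>Q = \<Prod>\<^bsub>k \<le> L\<^esub> (z - \<tau>\<^sub>k)\<close> and \<open>R = \<Prod>\<^bsub>k > L\<^esub> (z - \<tau>\<^sub>k)\<close>. An exponential
  polynomial is encoded by the sequence of its \<open>D\<^sub>t\<close>-derivatives at 0, on which polynomials in \<open>D\<^sub>t\<close>
  act through the shift. As \<open>Q R\<close> annihilates \<open>E\<^sub>j = W + V\<close> and \<open>Q, R\<close> are coprime on the tube,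
  Bezout's identity shows that \<open>Q\<close> annihilates \<open>W\<close> and \<open>R\<close> annihilates \<open>V\<close> (lemma
  \<open>group_splitting\<close>); consequently \<open>V = \<Prod>\<^bsub>k \<le> L\<^esub> (1 - R / R(\<tau>\<^sub>k)) E\<^sub>j\<close> (lemma \<open>group_projection\<close>).
  By compactness \<open>R(\<tau>\<^sub>k)\<close> stays away from 0, so the derivatives of \<open>V\<close> and \<open>W\<close> at \<open>t = 0\<close> are
  bounded uniformly in \<open>\<xi>\<close>. Finally \<open>Q(D\<^sub>t) W = 0\<close> is solved as a chain of \<open>L\<close> first order
  equations: the first one gives the exponential, each further one costs a factor \<open>1 + t\<close> (lemma
  \<open>root_group_decay\<close>). Measurability of \<open>W\<close> in \<open>\<xi>\<close> comes from continuity of its derivatives at \<open>t =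
  0\<close>: they are bounded, and any limit point of them solves the limiting equations, which have one
  solution only (lemma \<open>continuous_on_group_sequence\<close>).\<close>

section \<open>Polynomials acting on sequences by the shift\<close>

text \<open>The operator \<open>p(S)\<close> for the shift \<open>S\<close>. If \<open>w\<close> lists the \<open>D\<^sub>t\<close>-derivatives of a function at 0,
  then \<open>p(S) w\<close> lists those of the image of the function under \<open>p(D\<^sub>t)\<close>.\<close>

definition shift_poly :: "complex poly \<Rightarrow> (nat \<Rightarrow> complex) \<Rightarrow> nat \<Rightarrow> complex" where
  "shift_poly p w n = (\<Sum>i\<le>degree p. coeff p i * w (n + i))"

lemma shift_poly_eq:
  assumes "degree p \<le> N"
  shows "shift_poly p w n = (\<Sum>i\<le>N. coeff p i * w (n + i))"
  unfolding shift_poly_def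
  by (rule sum.mono_neutral_left) (use assms in \<open>auto simp: coeff_eq_0\<close>)

lemma shift_poly_0 [simp]: "shift_poly 0 w = (\<lambda>n. 0)"
  by (auto simp: shift_poly_def)

lemma shift_poly_1 [simp]: "shift_poly 1 w = w"
  by (auto simp: shift_poly_def)

lemma shift_poly_zero [simp]: "shift_poly p (\<lambda>n. 0) = (\<lambda>n. 0)"
  by (auto simp: shift_poly_def)

lemma shift_poly_add: "shift_poly (p + q) w n = shift_poly p w n + shift_poly q w n"
proof -
  let ?N = "max (degree p) (degree q)"
  show ?thesis
    using degree_add_le_max[of p q]
    by (simp add: shift_poly_eq[where N = ?N] sum.distrib ring_distribs)
qed

lemma shift_poly_smult: "shift_poly (smult a p) w n = a * shift_poly p w n"
  by (simp add: shift_poly_eq[where N = "degree p"] degree_smult_le sum_distrib_left mult.assoc)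

lemma shift_poly_minus: "shift_poly (- p) w n = - shift_poly p w n"
  using shift_poly_smult[of "-1" p w n] by simp

lemma shift_poly_diff: "shift_poly (p - q) w n = shift_poly p w n - shift_poly q w n"
  using shift_poly_add[of p "-q" w n] by (simp add: shift_poly_minus)

lemma shift_poly_pCons: "shift_poly (pCons a p) w n = a * w n + shift_poly p (\<lambda>n. w (Suc n)) n"
proof -
  have "shift_poly (pCons a p) w n = (\<Sum>i\<le>Suc (degree p). coeff (pCons a p) i * w (n + i))"
    by (rule shift_poly_eq) (simp add: degree_pCons_le)
  also have "\<dots> = a * w n + (\<Sum>i\<le>degree p. coeff p i * w (n + Suc i))"
    by (subst sum.atMost_Suc_shift) simp
  finally show ?thesis by (simp add: shift_poly_def)
qed

lemma shift_poly_lin: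
  "shift_poly p (\<lambda>n. a * u n + b * v n) n = a * shift_poly p u n + b * shift_poly p v n"
  by (simp add: shift_poly_def sum_distrib_left sum.distrib[symmetric] algebra_simps)

lemma shift_poly_seq_add: "shift_poly p (\<lambda>n. u n + v n) n = shift_poly p u n + shift_poly p v n"
  using shift_poly_lin[of p 1 u 1 v n] by simp

lemma shift_poly_seq_diff: "shift_poly p (\<lambda>n. u n - v n) n = shift_poly p u n - shift_poly p v n"
  using shift_poly_lin[of p 1 u "-1" v n] by simp

lemma shift_poly_seq_sum: "shift_poly p (\<lambda>n. \<Sum>k\<in>S. u k n) n = (\<Sum>k\<in>S. shift_poly p (u k) n)"
proof (cases "finite S")
  case True
  then show ?thesis
    by (induction S rule: finite_induct) (simp_all add: shift_poly_seq_add)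
qed simp

text \<open>Sequences thus form a module over the polynomial ring, in which annihilating polynomials can
  be multiplied and combined.\<close>

lemma shift_poly_mult: "shift_poly (p * q) w = shift_poly p (shift_poly q w)"
proof (induction p arbitrary: w)
  case (pCons a p)
  have sh: "(\<lambda>n. shift_poly q w (Suc n)) = shift_poly q (\<lambda>n. w (Suc n))"
    by (rule ext) (simp add: shift_poly_def)
  show ?case
    by (rule ext)
      (simp add: shift_poly_add shift_poly_smult shift_poly_pCons pCons.IH sh)
qed (simp add: fun_eq_iff)

lemma shift_poly_dvd:
  assumes "p dvd q" "shift_poly p w = (\<lambda>n. 0)"
  shows "shift_poly q w = (\<lambda>n. 0)"
  using assms by (auto simp: dvd_def mult.commute[of p] shift_poly_mult)

text \<open>With \<open>u p + v q = 1\<close>, a sequence annihilated by \<open>p\<close> and \<open>q\<close> is annihilated by 1.\<close>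

lemma shift_poly_coprime:
  assumes "coprime p q" "shift_poly p w = (\<lambda>n. 0)" "shift_poly q w = (\<lambda>n. 0)"
  shows "w = (\<lambda>n. 0)"
proof -
  obtain u v where "u * p + v * q = 1"
    using bezout_coefficients_fst_snd[of p q] assms(1) by (auto simp: coprime_iff_gcd_eq_1)
  then have "w = shift_poly (u * p + v * q) w" by simp
  also have "\<dots> = (\<lambda>n. 0)"
    by (rule ext) (simp add: shift_poly_add shift_poly_mult assms)
  finally show ?thesis .
qed

text \<open>Growth at most geometric makes the power series below converge everywhere; it holds for the
  derivatives at 0 of every exponential polynomial.\<close>

definition geometric :: "(nat \<Rightarrow> complex) \<Rightarrow> bool" where
  "geometric w \<longleftrightarrow> (\<exists>B \<rho>. \<forall>n. norm (w n) \<le> B * \<rho> ^ n)"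

text \<open>The Taylor series of the function with \<open>D\<^sub>t\<^sup>n\<close>-derivative \<open>w n\<close> at 0; the powers of \<open>\<i>\<close> come
  from \<open>d/dt = \<i> D\<^sub>t\<close>.\<close>

definition jet_fun :: "(nat \<Rightarrow> complex) \<Rightarrow> real \<Rightarrow> complex" where
  "jet_fun w t = (\<Sum>n. (\<i> * of_real t) ^ n / fact n * w n)"

lemma geometric_E:
  assumes "geometric w"
  obtains B \<rho> where "B \<ge> 0" "\<rho> \<ge> 1" "\<And>n. norm (w n) \<le> B * \<rho> ^ n"
proof -
  obtain B \<rho> where b: "\<And>n. norm (w n) \<le> B * \<rho> ^ n" using assms by (auto simp: geometric_def)
  have "norm (w n) \<le> \<bar>B\<bar> * (max 1 \<bar>\<rho>\<bar>) ^ n" for n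
  proof -
    have "norm (w n) \<le> \<bar>B * \<rho> ^ n\<bar>" using b[of n] by linarith
    also have "\<dots> \<le> \<bar>B\<bar> * (max 1 \<bar>\<rho>\<bar>) ^ n"
      by (auto simp: abs_mult power_abs intro!: mult_left_mono power_mono)
    finally show ?thesis .
  qed
  then show ?thesis using that[of "\<bar>B\<bar>" "max 1 \<bar>\<rho>\<bar>"] by auto
qed

lemma geometric_add:
  assumes "geometric u" "geometric v" shows "geometric (\<lambda>n. u n + v n)"
proof -
  obtain B \<rho> where 1: "B \<ge> 0" "\<rho> \<ge> 1" "\<And>n. norm (u n) \<le> B * \<rho> ^ n" using geometric_E[OF assms(1)] by metis
  obtain B' \<rho>' where 2: "B' \<ge> 0" "\<rho>' \<ge> 1" "\<And>n. norm (v n) \<le> B' * \<rho>' ^ n"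
    using geometric_E[OF assms(2)] by metis
  have "norm (u n + v n) \<le> (B + B') * (max \<rho> \<rho>') ^ n" for n
  proof -
    have "norm (u n + v n) \<le> B * \<rho> ^ n + B' * \<rho>' ^ n" using norm_triangle_mono[OF 1(3) 2(3)] .
    also have "\<dots> \<le> B * (max \<rho> \<rho>') ^ n + B' * (max \<rho> \<rho>') ^ n"
      using 1 2 by (intro add_mono mult_left_mono power_mono) auto
    finally show ?thesis by (simp add: algebra_simps)
  qed
  then show ?thesis unfolding geometric_def by blast
qed

lemma geometric_cmult: assumes "geometric u" shows "geometric (\<lambda>n. a * u n)"
proof -
  obtain B \<rho> where 1: "B \<ge> 0" "\<rho> \<ge> 1" "\<And>n. norm (u n) \<le> B * \<rho> ^ n" using geometric_E[OF assms(1)] by metis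
  show ?thesis unfolding geometric_def
    by (intro exI[of _ "norm a * B"] exI[of _ \<rho>])
       (auto simp: norm_mult mult.assoc intro!: mult_left_mono 1)
qed

lemma geometric_shift: assumes "geometric u" shows "geometric (\<lambda>n. u (n + i))"
proof -
  obtain B \<rho> where 1: "B \<ge> 0" "\<rho> \<ge> 1" "\<And>n. norm (u n) \<le> B * \<rho> ^ n" using geometric_E[OF assms(1)] by metis
  show ?thesis unfolding geometric_def
    by (intro exI[of _ "B * \<rho> ^ i"] exI[of _ \<rho>])
       (intro allI, rule order_trans[OF 1(3)], simp add: power_add mult_ac)
qed

lemma geometric_zero: "geometric (\<lambda>n. 0)" unfolding geometric_def by (intro exI[of _ 0]) auto

lemma geometric_sum: assumes "\<And>k. k \<in> S \<Longrightarrow> geometric (u k)" shows "geometric (\<lambda>n. \<Sum>k\<in>S. u k n)"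
  using assms
  by (induction S rule: infinite_finite_induct) (auto intro: geometric_zero geometric_add)

lemma geometric_shift_poly: assumes "geometric u" shows "geometric (shift_poly p u)"
  unfolding shift_poly_def[abs_def]
  by (intro geometric_sum geometric_cmult geometric_shift assms)

lemma jet_fun_summable: assumes "geometric w" shows "summable (\<lambda>n. (w n / fact n) * z ^ n)"
proof -
  obtain B \<rho> where 1: "B \<ge> 0" "\<rho> \<ge> 1" "\<And>n. norm (w n) \<le> B * \<rho> ^ n" using geometric_E[OF assms(1)] by metis
  show ?thesis
  proof (rule summable_comparison_test')
    show "summable (\<lambda>n. B * (inverse (fact n) * (\<rho> * norm z) ^ n))"
      by (intro summable_mult summable_exp)
    show "norm (w n / fact n * z ^ n) \<le> B * (inverse (fact n) * (\<rho> * norm z) ^ n)" if "n \<ge> 0" for n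
      using mult_right_mono[OF 1(3)[of n], of "norm z ^ n / fact n"]
      by (simp add: norm_mult norm_divide norm_power power_mult_distrib field_simps)
  qed
qed

lemma jet_fun_sums:
  assumes "geometric w" shows "(\<lambda>n. (\<i> * of_real t) ^ n / fact n * w n) sums jet_fun w t"
  unfolding jet_fun_def
  using jet_fun_summable[OF assms, of "\<i> * of_real t"]
  by (intro summable_sums) (simp add: mult_ac)

lemma jet_fun_0: "geometric w \<Longrightarrow> jet_fun w 0 = w 0"
  using suminf_finite[of "{0}" "\<lambda>n. (\<i> * of_real 0) ^ n / fact n * w n"]
  unfolding jet_fun_def by simp

lemma jet_fun_add: "geometric u \<Longrightarrow> geometric v \<Longrightarrow> jet_fun (\<lambda>n. u n + v n) t = jet_fun u t + jet_fun v t"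
  using sums_unique[OF sums_add[OF jet_fun_sums[of u t] jet_fun_sums[of v t]]]
  by (simp add: jet_fun_def ring_distribs)

lemma jet_fun_cmult: "geometric u \<Longrightarrow> jet_fun (\<lambda>n. a * u n) t = a * jet_fun u t"
  using sums_unique[OF sums_mult[OF jet_fun_sums[of u t], of a]] by (simp add: jet_fun_def mult_ac)

lemma jet_fun_zero: "jet_fun (\<lambda>n. 0) t = 0"
  by (simp add: jet_fun_def)

lemma jet_fun_sum: "(\<And>k. k \<in> S \<Longrightarrow> geometric (u k)) \<Longrightarrow> jet_fun (\<lambda>n. \<Sum>k\<in>S. u k n) t = (\<Sum>k\<in>S. jet_fun (u k) t)"
  by (induction S rule: infinite_finite_induct) (auto simp: jet_fun_zero jet_fun_add geometric_sum)

lemma jet_fun_has_vector_derivative: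
  assumes "geometric w"
  shows "(jet_fun w has_vector_derivative \<i> * jet_fun (\<lambda>n. w (Suc n)) t) (at t)"
proof -
  define c where "c n = \<i> ^ n * w n / fact n" for n
  have fnc: "jet_fun w t = (\<Sum>n. c n * (of_real t) ^ n)" for t
    unfolding jet_fun_def c_def by (simp add: power_mult_distrib mult_ac)
  have sm: "summable (\<lambda>n. c n * z ^ n)" for z
    using jet_fun_summable[OF assms, of "\<i> * z"] by (simp add: c_def power_mult_distrib mult_ac)
  have "((\<lambda>z. \<Sum>n. c n * z ^ n) has_field_derivative (\<Sum>n. diffs c n * of_real t ^ n)) (at (of_real t))"
    by (rule termdiffs_strong_converges_everywhere) (rule sm)
  then have "((\<lambda>z. \<Sum>n. c n * (of_real z) ^ n) has_vector_derivative (\<Sum>n. diffs c n * of_real t ^ n)) (at t)"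
    by (rule has_vector_derivative_real_field)
  also have "(\<lambda>z. \<Sum>n. c n * (of_real z) ^ n) = jet_fun w" by (rule ext) (simp only: fnc)
  also have "(\<Sum>n. diffs c n * of_real t ^ n) = (\<Sum>n. \<i> * ((\<i> * of_real t) ^ n / fact n * w (Suc n)))"
  proof (rule arg_cong[of _ _ suminf], rule ext)
    fix n
    have "(1 + of_nat n :: complex) \<noteq> 0"
      using of_nat_neq_0[of n, where 'a = complex] by simp
    then show "diffs c n * of_real t ^ n = \<i> * ((\<i> * of_real t) ^ n / fact n * w (Suc n))"
      by (simp add: diffs_def c_def power_mult_distrib divide_simps del: of_nat_Suc)
        (simp add: algebra_simps)?
  qed
  also have "\<dots> = \<i> * jet_fun (\<lambda>n. w (Suc n)) t"
    using jet_fun_sums[OF geometric_shift[OF assms, of 1], of t]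
    by (intro sums_unique[symmetric] sums_mult) simp
  finally show ?thesis .
qed

lemma Dt_jet_fun: "geometric w \<Longrightarrow> Dt (jet_fun w) = jet_fun (\<lambda>n. w (Suc n))"
  using vector_derivative_at[OF jet_fun_has_vector_derivative] by (simp add: Dt_def fun_eq_iff)

lemma Dt_pow_jet_fun: "geometric w \<Longrightarrow> (Dt ^^ r) (jet_fun w) = jet_fun (\<lambda>n. w (n + r))"
proof (induction r arbitrary: w)
  case (Suc r)
  have "(Dt ^^ Suc r) (jet_fun w) = (Dt ^^ r) (jet_fun (\<lambda>n. w (n + 1)))"
    by (simp add: funpow_swap1 Dt_jet_fun[OF Suc.prems])
  also have "\<dots> = jet_fun (\<lambda>n. w (n + Suc r))"
    by (subst Suc.IH) (auto intro: geometric_shift[OF Suc.prems, of 1, simplified])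
  finally show ?case .
qed simp

lemma Dt_pow_jet_fun_0: "geometric w \<Longrightarrow> (Dt ^^ r) (jet_fun w) 0 = w r"
  by (simp add: Dt_pow_jet_fun jet_fun_0 geometric_shift)

text \<open>The sequence is recovered from the function as its derivatives at 0.\<close>

lemma jet_fun_inject: "geometric u \<Longrightarrow> geometric v \<Longrightarrow> jet_fun u = jet_fun v \<Longrightarrow> u = v"
  by (rule ext) (metis Dt_pow_jet_fun_0)

lemma poly_Dt_jet_fun: "geometric w \<Longrightarrow> poly_Dt p (jet_fun w) t = jet_fun (shift_poly p w) t"
  unfolding poly_Dt_def shift_poly_def[abs_def]
  by (subst jet_fun_sum) (auto intro!: geometric_cmult geometric_shift sum.cong simp: Dt_pow_jet_fun
    jet_fun_cmult geometric_shift)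

section \<open>Exponential polynomials and groups of characteristic roots\<close>

lemma exp_seq: "geometric (\<lambda>n. \<tau> ^ n)" "jet_fun (\<lambda>n. \<tau> ^ n) t = exp (\<i> * \<tau> * of_real t)"
proof -
  show "geometric (\<lambda>n. \<tau> ^ n)"
    unfolding geometric_def by (intro exI[of _ 1] exI[of _ "norm \<tau>"]) (simp add: norm_power)
  show "jet_fun (\<lambda>n. \<tau> ^ n) t = exp (\<i> * \<tau> * of_real t)"
    unfolding jet_fun_def exp_def
    by (simp add: scaleR_conv_of_real power_mult_distrib field_simps)
qed

lemma shift_linear: "shift_poly [:-\<tau>, 1:] w n = w (Suc n) - \<tau> * w n"
  by (simp add: shift_poly_pCons)

text \<open>Multiplication by \<open>t\<close>, on the level of derivatives at 0 (Leibniz rule).\<close>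

definition times_t :: "(nat \<Rightarrow> complex) \<Rightarrow> nat \<Rightarrow> complex" where
  "times_t w n = - \<i> * of_nat n * w (n - 1)"

lemma geometric_times_t:
  assumes "geometric w" shows "geometric (times_t w)"
proof -
  obtain B \<rho> where 1: "B \<ge> 0" "\<rho> \<ge> 1" "\<And>n. norm (w n) \<le> B * \<rho> ^ n" using geometric_E[OF assms(1)] by metis
  have "norm (times_t w n) \<le> B * (2 * \<rho>) ^ n" for n
  proof -
    have "norm (times_t w n) \<le> real n * (B * \<rho> ^ (n - 1))"
      unfolding times_t_def using 1 by (auto simp: norm_mult intro!: mult_left_mono)
    also have "\<dots> \<le> 2 ^ n * (B * \<rho> ^ n)"
      using 1 of_nat_less_two_power[of n, where 'a = real]
      by (intro mult_mono mult_left_mono power_increasing) auto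
    finally show ?thesis by (simp add: power_mult_distrib mult_ac)
  qed
  then show ?thesis unfolding geometric_def by blast
qed

lemma jet_fun_times_t:
  assumes "geometric w" shows "jet_fun (times_t w) t = of_real t * jet_fun w t"
proof -
  let ?f = "\<lambda>n. (\<i> * of_real t) ^ n / fact n * times_t w n"
  have "?f (Suc n) = of_real t * ((\<i> * of_real t) ^ n / fact n * w n)" for n
  proof -
    have "(1 + of_nat n :: complex) \<noteq> 0"
      using of_nat_neq_0[of n, where 'a = complex] by simp
    then show ?thesis
      by (simp add: times_t_def divide_simps del: of_nat_Suc) (simp add: algebra_simps)?
  qed
  then have "(\<lambda>n. ?f (Suc n)) sums (of_real t * jet_fun w t)"
    using sums_mult[OF jet_fun_sums[OF assms, of t], of "of_real t"] by simp
  moreover have "?f 0 = 0" by (simp add: times_t_def)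
  ultimately have "?f sums (of_real t * jet_fun w t)"
    using sums_Suc_iff[of ?f "of_real t * jet_fun w t"] by (simp del: power_Suc fact_Suc)
  then show ?thesis unfolding jet_fun_def by (simp add: sums_iff)
qed

text \<open>The commutator of \<open>D\<^sub>t\<close> and multiplication by \<open>t\<close> is \<open>-\<i>\<close>; the formula iterates this.\<close>

lemma shift_times_t:
  "shift_poly ([:-\<tau>, 1:] ^ N) (times_t w) n =
     times_t (shift_poly ([:-\<tau>, 1:] ^ N) w) n - \<i> * of_nat N * shift_poly ([:-\<tau>, 1:] ^ (N - 1)) w n"
proof (induction N arbitrary: w)
  case (Suc N)
  have a: "shift_poly [:-\<tau>, 1:] (times_t w) = (\<lambda>n. times_t (shift_poly [:-\<tau>, 1:] w) n + (- \<i>) * w n)"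
  proof
    fix n show "shift_poly [:-\<tau>, 1:] (times_t w) n = times_t (shift_poly [:-\<tau>, 1:] w) n + (- \<i>) * w n"
      by (cases n) (simp_all add: shift_linear times_t_def algebra_simps)
  qed
  have p: "[:-\<tau>, 1:] ^ Suc N = [:-\<tau>, 1:] ^ N * [:-\<tau>, 1:]" for N by (simp only: power_Suc2)
  have b: "shift_poly ([:-\<tau>, 1:] ^ Suc N) (times_t w) n =
     shift_poly ([:-\<tau>, 1:] ^ N) (times_t (shift_poly [:-\<tau>, 1:] w)) n - \<i> * shift_poly ([:-\<tau>, 1:] ^ N) w n"
    using shift_poly_lin[of "[:-\<tau>, 1:] ^ N" 1 "times_t (shift_poly [:-\<tau>, 1:] w)" "-\<i>" w n]
    unfolding p shift_poly_mult a by simp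
  have c: "of_nat N * shift_poly ([:-\<tau>, 1:] ^ (N - 1)) (shift_poly [:-\<tau>, 1:] w) n
     = of_nat N * shift_poly ([:-\<tau>, 1:] ^ N) w n"
    by (cases N) (auto simp only: p shift_poly_mult diff_Suc_1 of_nat_0 mult_zero_left)
  show ?case
    using c unfolding b Suc.IH unfolding p shift_poly_mult diff_Suc_1
    by (simp add: ring_distribs mult.assoc del: power_Suc mult_pCons_left mult_pCons_right)
qed simp

text \<open>The annihilating power is obtained by induction on the amplitude: each multiplication by \<open>t\<close>
  raises the exponent by one.\<close>

lemma exp_poly_seq:
  "\<exists>w N. geometric w \<and> (\<forall>t. jet_fun w t = exp (\<i> * \<tau> * of_real t) * poly p (of_real t)) \<and>
     shift_poly ([:-\<tau>, 1:] ^ N) w = (\<lambda>n. 0)"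
proof (induction p)
  case 0
  show ?case
    by (intro exI[of _ "\<lambda>n. 0"] exI[of _ 0]) (simp add: geometric_zero jet_fun_zero)
next
  case (pCons a p)
  then obtain w N where w: "geometric w" "\<And>t. jet_fun w t = exp (\<i> * \<tau> * of_real t) * poly p (of_real t)"
    "shift_poly ([:-\<tau>, 1:] ^ N) w = (\<lambda>n. 0)" by blast
  let ?u = "\<lambda>n. a * \<tau> ^ n + times_t w n"
  have t: "geometric ?u" by (intro geometric_add geometric_cmult exp_seq geometric_times_t w)
  have "jet_fun ?u t = exp (\<i> * \<tau> * of_real t) * poly (pCons a p) (of_real t)" for t
    by (simp add: jet_fun_add geometric_cmult exp_seq geometric_times_t w jet_fun_cmult jet_fun_times_t
      algebra_simps)
  moreover have "shift_poly ([:-\<tau>, 1:] ^ Suc N) ?u = (\<lambda>n. 0)"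
  proof
    fix n
    have e: "shift_poly [:-\<tau>, 1:] (\<lambda>n. a * \<tau> ^ n) = (\<lambda>n. 0)"
      by (rule ext) (simp add: shift_linear)
    have z: "shift_poly ([:-\<tau>, 1:] ^ Suc N) w = (\<lambda>n. 0)"
      by (rule shift_poly_dvd[OF le_imp_power_dvd w(3)]) simp
    have "shift_poly ([:-\<tau>, 1:] ^ Suc N) (\<lambda>n. a * \<tau> ^ n) n = 0"
      by (simp only: power_Suc2 shift_poly_mult e shift_poly_zero)
    moreover have "shift_poly ([:-\<tau>, 1:] ^ Suc N) (times_t w) n = 0"
      unfolding shift_times_t z diff_Suc_1 w(3) by (simp add: times_t_def)
    ultimately show "shift_poly ([:-\<tau>, 1:] ^ Suc N) ?u n = 0"
      by (simp add: shift_poly_seq_add del: power_Suc)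
  qed
  ultimately show ?case using t by blast
qed

text \<open>Duhamel's principle for \<open>D\<^sub>t g - \<tau> g = h\<close>, in integrated form: the function \<open>exp (-\<i> \<tau> t)
  g(t)\<close> has the derivative \<open>\<i> exp (-\<i> \<tau> t) h(t)\<close>, and the mean value inequality replaces the
  integral.\<close>

lemma first_order_bound:
  assumes w: "geometric w" and lam: "\<mu> \<le> Im \<tau>" and t: "t \<ge> 0" and H: "H \<ge> 0"
    and h: "\<And>s. s \<ge> 0 \<Longrightarrow> norm (jet_fun (shift_poly [:-\<tau>, 1:] w) s) \<le> H * (1 + s) ^ k * exp (- \<mu> * s)"
  shows "norm (jet_fun w t) \<le> (norm (w 0) + t * (H * (1 + t) ^ k)) * exp (- \<mu> * t)"
proof -
  let ?h = "shift_poly [:-\<tau>, 1:] w"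
  define \<phi> where "\<phi> s = exp (- \<i> * \<tau> * of_real s) * jet_fun w s" for s
  have ne: "norm (exp (- \<i> * \<tau> * of_real s)) = exp (Im \<tau> * s)" for s
    by (simp add: norm_exp_eq_Re)
  have hs: "jet_fun ?h s = jet_fun (\<lambda>n. w (Suc n)) s - \<tau> * jet_fun w s" for s
    using jet_fun_add[OF geometric_shift[OF w, of 1] geometric_cmult[OF w, of "-\<tau>"], of s]
      jet_fun_cmult[OF w, of "-\<tau>" s]
    by (simp add: shift_linear[abs_def])
  have d: "(\<phi> has_vector_derivative (\<i> * exp (- \<i> * \<tau> * of_real s) * jet_fun ?h s))
    (at s within {0..t})" for s
  proof -
    have "((\<lambda>s. exp (- \<i> * \<tau> * of_real s)) has_vector_derivative (- \<i> * \<tau> * exp (- \<i> * \<tau> * of_real s)))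
      (at s within {0..t})"
      by (rule has_vector_derivative_at_within, rule has_vector_derivative_real_field)
         (auto intro!: derivative_eq_intros)
    from has_vector_derivative_mult[OF this
      has_vector_derivative_at_within[OF jet_fun_has_vector_derivative[OF w]]]
    show ?thesis unfolding \<phi>_def hs by (simp add: algebra_simps)
  qed
  let ?B = "H * (1 + t) ^ k * exp ((Im \<tau> - \<mu>) * t)"
  have bd: "norm (\<i> * exp (- \<i> * \<tau> * of_real s) * jet_fun ?h s) \<le> ?B" if s: "s \<in> {0..t}" for s
  proof -
    have "norm (\<i> * exp (- \<i> * \<tau> * of_real s) * jet_fun ?h s)
      \<le> exp (Im \<tau> * s) * (H * (1 + s) ^ k * exp (- \<mu> * s))"
      using h[of s] s by (simp add: norm_mult ne del: mult_minus_left)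
    also have "\<dots> = H * (1 + s) ^ k * exp ((Im \<tau> - \<mu>) * s)"
      by (simp add: exp_add[symmetric] algebra_simps)
    also have "\<dots> \<le> ?B"
      using s lam H by (intro mult_mono power_mono) (auto intro: mult_left_mono)
    finally show ?thesis .
  qed
  have "norm (\<phi> t - \<phi> 0) \<le> ?B * norm (t - 0)"
  proof (rule differentiable_bound[where S = "{0..t}"])
    show "(\<phi> has_derivative (\<lambda>u. u *\<^sub>R (\<i> * exp (- \<i> * \<tau> * of_real s) * jet_fun ?h s)))
      (at s within {0..t})" for s
      using d[of s] unfolding has_vector_derivative_def .
    show "onorm (\<lambda>u. u *\<^sub>R (\<i> * exp (- \<i> * \<tau> * of_real s) * jet_fun ?h s)) \<le> ?B" if "s \<in> {0..t}" for s
      using mult_left_mono[OF bd[OF that]] t H by (intro onorm_bound) (simp_all add: mult.commute)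
  qed (use t in auto)
  then have "norm (\<phi> t) \<le> norm (\<phi> 0) + ?B * t"
    using t norm_triangle_sub[of "\<phi> t" "\<phi> 0"] by simp
  also have "norm (\<phi> 0) = norm (w 0)" by (simp add: \<phi>_def jet_fun_0[OF w])
  finally have "norm (jet_fun w t) \<le> exp (- Im \<tau> * t) * (norm (w 0) + ?B * t)"
    unfolding \<phi>_def norm_mult ne by (simp add: exp_minus field_simps)
  also have "\<dots> = exp (- Im \<tau> * t) * norm (w 0) + t * (H * (1 + t) ^ k) *
    (exp (- Im \<tau> * t) * exp ((Im \<tau> - \<mu>) * t))"
    by (simp add: algebra_simps)
  also have "exp (- Im \<tau> * t) * exp ((Im \<tau> - \<mu>) * t) = exp (- \<mu> * t)"
    by (simp add: exp_add[symmetric] algebra_simps)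
  also have "exp (- Im \<tau> * t) * norm (w 0) \<le> exp (- \<mu> * t) * norm (w 0)"
    using lam t by (intro mult_right_mono) (auto intro: mult_right_mono)
  finally show ?thesis by (simp add: algebra_simps)
qed

text \<open>Solutions of \<open>\<Prod>\<^bsub>k \<le> L + 1\<^esub> (D\<^sub>t - \<tau>\<^sub>k) g = 0\<close> are peeled off one factor at a time. The
  constant depends only on \<open>L\<close> and on a common bound \<open>\<rho>\<close> for the roots and for the growth of the
  derivatives at 0, not on the distances between the roots; this makes the estimate uniform near
  coinciding roots.\<close>

lemma root_group_decay:
  assumes \<rho>: "\<rho> \<ge> 0"
  shows "\<exists>C\<ge>0. \<forall>w \<tau> \<mu> G t. (\<forall>n. norm (w n) \<le> G * \<rho> ^ n) \<longrightarrow>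
    (\<forall>k\<in>{1..Suc L}. norm (\<tau> k) \<le> \<rho> \<and> \<mu> \<le> Im (\<tau> k)) \<longrightarrow>
    shift_poly (\<Prod>k=1..Suc L. [:- \<tau> k, 1:]) w = (\<lambda>n. 0) \<longrightarrow> t \<ge> 0 \<longrightarrow>
    norm (jet_fun w t) \<le> C * G * (1 + t) ^ L * exp (- \<mu> * t)"
proof (induction L)
  case 0
  show ?case
  proof (intro exI[of _ 1] conjI allI impI)
    fix w :: "nat \<Rightarrow> complex" and \<tau> \<mu> G and t :: real
    assume a: "\<forall>n. norm (w n) \<le> G * \<rho> ^ n" "\<forall>k\<in>{1..Suc 0}. norm (\<tau> k) \<le> \<rho> \<and> \<mu> \<le> Im (\<tau> k)"
      "shift_poly (\<Prod>k=1..Suc 0. [:- \<tau> k, 1:]) w = (\<lambda>n. 0)" "0 \<le> t"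
    have "geometric w" using a(1) by (auto simp: geometric_def)
    then have "norm (jet_fun w t) \<le> (norm (w 0) + t * (0 * (1 + t) ^ 0)) * exp (- \<mu> * t)"
      using a by (intro first_order_bound[where \<tau> = "\<tau> 1"]) (auto simp: jet_fun_zero)
    also have "\<dots> \<le> 1 * G * (1 + t) ^ 0 * exp (- \<mu> * t)"
      using spec[OF a(1), of 0] by simp
    finally show "norm (jet_fun w t) \<le> 1 * G * (1 + t) ^ 0 * exp (- \<mu> * t)" .
  qed simp
next
  case (Suc L)
  then obtain C where C: "C \<ge> 0" and IH: "\<And>w \<tau> \<mu> G t. (\<forall>n. norm (w n) \<le> G * \<rho> ^ n) \<Longrightarrow>
    (\<forall>k\<in>{1..Suc L}. norm (\<tau> k) \<le> \<rho> \<and> \<mu> \<le> Im (\<tau> k)) \<Longrightarrow>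
    shift_poly (\<Prod>k=1..Suc L. [:- \<tau> k, 1:]) w = (\<lambda>n. 0) \<Longrightarrow> t \<ge> 0 \<Longrightarrow>
    norm (jet_fun w t) \<le> C * G * (1 + t) ^ L * exp (- \<mu> * t)" by blast
  show ?case
  proof (intro exI[of _ "1 + C * (2 * \<rho>)"] conjI allI impI)
    fix w :: "nat \<Rightarrow> complex" and \<tau> \<mu> G and t :: real
    assume a: "\<forall>n. norm (w n) \<le> G * \<rho> ^ n" "\<forall>k\<in>{1..Suc (Suc L)}. norm (\<tau> k) \<le> \<rho> \<and> \<mu> \<le> Im (\<tau> k)"
      "shift_poly (\<Prod>k=1..Suc (Suc L). [:- \<tau> k, 1:]) w = (\<lambda>n. 0)" "0 \<le> t"
    let ?\<tau> = "\<tau> (Suc (Suc L))"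
    \<comment> \<open>the image under the last factor solves the equation for the remaining roots\<close>
    let ?h = "shift_poly [:-?\<tau>, 1:] w"
    have tm: "geometric w" using a(1) by (auto simp: geometric_def)
    have w0: "norm (w 0) \<le> G" using spec[OF a(1), of 0] by simp
    then have G: "G \<ge> 0" using norm_ge_zero[of "w 0"] by linarith
    \<comment> \<open>this factor \<open>2 \<rho>\<close> enters the recursion \<open>C\<^sub>L\<^sub>+\<^sub>1 = 1 + 2 \<rho> C\<^sub>L\<close> for the constants\<close>
    have hb: "norm (?h n) \<le> (2 * \<rho> * G) * \<rho> ^ n" for n
    proof -
      have "norm (?h n) \<le> norm (w (Suc n)) + norm ?\<tau> * norm (w n)"
        unfolding shift_linear by (metis norm_mult norm_triangle_ineq4)
      also have "\<dots> \<le> G * \<rho> ^ Suc n + \<rho> * (G * \<rho> ^ n)"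
        using a(2) \<rho> by (intro add_mono mult_mono a(1)[rule_format]) auto
      finally show ?thesis by (simp add: algebra_simps)
    qed
    have "shift_poly (\<Prod>k=1..Suc L. [:- \<tau> k, 1:]) ?h = (\<lambda>n. 0)"
      using a(3) by (simp add: shift_poly_mult[symmetric])
    then have h: "norm (jet_fun ?h s) \<le> (C * (2 * \<rho> * G)) * (1 + s) ^ L * exp (- \<mu> * s)" if "s \<ge> 0" for s
      using IH[of ?h "2 * \<rho> * G" \<tau> \<mu> s] hb a(2) that by simp
    have "norm (jet_fun w t) \<le> (norm (w 0) + t * ((C * (2 * \<rho> * G)) * (1 + t) ^ L)) * exp (- \<mu> * t)"
      by (rule first_order_bound[where \<tau> = ?\<tau>, OF tm _ a(4) _ h]) (use a(2) C \<rho> G in auto)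
    also have "\<dots> \<le> (G * (1 + t) ^ Suc L + (1 + t) * ((C * (2 * \<rho> * G)) * (1 + t) ^ L)) * exp (- \<mu> * t)"
    proof (intro mult_right_mono add_mono)
      show "norm (w 0) \<le> G * (1 + t) ^ Suc L"
        using w0 mult_left_mono[OF one_le_power[of "1 + t" "Suc L"] G] a(4) by simp
    qed (use a(4) C \<rho> G in auto)
    also have "\<dots> = (1 + C * (2 * \<rho>)) * G * (1 + t) ^ Suc L * exp (- \<mu> * t)"
      by (simp add: algebra_simps)
    finally show "norm (jet_fun w t) \<le> (1 + C * (2 * \<rho>)) * G * (1 + t) ^ Suc L * exp (- \<mu> * t)" .
  qed (use C \<rho> in auto)
qed

lemma coprime_linear:
  fixes R :: "complex poly"
  assumes "poly R a \<noteq> 0" shows "coprime [:-a, 1:] R"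
proof (rule coprimeI)
  fix d assume "d dvd [:-a, 1:]" "d dvd R"
  then have "d dvd R - [:-a, 1:] * synthetic_div R a" by (simp add: dvd_diff del: mult_pCons_left)
  also have "\<dots> = [:poly R a:]" using synthetic_div_correct'[of a R] by (simp add: algebra_simps)
  finally show "is_unit d" using assms by (meson dvd_trans is_unit_const_poly_iff is_unit_triv dvd_field_iff)
qed

text \<open>The sum is annihilated by \<open>Q R\<close>, the summands a priori only by powers of \<open>Q\<close> and \<open>R\<close>, because
  amplitudes of coinciding roots may have spurious high degree terms that cancel. The image of \<open>w\<close>
  under \<open>Q R\<close> is minus that of \<open>v\<close>, hence annihilated by powers of both \<open>Q\<close> and \<open>R\<close>, hence 0.\<close>

lemma group_splitting:
  assumes QR: "coprime Q R" "shift_poly (Q * R) (\<lambda>n. w n + v n) = (\<lambda>n. 0)"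
    and w: "shift_poly (Q ^ N) w = (\<lambda>n. 0)" and v: "shift_poly (R ^ N') v = (\<lambda>n. 0)"
  shows "shift_poly Q w = (\<lambda>n. 0)" "shift_poly R v = (\<lambda>n. 0)"
proof -
  have c: "coprime (Q ^ N) (R ^ N')" "coprime R (Q ^ N)" "coprime Q (R ^ N')"
    using QR(1) by (auto simp: coprime_commute)
  let ?X = "shift_poly (Q * R) w"
  have X: "?X = (\<lambda>n. - shift_poly (Q * R) v n)"
    using QR(2) by (auto simp: fun_eq_iff shift_poly_seq_add eq_neg_iff_add_eq_0)
  have comm: "shift_poly p (shift_poly q u) = shift_poly q (shift_poly p u)" for p q u
    by (simp add: shift_poly_mult[symmetric] mult.commute)
  have 1: "shift_poly (Q ^ N) ?X = (\<lambda>n. 0)"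
    unfolding comm[of "Q ^ N"] w by simp
  have "shift_poly (R ^ N') (shift_poly (Q * R) v) = (\<lambda>n. 0)"
    unfolding comm[of "R ^ N'"] v by simp
  then have 2: "shift_poly (R ^ N') ?X = (\<lambda>n. 0)"
    unfolding X using shift_poly_lin[of "R ^ N'" "-1" _ 0] by (simp add: fun_eq_iff)
  \<comment> \<open>annihilated by coprime powers of \<open>Q\<close> and \<open>R\<close>\<close>
  have X0: "?X = (\<lambda>n. 0)" by (rule shift_poly_coprime[OF c(1) 1 2])
  show "shift_poly Q w = (\<lambda>n. 0)"
  proof (rule shift_poly_coprime[OF c(2)])
    show "shift_poly R (shift_poly Q w) = (\<lambda>n. 0)"
      using X0 by (simp add: shift_poly_mult comm[of Q R])
    show "shift_poly (Q ^ N) (shift_poly Q w) = (\<lambda>n. 0)"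
      unfolding comm[of "Q ^ N"] w by simp
  qed
  show "shift_poly R v = (\<lambda>n. 0)"
  proof (rule shift_poly_coprime[OF c(3)])
    show "shift_poly Q (shift_poly R v) = (\<lambda>n. 0)"
      using X X0 by (simp add: shift_poly_mult fun_eq_iff)
    show "shift_poly (R ^ N') (shift_poly R v) = (\<lambda>n. 0)"
      unfolding comm[of "R ^ N'"] v by simp
  qed
qed

text \<open>The factor of index \<open>k\<close> vanishes at \<open>\<tau>\<^sub>k\<close>, so the product is divisible by \<open>\<Prod>\<^sub>k (z - \<tau>\<^sub>k)\<close> and
  annihilates \<open>w\<close>; modulo \<open>R\<close> it is 1 and fixes \<open>v\<close>. In contrast to partial fractions, the formula
  involves only the differences between roots of different groups.\<close>

lemma group_projection:
  assumes nz: "\<And>k. k \<in> S \<Longrightarrow> poly R (\<tau> k) \<noteq> 0" and fin: "finite S"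
    and w: "shift_poly (\<Prod>k\<in>S. [:- \<tau> k, 1:]) w = (\<lambda>n. 0)" and v: "shift_poly R v = (\<lambda>n. 0)"
  shows "shift_poly (\<Prod>k\<in>S. 1 - smult (1 / poly R (\<tau> k)) R) (\<lambda>n. w n + v n) = v"
proof -
  let ?P = "\<Prod>k\<in>S. 1 - smult (1 / poly R (\<tau> k)) R"
  have "(\<Prod>k\<in>S. [:- \<tau> k, 1:]) dvd ?P"
    by (rule prod_dvd_prod) (use nz in \<open>auto simp: poly_eq_0_iff_dvd[symmetric]\<close>)
  then have 1: "shift_poly ?P w = (\<lambda>n. 0)" by (rule shift_poly_dvd[OF _ w])
  have "R dvd 1 - ?P"
    using fin
  proof (induction S rule: finite_induct)
    case (insert k S)
    have "1 - (\<Prod>k\<in>insert k S. 1 - smult (1 / poly R (\<tau> k)) R)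
      = (1 - (\<Prod>k\<in>S. 1 - smult (1 / poly R (\<tau> k)) R)) + R * smult (1 / poly R (\<tau> k))
        (\<Prod>k\<in>S. 1 - smult (1 / poly R (\<tau> k)) R)"
      using insert.hyps by (simp add: algebra_simps)
    then show ?case using insert.IH by (metis dvd_add dvd_triv_left)
  qed simp
  then have "shift_poly (1 - ?P) v = (\<lambda>n. 0)" by (rule shift_poly_dvd[OF _ v])
  then have "shift_poly ?P v n = v n" for n
    using shift_poly_diff[of 1 ?P v n] by simp
  then show ?thesis by (auto simp: shift_poly_seq_add 1)
qed

section \<open>Gaussian weights and the Plancherel inequality\<close>

text \<open>The Fourier transform of the weight \<open>exp (-x\<^sup>2 / (2 N\<^sup>2))\<close> on the line, of total mass \<open>2 \<pi>\<close>
  for every positive \<open>N\<close>.\<close>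

definition gauss_hat :: "real \<Rightarrow> real \<Rightarrow> real" where
  "gauss_hat N v = 2 * pi * normal_density 0 (1 / N) v"

text \<open>A rescaling of the characteristic function of the standard normal distribution.\<close>

lemma gaussian_char:
  assumes N: "N > 0"
  shows "(LINT x|lborel. iexp (t * x) * of_real (exp (- x\<^sup>2 / (2 * N\<^sup>2)))) = of_real (gauss_hat N t)"
    and "integrable lborel (\<lambda>x. iexp (t * x) * of_real (exp (- x\<^sup>2 / (2 * N\<^sup>2))))"
proof -
  have nd: "exp (- x\<^sup>2 / (2 * N\<^sup>2)) = sqrt (2 * pi) * N * normal_density 0 N x" for x
    using N by (simp add: normal_density_def real_sqrt_mult)
  have "integrable lborel (\<lambda>x. of_real (sqrt (2 * pi) * N) *
    (iexp (t * x) * of_real (normal_density 0 N x) :: complex))"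
    by (intro integrable_mult_right Bochner_Integration.integrable_bound[OF
      integrable_normal_density[OF N, of 0]])
       (auto simp: norm_mult)
  then show "integrable lborel (\<lambda>x. iexp (t * x) * of_real (exp (- x\<^sup>2 / (2 * N\<^sup>2))))"
    unfolding nd by (simp add: mult_ac)
  have "(LINT x|lborel. iexp (t * x) * of_real (exp (- x\<^sup>2 / (2 * N\<^sup>2)))) =
     N *\<^sub>R (LINT x|lborel. iexp (t * (0 + N * x)) * of_real (exp (- (0 + N * x)\<^sup>2 / (2 * N\<^sup>2))))"
    using N by (subst lborel_integral_real_affine[where c = N and t = 0]) auto
  also have "\<dots> = N *\<^sub>R (LINT x|lborel. of_real (sqrt (2 * pi)) * (std_normal_density x *\<^sub>R iexp (t * N * x)))"
    using N by (intro arg_cong[where f = "\<lambda>x. N *\<^sub>R x"] Bochner_Integration.integral_cong)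
      (auto simp: std_normal_density_def scaleR_conv_of_real power_mult_distrib mult_ac real_sqrt_mult)
  also have "\<dots> = N *\<^sub>R (of_real (sqrt (2 * pi)) * char std_normal_distribution (t * N))"
    unfolding char_def integral_mult_right_zero by (subst integral_density) (auto simp: normal_density_nonneg)
  also have "\<dots> = of_real (gauss_hat N t)"
  proof -
    have "N * (sqrt (2 * pi) * exp (- (t * N)\<^sup>2 / 2)) = gauss_hat N t"
      using N by (simp add: gauss_hat_def normal_density_def real_sqrt_mult real_sqrt_divide
        power_mult_distrib field_simps)
    then show ?thesis
      by (simp only: char_std_normal_distribution scaleR_conv_of_real of_real_mult[symmetric])
  qed
  finally show "(LINT x|lborel. iexp (t * x) * of_real (exp (- x\<^sup>2 / (2 * N\<^sup>2)))) = of_real (gauss_hat N t)" .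
qed

lemma lborel_integral_prod:
  fixes f :: "'a::euclidean_space \<Rightarrow> real \<Rightarrow> complex"
  assumes "\<And>b. b \<in> Basis \<Longrightarrow> integrable lborel (f b)"
  shows "(LINT x|lborel. (\<Prod>b\<in>Basis. f b (x \<bullet> b))) = (\<Prod>b\<in>Basis. LINT x|lborel. f b x)"
    and "integrable lborel (\<lambda>x. (\<Prod>b\<in>Basis. f b (x \<bullet> b)))"
proof -
  interpret product_sigma_finite "\<lambda>_::'a. lborel :: real measure" ..
  have [measurable]: "f b \<in> borel_measurable borel" if "b \<in> Basis" for b
    using assms[OF that] by auto
  have m: "(\<lambda>x::'a. \<Prod>b\<in>Basis. f b (x \<bullet> b)) \<in> borel_measurable borel" by measurable
  have m2: "(\<lambda>f. \<Sum>b\<in>Basis. f b *\<^sub>R b) \<in> (\<Pi>\<^sub>M b\<in>(Basis :: 'a set). lborel :: real measure) \<rightarrow>\<^sub>M borel"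
    by measurable
  show "(LINT x|lborel. (\<Prod>b\<in>Basis. f b (x \<bullet> b))) = (\<Prod>b\<in>Basis. LINT x|lborel. f b x)"
    unfolding lborel_eq[where 'a = 'a]
    by (subst integral_distr[OF m2 m]) (simp add: product_integral_prod assms)
  show "integrable lborel (\<lambda>x. (\<Prod>b\<in>Basis. f b (x \<bullet> b)))"
    unfolding lborel_eq[where 'a = 'a] integrable_distr_eq[OF m2 m]
    using product_integrable_prod[of Basis f] assms by simp
qed

definition gauss_weight :: "real \<Rightarrow> 'a::euclidean_space \<Rightarrow> real" where
  "gauss_weight N x = (\<Prod>b\<in>Basis. exp (- (x \<bullet> b)\<^sup>2 / (2 * N\<^sup>2)))"

definition gauss_kernel :: "real \<Rightarrow> 'a::euclidean_space \<Rightarrow> real" where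
  "gauss_kernel N x = (\<Prod>b\<in>Basis. gauss_hat N (x \<bullet> b))"

lemma gauss_measurable [measurable]:
  "gauss_weight N \<in> borel_measurable borel" "gauss_kernel N \<in> borel_measurable borel"
  unfolding gauss_weight_def[abs_def] gauss_kernel_def[abs_def] gauss_hat_def[abs_def] by measurable

lemma gauss_weight_bounds: "0 \<le> gauss_weight N x" "gauss_weight N x \<le> 1"
  unfolding gauss_weight_def by (auto intro!: prod_nonneg prod_le_1)

lemma gauss_kernel_nonneg: "0 \<le> gauss_kernel N x"
  unfolding gauss_kernel_def gauss_hat_def by (auto intro!: prod_nonneg)

lemma gauss_kernel_minus: "gauss_kernel N (x - y) = gauss_kernel N (y - x)"
  unfolding gauss_kernel_def gauss_hat_def normal_density_def
  by (simp add: inner_diff_left power2_commute)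

lemma gauss_weight_fourier:
  fixes u :: "'a::euclidean_space"
  assumes "N > 0"
  shows "(LINT x|lborel. iexp (u \<bullet> x) * of_real (gauss_weight N x)) = of_real (gauss_kernel N u)"
    and "integrable lborel (\<lambda>x. iexp (u \<bullet> x) * of_real (gauss_weight N x))"
proof -
  have e: "iexp (u \<bullet> x) * of_real (gauss_weight N x) =
     (\<Prod>b\<in>Basis. iexp ((u \<bullet> b) * (x \<bullet> b)) * of_real (exp (- (x \<bullet> b)\<^sup>2 / (2 * N\<^sup>2))))" for x
    by (subst euclidean_inner) (simp add: gauss_weight_def exp_sum[symmetric] sum_distrib_left prod.distrib
      exp_of_real[symmetric] del: exp_of_real)
  show "(LINT x|lborel. iexp (u \<bullet> x) * of_real (gauss_weight N x)) = of_real (gauss_kernel N u)"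
    unfolding e by (subst lborel_integral_prod)
      (use gaussian_char[OF assms] in \<open>simp_all add: gauss_kernel_def\<close>)
  show "integrable lborel (\<lambda>x. iexp (u \<bullet> x) * of_real (gauss_weight N x))"
    unfolding e by (rule lborel_integral_prod) (use gaussian_char[OF assms] in simp)
qed

lemma gauss_kernel_integral:
  assumes "N > 0"
  shows "(\<integral>\<^sup>+x. ennreal (gauss_kernel N (x :: 'a::euclidean_space)) \<partial>lborel) = ennreal ((2 * pi) ^ DIM('a))"
proof -
  have "(\<integral>\<^sup>+x. ennreal (gauss_kernel N (x :: 'a)) \<partial>lborel)
    = (\<integral>\<^sup>+x. (\<Prod>b\<in>Basis. ennreal (gauss_hat N (x \<bullet> b))) \<partial>(lborel :: 'a measure))"
    unfolding gauss_kernel_def by (intro nn_integral_cong prod_ennreal[symmetric]) (simp add: gauss_hat_def)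
  also have "\<dots> = (\<Prod>b\<in>(Basis :: 'a set). \<integral>\<^sup>+x. ennreal (gauss_hat N x) \<partial>lborel)"
    by (rule nn_integral_lborel_prod) (auto simp: gauss_hat_def[abs_def])
  also have "(\<integral>\<^sup>+x. ennreal (gauss_hat N x) \<partial>lborel) = ennreal (2 * pi)"
  proof -
    have "(\<integral>\<^sup>+x. ennreal (gauss_hat N x) \<partial>lborel) = ennreal (LINT x|lborel. gauss_hat N x)"
      using assms by (intro nn_integral_eq_integral) (auto simp: gauss_hat_def[abs_def])
    then show ?thesis using assms by (simp add: gauss_hat_def[abs_def])
  qed
  finally show ?thesis by (simp add: ennreal_power)
qed

lemma gauss_kernel_translate:
  assumes "N > 0"
  shows "(\<integral>\<^sup>+y. ennreal (gauss_kernel N (x - y :: 'a::euclidean_space)) \<partial>lborel)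
    = ennreal ((2 * pi) ^ DIM('a))"
proof -
  have "(\<integral>\<^sup>+y. ennreal (gauss_kernel N (x - y)) \<partial>lborel) = (\<integral>\<^sup>+y. ennreal (gauss_kernel N (- x + y)) \<partial>lborel)"
    by (simp add: gauss_kernel_minus[of N x])
  also have "\<dots> = (\<integral>\<^sup>+y. ennreal (gauss_kernel N y) \<partial>distr lborel borel ((+) (- x)))"
    by (subst nn_integral_distr) auto
  also have "\<dots> = ennreal ((2 * pi) ^ DIM('a))"
    by (simp only: lborel_distr_plus gauss_kernel_integral[OF assms])
  finally show ?thesis .
qed

lemma exp_i_integrable:
  assumes "integrable M g" "\<And>x. \<psi> x \<in> \<real>" "\<psi> \<in> borel_measurable M"
  shows "integrable M (\<lambda>x. exp (\<i> * \<psi> x) * g x :: complex)"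
proof (rule Bochner_Integration.integrable_bound[OF assms(1)])
  have "norm (exp (\<i> * \<psi> x)) = 1" for x
    using assms(2)[of x] by (auto elim!: Reals_cases)
  then show "AE x in M. norm (exp (\<i> * \<psi> x) * g x) \<le> norm (g x)" by (simp add: norm_mult)
qed (use assms in measurable)

lemma fourier_integrable:
  assumes "integrable lborel g"
  shows "integrable lborel (\<lambda>x. exp (- \<i> * of_real (x \<bullet> \<xi>)) * g x)"
  using exp_i_integrable[OF assms, of "\<lambda>x. - of_real (x \<bullet> \<xi>)"] by simp

lemma fourier_measurable:
  assumes [measurable]: "g \<in> borel_measurable borel"
  shows "fourier g \<in> borel_measurable borel"
  unfolding fourier_def[abs_def] by measurable

lemma fourier_norm_le:
  assumes "integrable lborel g"
  shows "norm (fourier g \<xi>) \<le> (LINT x|lborel. norm (g x))"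
  unfolding fourier_def
  using integral_norm_bound[of lborel "\<lambda>x. exp (- \<i> * of_real (x \<bullet> \<xi>)) * g x"]
  by (simp add: norm_mult)

text \<open>Fubini; the kernel is symmetric in the two variables.\<close>

lemma fourier_multiplication:
  fixes g h :: "real ^ 'n \<Rightarrow> complex"
  assumes g: "integrable lborel g" and h: "integrable lborel h"
  shows "(LINT \<xi>|lborel. fourier g \<xi> * h \<xi>) = (LINT x|lborel. g x * fourier h x)"
proof -
  have [measurable]: "g \<in> borel_measurable borel" "h \<in> borel_measurable borel" using g h by auto
  have i: "integrable (lborel \<Otimes>\<^sub>M lborel) (\<lambda>(x, \<xi>). exp (- \<i> * of_real (x \<bullet> \<xi>)) * g x * h \<xi>)"
  proof (rule lborel_pair.Fubini_integrable)
    show "integrable lborel (\<lambda>x. LINT y|lborel. norm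
      (case (x, y) of (x, \<xi>) \<Rightarrow> exp (- \<i> * of_real (x \<bullet> \<xi>)) * g x * h \<xi>))"
      using g by (simp add: norm_mult)
    show "AE x in lborel. integrable lborel
      (\<lambda>y. case (x, y) of (x, \<xi>) \<Rightarrow> exp (- \<i> * of_real (x \<bullet> \<xi>)) * g x * h \<xi>)"
    proof (rule AE_I2)
      fix x show "integrable lborel (\<lambda>y. case (x, y) of (x, \<xi>) \<Rightarrow> exp (- \<i> * of_real (x \<bullet> \<xi>)) * g x * h \<xi>)"
        using fourier_integrable[OF integrable_mult_right[OF h, of "g x"], of x]
          by (simp add: inner_commute mult_ac)
    qed
  qed measurable
  have "(LINT \<xi>|lborel. fourier g \<xi> * h \<xi>)
    = (LINT \<xi>|lborel. LINT x|lborel. exp (- \<i> * of_real (x \<bullet> \<xi>)) * g x * h \<xi>)"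
    unfolding fourier_def by simp
  also have "\<dots> = (LINT x|lborel. LINT \<xi>|lborel. exp (- \<i> * of_real (x \<bullet> \<xi>)) * g x * h \<xi>)"
    by (rule lborel_pair.Fubini_integral[OF i])
  also have "\<dots> = (LINT x|lborel. LINT \<xi>|lborel. g x * (exp (- \<i> * of_real (\<xi> \<bullet> x)) * h \<xi>))"
    by (simp add: inner_commute mult_ac)
  also have "\<dots> = (LINT x|lborel. g x * fourier h x)"
    unfolding fourier_def by simp
  finally show ?thesis .
qed

text \<open>With the weight, all integrals converge absolutely. Two applications of the multiplication
  formula turn the left-hand side into the quadratic form of the Gaussian kernel in \<open>g\<close>, and Schur's
  test bounds this form by the mass of the kernel, which does not depend on \<open>N\<close>.\<close>

lemma plancherel_weighted:
  fixes g :: "real ^ 'n \<Rightarrow> complex"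
  assumes g: "integrable lborel g" and N: "N > 0"
  shows "(\<integral>\<^sup>+\<xi>. ennreal ((norm (fourier g \<xi>))\<^sup>2 * gauss_weight N \<xi>) \<partial>lborel)
    \<le> ennreal ((2 * pi) ^ CARD('n)) * (\<integral>\<^sup>+x. ennreal ((norm (g x))\<^sup>2) \<partial>lborel)"
proof -
  let ?w = "\<lambda>\<xi>. (norm (fourier g \<xi>))\<^sup>2 * gauss_weight N \<xi>"
  let ?s = "\<lambda>x. ennreal ((norm (g x))\<^sup>2)" and ?k = "\<lambda>x y. ennreal (gauss_kernel N (x - y))"
  have [measurable]: "g \<in> borel_measurable borel" using g by auto
  have [measurable]: "fourier g \<in> borel_measurable borel" by (rule fourier_measurable) simp
  have [measurable]: "cnj \<in> borel_measurable borel"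
    by (intro borel_measurable_continuous_onI continuous_intros)
  have wint: "integrable lborel (\<lambda>\<xi>. of_real (gauss_weight N \<xi>) :: complex)"
    using gauss_weight_fourier(2)[OF N, of 0] by simp
  let ?I = "LINT x|lborel. norm (g x)"
  let ?A = "ennreal ((2 * pi) ^ CARD('n))"
  have wg: "integrable lborel (\<lambda>\<xi>. cnj (fourier g \<xi>) * of_real (gauss_weight N \<xi>))"
  proof (rule Bochner_Integration.integrable_bound[OF integrable_mult_right[OF wint, of "of_real ?I"]])
    show "AE \<xi> in lborel. norm (cnj (fourier g \<xi>) * of_real (gauss_weight N \<xi>))
      \<le> norm (of_real ?I * of_real (gauss_weight N \<xi>) :: complex)"
      using fourier_norm_le[OF g] by (intro AE_I2) (auto simp: norm_mult abs_mult intro!: mult_right_mono)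
  qed measurable
  let ?h = "\<lambda>\<xi>. cnj (fourier g \<xi>) * of_real (gauss_weight N \<xi>)"
  have [measurable]: "fourier ?h \<in> borel_measurable borel" by (rule fourier_measurable) measurable
  \<comment> \<open>by the multiplication formula, the transform of the weighted
    conjugate is a convolution of \<open>g\<close> with the Gaussian kernel\<close>
  have hhat: "ennreal (norm (fourier ?h x))
    \<le> (\<integral>\<^sup>+y. ennreal (norm (g y) * gauss_kernel N (x - y)) \<partial>lborel)" for x
  proof -
    let ?k = "\<lambda>\<xi>. iexp (x \<bullet> \<xi>) * of_real (gauss_weight N \<xi>)"
    have ki: "integrable lborel ?k" by (rule gauss_weight_fourier(2)[OF N])
    have kf: "fourier ?k y = of_real (gauss_kernel N (x - y))" for y
    proof -
      have "exp (- \<i> * of_real (\<xi> \<bullet> y)) * ?k \<xi> = iexp ((x - y) \<bullet> \<xi>) * of_real (gauss_weight N \<xi>)" for \<xi>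
        unfolding mult.assoc[symmetric] exp_add[symmetric]
        by (simp add: inner_diff_left inner_commute[of \<xi> y] right_diff_distrib)
      then show ?thesis unfolding fourier_def gauss_weight_fourier(1)[OF N, symmetric] by (simp only:)
    qed
    have c1: "cnj (fourier ?h x) = (LINT \<xi>|lborel. fourier g \<xi> * ?k \<xi>)"
    proof -
      have "cnj (exp (- \<i> * of_real (\<xi> \<bullet> x)) * ?h \<xi>) = fourier g \<xi> * ?k \<xi>" for \<xi>
        unfolding complex_cnj_mult exp_cnj by (simp add: inner_commute[of \<xi> x])
      then show ?thesis unfolding fourier_def[of ?h] Bochner_Integration.integral_cnj[symmetric]
        by (simp only:)
    qed
    have c2: "(LINT \<xi>|lborel. fourier g \<xi> * ?k \<xi>) = (LINT y|lborel. g y * of_real (gauss_kernel N (x - y)))"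
      using fourier_multiplication[OF g ki] by (simp only: kf)
    have c3: "ennreal (norm (LINT y|lborel. g y * of_real (gauss_kernel N (x - y))))
      \<le> (\<integral>\<^sup>+y. ennreal (norm (g y * of_real (gauss_kernel N (x - y)))) \<partial>lborel)"
      by (cases "integrable lborel (\<lambda>y. g y * of_real (gauss_kernel N (x - y)))")
        (auto intro: integral_norm_bound_ennreal simp: not_integrable_integral_eq)
    have c4: "norm (fourier ?h x) = norm (LINT y|lborel. g y * of_real (gauss_kernel N (x - y)))"
      unfolding c2[symmetric] c1[symmetric] by (rule complex_mod_cnj[symmetric])
    show ?thesis using c3 unfolding c4 by (simp add: norm_mult gauss_kernel_nonneg)
  qed
  have e1: "(\<integral>\<^sup>+\<xi>. ennreal (?w \<xi>) \<partial>lborel) = ennreal (LINT \<xi>|lborel. ?w \<xi>)"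
  proof (rule nn_integral_eq_integral)
    have "integrable lborel (\<lambda>\<xi>. norm (?h \<xi>) * ?I)"
      using wg by (intro integrable_mult_left integrable_norm)
    then show "integrable lborel (\<lambda>\<xi>. ?w \<xi>)"
    proof (rule Bochner_Integration.integrable_bound)
      show "AE \<xi> in lborel. norm (?w \<xi>) \<le> norm (norm (?h \<xi>) * ?I)"
      proof (rule AE_I2)
        fix \<xi>
        have "norm (fourier g \<xi>) * gauss_weight N \<xi> * norm (fourier g \<xi>)
          \<le> norm (fourier g \<xi>) * gauss_weight N \<xi> * ?I"
          using fourier_norm_le[OF g, of \<xi>] gauss_weight_bounds(1)
            by (intro mult_left_mono mult_nonneg_nonneg norm_ge_zero)
        moreover have "norm (?w \<xi>) = norm (fourier g \<xi>) * gauss_weight N \<xi> * norm (fourier g \<xi>)"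
          using gauss_weight_bounds(1)[of N \<xi>] by (simp add: abs_mult power2_eq_square)
        moreover have "?I \<ge> 0" by (rule Bochner_Integration.integral_nonneg) simp
        then have "norm (norm (?h \<xi>) * ?I) = norm (fourier g \<xi>) * gauss_weight N \<xi> * ?I"
          using gauss_weight_bounds(1)[of N \<xi>] by (simp add: norm_mult)
        ultimately show "norm (?w \<xi>) \<le> norm (norm (?h \<xi>) * ?I)"
          by (simp only:)
      qed
    qed measurable
  qed (simp add: gauss_weight_bounds(1))
  have e2: "(LINT \<xi>|lborel. ?w \<xi>) \<le> norm (LINT \<xi>|lborel. fourier g \<xi> * ?h \<xi>)"
  proof -
    have "(LINT \<xi>|lborel. fourier g \<xi> * ?h \<xi>) = (LINT \<xi>|lborel. of_real (?w \<xi>))"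
    proof -
      have "fourier g \<xi> * ?h \<xi> = of_real (?w \<xi>)" for \<xi>
        unfolding mult.assoc[symmetric] complex_norm_square[symmetric] by simp
      then show ?thesis by (simp only:)
    qed
    then show ?thesis by (simp only: integral_complex_of_real norm_of_real abs_ge_self)
  qed
  have e3: "(LINT \<xi>|lborel. fourier g \<xi> * ?h \<xi>) = (LINT x|lborel. g x * fourier ?h x)"
    by (rule fourier_multiplication[OF g wg])
  have e4: "ennreal (norm (LINT x|lborel. g x * fourier ?h x))
    \<le> (\<integral>\<^sup>+x. ennreal (norm (g x * fourier ?h x)) \<partial>lborel)"
    by (cases "integrable lborel (\<lambda>x. g x * fourier ?h x)")
        (auto intro: integral_norm_bound_ennreal simp: not_integrable_integral_eq)
  have "(\<integral>\<^sup>+\<xi>. ennreal (?w \<xi>) \<partial>lborel)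
     \<le> (\<integral>\<^sup>+x. ennreal (norm (g x * fourier ?h x)) \<partial>lborel)"
    using ennreal_leI[OF e2] e4 unfolding e1 e3 by (rule order_trans)
  also have "\<dots> \<le> (\<integral>\<^sup>+x. \<integral>\<^sup>+y. ennreal (norm (g x)) * ennreal
    (norm (g y) * gauss_kernel N (x - y)) \<partial>lborel \<partial>lborel)"
    by (intro nn_integral_mono) (simp add: norm_mult ennreal_mult nn_integral_cmult mult_left_mono hhat)
  also have "\<dots> \<le> (\<integral>\<^sup>+x. \<integral>\<^sup>+y. ennreal (1/2) * (?s x * ?k x y
      + ?s y * ?k x y) \<partial>lborel \<partial>lborel)"
  proof (intro nn_integral_mono)
    fix x y
    \<comment> \<open>the symmetric kernel has the same mass in both variables, so this suffices\<close>
    have "2 * (norm (g x) * norm (g y)) \<le> (norm (g x))\<^sup>2 + (norm (g y))\<^sup>2"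
      using sum_squares_bound[of "norm (g x)" "norm (g y)"] by simp
    from mult_right_mono[OF this gauss_kernel_nonneg[of N "x - y"]]
    have "norm (g x) * (norm (g y) * gauss_kernel N (x - y)) \<le>
       (1/2) * ((norm (g x))\<^sup>2 * gauss_kernel N (x - y) + (norm (g y))\<^sup>2 * gauss_kernel N (x - y))"
      by (simp add: algebra_simps)
    then show "ennreal (norm (g x)) * ennreal (norm (g y) * gauss_kernel N (x - y))
      \<le> ennreal (1/2) * (?s x * ?k x y
      + ?s y * ?k x y)"
      by (simp add: gauss_kernel_nonneg flip: ennreal_mult ennreal_plus del: ennreal_half)
  qed
  also have "\<dots> = ennreal (1/2) * ((\<integral>\<^sup>+x. \<integral>\<^sup>+y. ?s x * ?k x y \<partial>lborel \<partial>lborel)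
      + (\<integral>\<^sup>+x. \<integral>\<^sup>+y. ?s y * ?k x y \<partial>lborel \<partial>lborel))"
    by (simp add: nn_integral_cmult nn_integral_add del: ennreal_half)
  finally have fin: "(\<integral>\<^sup>+\<xi>. ennreal (?w \<xi>) \<partial>lborel)
    \<le> ennreal (1/2) * ((\<integral>\<^sup>+x. \<integral>\<^sup>+y. ?s x * ?k x y \<partial>lborel \<partial>lborel)
      + (\<integral>\<^sup>+x. \<integral>\<^sup>+y. ?s y * ?k x y \<partial>lborel \<partial>lborel))" .
  have tr1: "(\<integral>\<^sup>+y. ?k x y \<partial>lborel) = ?A" for x :: "real ^ 'n"
    using gauss_kernel_translate[OF N, of x] by simp
  then have tr2: "(\<integral>\<^sup>+x. ?k x y \<partial>lborel) = ?A" for y :: "real ^ 'n"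
    by (simp only: gauss_kernel_minus[of N _ y])
  have f1: "(\<integral>\<^sup>+x. \<integral>\<^sup>+y. ?s y * ?k x y \<partial>lborel \<partial>lborel) =
     (\<integral>\<^sup>+y. \<integral>\<^sup>+x. ?s y * ?k x y \<partial>lborel \<partial>lborel)"
    by (rule lborel_pair.Fubini') measurable
  have f2: "(\<lambda>y. \<integral>\<^sup>+x. ?s y * ?k x y \<partial>lborel) = (\<lambda>y. ?A * ?s y)"
    by (rule ext, subst nn_integral_cmult) (simp, simp only: tr2, rule mult.commute)
  have f3: "(\<lambda>x. \<integral>\<^sup>+y. ?s x * ?k x y \<partial>lborel) = (\<lambda>y. ?A * ?s y)"
    by (rule ext, subst nn_integral_cmult) (simp, simp only: tr1, rule mult.commute)
  have f4: "ennreal (1/2) * (X + X) = X" for X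
  proof -
    have "ennreal (1/2) * (X + X) = (ennreal (1/2) * ennreal 2) * X"
      by (simp add: mult.assoc flip: mult_2)
    also have "ennreal (1/2) * ennreal 2 = 1" by (subst ennreal_mult[symmetric]) auto
    finally show ?thesis by simp
  qed
  show ?thesis using fin unfolding f1 f2 f3 f4 by (simp add: nn_integral_cmult)
qed

text \<open>The weights tend to 1 as \<open>N\<close> grows, and Fatou's lemma removes them.\<close>

lemma plancherel_le:
  fixes g :: "real ^ 'n \<Rightarrow> complex"
  assumes g: "integrable lborel g"
  shows "(\<integral>\<^sup>+\<xi>. ennreal ((norm (fourier g \<xi>))\<^sup>2) \<partial>lborel)
    \<le> ennreal ((2 * pi) ^ CARD('n)) * (\<integral>\<^sup>+x. ennreal ((norm (g x))\<^sup>2) \<partial>lborel)"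
proof -
  have [measurable]: "g \<in> borel_measurable borel" using g by auto
  have [measurable]: "fourier g \<in> borel_measurable borel" by (rule fourier_measurable) simp
  let ?B = "ennreal ((2 * pi) ^ CARD('n)) * (\<integral>\<^sup>+x. ennreal ((norm (g x))\<^sup>2) \<partial>lborel)"
  have lim: "(\<lambda>N. gauss_weight (real (Suc N)) \<xi>) \<longlonglongrightarrow> 1" for \<xi> :: "real ^ 'n"
  proof -
    have "(\<lambda>N. exp (- (\<xi> \<bullet> b)\<^sup>2 / (2 * (real (Suc N))\<^sup>2))) \<longlonglongrightarrow> exp 0" for b :: "real ^ 'n"
      by (intro tendsto_exp real_tendsto_divide_at_top[OF tendsto_const]
           filterlim_tendsto_pos_mult_at_top[OF tendsto_const] filterlim_pow_at_top
           filterlim_compose[OF filterlim_real_sequentially filterlim_Suc]) auto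
    then have "(\<lambda>N. gauss_weight (real (Suc N)) \<xi>) \<longlonglongrightarrow> (\<Prod>b\<in>(Basis :: (real ^ 'n) set). exp 0)"
      unfolding gauss_weight_def by (rule tendsto_prod)
    then show ?thesis by simp
  qed
  have "(\<integral>\<^sup>+\<xi>. ennreal ((norm (fourier g \<xi>))\<^sup>2) \<partial>lborel) =
     (\<integral>\<^sup>+\<xi>. liminf (\<lambda>N. ennreal ((norm (fourier g \<xi>))\<^sup>2 * gauss_weight (real (Suc N)) \<xi>)) \<partial>lborel)"
  proof (intro nn_integral_cong)
    fix \<xi>
    have "(\<lambda>N. ennreal ((norm (fourier g \<xi>))\<^sup>2 * gauss_weight (real (Suc N)) \<xi>))
      \<longlonglongrightarrow> ennreal ((norm (fourier g \<xi>))\<^sup>2 * 1)"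
      by (intro tendsto_ennrealI tendsto_mult tendsto_const lim)
    then show "ennreal ((norm (fourier g \<xi>))\<^sup>2)
      = liminf (\<lambda>N. ennreal ((norm (fourier g \<xi>))\<^sup>2 * gauss_weight (real (Suc N)) \<xi>))"
      by (simp add: lim_imp_Liminf)
  qed
  also have "\<dots> \<le> liminf (\<lambda>N. (\<integral>\<^sup>+\<xi>. ennreal
    ((norm (fourier g \<xi>))\<^sup>2 * gauss_weight (real (Suc N)) \<xi>) \<partial>lborel))"
    by (rule nn_integral_liminf) measurable
  also have "\<dots> \<le> ?B"
    by (rule Liminf_le) (use plancherel_weighted[OF g] in auto)
  finally show ?thesis .
qed

section \<open>Fourier multipliers and interpolation\<close>

lemma lborel_reflect: "distr lborel borel uminus = (lborel :: 'a::euclidean_space measure)"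
  using lborel_affine[of "-1" "0 :: 'a"] by (simp add: density_1 one_ennreal_def[symmetric])

text \<open>Bounded measurable functions vanishing outside a bounded set: a class that contains the test
  functions and the symbols, is stable under truncation in height, and on which all Fourier
  integrals converge absolutely.\<close>

definition bdd_bsupp :: "(real ^ 'n \<Rightarrow> complex) \<Rightarrow> bool" where
  "bdd_bsupp f \<longleftrightarrow> f \<in> borel_measurable borel \<and> bounded (range f) \<and> bounded {x. f x \<noteq> 0}"

lemma bdd_bsupp_measurable: "bdd_bsupp f \<Longrightarrow> f \<in> borel_measurable borel"
  by (simp add: bdd_bsupp_def)

lemma bdd_bsuppE:
  assumes "bdd_bsupp f"
  obtains B R where "B \<ge> 0" "\<And>x. norm (f x) \<le> B * indicator (cball 0 R) x"
proof -
  obtain B where B: "\<And>x. norm (f x) \<le> B" using assms by (auto simp: bdd_bsupp_def bounded_iff)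
  obtain R where R: "\<And>x. f x \<noteq> 0 \<Longrightarrow> norm x \<le> R" using assms by (auto simp: bdd_bsupp_def bounded_iff)
  have "B \<ge> 0" using B[of 0] norm_ge_zero order_trans by blast
  moreover have "norm (f x) \<le> B * indicator (cball 0 R) x" for x
    using B[of x] R[of x] by (cases "f x = 0") (auto simp: indicator_def \<open>B \<ge> 0\<close>)
  ultimately show ?thesis using that by blast
qed

lemma bdd_bsupp_powr_integrable:
  fixes f :: "real ^ 'n \<Rightarrow> complex"
  assumes "bdd_bsupp f" "p > 0" shows "integrable lborel (\<lambda>x. norm (f x) powr p)"
proof -
  obtain B R where b: "B \<ge> 0" "\<And>x. norm (f x) \<le> B * indicator (cball 0 R) x"
    using bdd_bsuppE[OF assms(1)] by metis
  have [measurable]: "f \<in> borel_measurable borel" using assms by (simp add: bdd_bsupp_def)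
  have "integrable lborel (\<lambda>x :: real ^ 'n. B powr p * indicat_real (cball 0 R) x)"
    by (intro integrable_mult_right integrable_real_indicator)
      (use emeasure_bounded_finite[OF bounded_cball, of "0 :: real ^ 'n" R] in \<open>auto simp:
      infinity_ennreal_def\<close>)
  then show ?thesis
  proof (rule Bochner_Integration.integrable_bound)
    have "norm (f x) powr p \<le> B powr p * indicat_real (cball 0 R) x" for x
      using powr_mono2[of p "norm (f x)" "B * indicator (cball 0 R) x"] b(2)[of x] assms(2)
        by (auto simp: indicator_def)
    then show "AE x in lborel. norm (norm (f x) powr p) \<le> norm (B powr p * indicat_real (cball 0 R) x)"
      by (intro AE_I2) (auto intro: order_trans)
  qed measurable
qed

lemma bdd_bsupp_integrable:
  fixes f :: "real ^ 'n \<Rightarrow> complex"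
  assumes "bdd_bsupp f" shows "integrable lborel f"
proof -
  have "integrable lborel (\<lambda>x. norm (f x))"
    using bdd_bsupp_powr_integrable[OF assms, of 1] by simp
  then show ?thesis using bdd_bsupp_measurable[OF assms] by (subst integrable_norm_cancel) auto
qed

lemma bdd_bsupp_mult:
  assumes "bdd_bsupp f" "g \<in> borel_measurable borel" "\<And>x. norm (g x) \<le> B"
  shows "bdd_bsupp (\<lambda>x. f x * g x)"
proof -
  have [measurable]: "f \<in> borel_measurable borel" "g \<in> borel_measurable borel" using assms
    by (auto simp: bdd_bsupp_def)
  obtain C where C: "\<And>x. norm (f x) \<le> C" using assms(1) by (auto simp: bdd_bsupp_def bounded_iff)
  have "norm (f x * g x) \<le> C * B" for x
    unfolding norm_mult by (intro mult_mono C assms(3)) (auto intro: order_trans[OF norm_ge_zero C])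
  then have "bounded (range (\<lambda>x. f x * g x))" by (auto simp: bounded_iff)
  moreover have "bounded {x. f x * g x \<noteq> 0}"
    by (rule bounded_subset[of "{x. f x \<noteq> 0}"]) (use assms in \<open>auto simp: bdd_bsupp_def\<close>)
  ultimately show ?thesis by (simp add: bdd_bsupp_def)
qed

text \<open>The inverse transform is the transform at the reflected point, up to the factor \<open>(2 \<pi>)\<^sup>-\<^sup>n\<close>,
  which is left out here as in the localized wave.\<close>

definition multiplier :: "(real ^ 'n \<Rightarrow> complex) \<Rightarrow> (real ^ 'n \<Rightarrow> complex) \<Rightarrow> real ^ 'n \<Rightarrow> complex" where
  "multiplier \<mu> f x = fourier (\<lambda>\<xi>. \<mu> \<xi> * fourier f \<xi>) (- x)"

lemma bdd_bsupp_mult_fourier: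
  assumes "bdd_bsupp \<mu>" "bdd_bsupp f" shows "bdd_bsupp (\<lambda>\<xi>. \<mu> \<xi> * fourier f \<xi>)"
  using assms
  by (intro bdd_bsupp_mult[OF _ fourier_measurable fourier_norm_le])
    (auto intro: bdd_bsupp_measurable bdd_bsupp_integrable)

lemma multiplier_measurable:
  assumes "bdd_bsupp \<mu>" "bdd_bsupp f" shows "multiplier \<mu> f \<in> borel_measurable borel"
  unfolding multiplier_def[abs_def]
  by (rule measurable_compose[OF _ fourier_measurable])
    (auto intro!: bdd_bsupp_measurable bdd_bsupp_mult_fourier assms)

text \<open>The endpoint from exponent 1 to exponent infinity.\<close>

lemma multiplier_sup:
  assumes \<mu>: "bdd_bsupp \<mu>" and f: "bdd_bsupp f" and M: "(LINT \<xi>|lborel. norm (\<mu> \<xi>)) \<le> M"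
  shows "norm (multiplier \<mu> f x) \<le> M * (LINT x|lborel. norm (f x))"
proof -
  have "norm (multiplier \<mu> f x) \<le> (LINT \<xi>|lborel. norm (\<mu> \<xi> * fourier f \<xi>))"
    unfolding multiplier_def by (rule fourier_norm_le[OF
      bdd_bsupp_integrable[OF bdd_bsupp_mult_fourier[OF \<mu> f]]])
  also have "\<dots> \<le> (LINT \<xi>|lborel. norm (\<mu> \<xi>) * (LINT x|lborel. norm (f x)))"
    using fourier_norm_le[OF bdd_bsupp_integrable[OF f]]
    by (intro integral_mono integrable_norm integrable_mult_left bdd_bsupp_integrable
      bdd_bsupp_mult_fourier \<mu> f)
      (auto simp: norm_mult intro!: mult_left_mono)
  also have "\<dots> = (LINT \<xi>|lborel. norm (\<mu> \<xi>)) * (LINT x|lborel. norm (f x))" by simp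
  also have "\<dots> \<le> M * (LINT x|lborel. norm (f x))"
    by (intro mult_right_mono M Bochner_Integration.integral_nonneg) auto
  finally show ?thesis .
qed

text \<open>The endpoint of exponent 2: Plancherel's inequality is applied to \<open>f\<close> and to \<open>\<mu>\<close> times its
  transform.\<close>

lemma multiplier_L2:
  fixes f :: "real ^ 'n \<Rightarrow> complex"
  assumes \<mu>: "bdd_bsupp \<mu>" and f: "bdd_bsupp f" and M: "\<And>\<xi>. norm (\<mu> \<xi>) \<le> M"
  shows "(\<integral>\<^sup>+x. ennreal ((norm (multiplier \<mu> f x))\<^sup>2) \<partial>lborel)
     \<le> ennreal (((2 * pi) ^ CARD('n) * M)\<^sup>2) * (\<integral>\<^sup>+x. ennreal ((norm (f x))\<^sup>2) \<partial>lborel)"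
proof -
  let ?g = "\<lambda>\<xi>. \<mu> \<xi> * fourier f \<xi>"
  let ?A = "(2 * pi) ^ CARD('n)"
  have M0: "M \<ge> 0" using M[of 0] norm_ge_zero order_trans by blast
  have [measurable]: "fourier ?g \<in> borel_measurable borel" "fourier f \<in> borel_measurable borel"
    by (auto intro!: fourier_measurable intro: bdd_bsupp_measurable[OF bdd_bsupp_mult_fourier[OF \<mu> f]]
      bdd_bsupp_measurable[OF f])
  have "(\<integral>\<^sup>+x. ennreal ((norm (multiplier \<mu> f x))\<^sup>2) \<partial>lborel)
    = (\<integral>\<^sup>+x. ennreal ((norm (fourier ?g x))\<^sup>2) \<partial>(distr lborel borel uminus))"
    unfolding multiplier_def by (subst nn_integral_distr) auto
  also have "\<dots> = (\<integral>\<^sup>+x. ennreal ((norm (fourier ?g x))\<^sup>2) \<partial>lborel)"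
    by (simp only: lborel_reflect)
  also have "\<dots> \<le> ennreal ?A * (\<integral>\<^sup>+x. ennreal ((norm (?g x))\<^sup>2) \<partial>lborel)"
    by (rule plancherel_le[OF bdd_bsupp_integrable[OF bdd_bsupp_mult_fourier[OF \<mu> f]]])
  also have "\<dots> \<le> ennreal ?A * (\<integral>\<^sup>+x. ennreal (M\<^sup>2) * ennreal ((norm (fourier f x))\<^sup>2) \<partial>lborel)"
  proof (intro mult_left_mono nn_integral_mono)
    fix x
    have "(norm (?g x))\<^sup>2 \<le> M\<^sup>2 * (norm (fourier f x))\<^sup>2"
      unfolding norm_mult power_mult_distrib using M[of x] by (intro mult_right_mono power_mono) auto
    then show "ennreal ((norm (?g x))\<^sup>2) \<le> ennreal (M\<^sup>2) * ennreal ((norm (fourier f x))\<^sup>2)"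
      by (simp add: ennreal_mult[symmetric])
  qed simp
  also have "\<dots> = ennreal ?A * (ennreal (M\<^sup>2) * (\<integral>\<^sup>+x. ennreal ((norm (fourier f x))\<^sup>2) \<partial>lborel))"
    by (simp add: nn_integral_cmult)
  also have "\<dots> \<le> ennreal ?A * (ennreal (M\<^sup>2) * (ennreal ?A * (\<integral>\<^sup>+x. ennreal ((norm (f x))\<^sup>2) \<partial>lborel)))"
    by (intro mult_left_mono plancherel_le[OF bdd_bsupp_integrable[OF f]]) auto
  also have "\<dots> = (ennreal ?A * (ennreal (M\<^sup>2) * ennreal ?A)) * (\<integral>\<^sup>+x. ennreal ((norm (f x))\<^sup>2) \<partial>lborel)"
    by (simp only: mult.assoc)
  also have "ennreal ?A * (ennreal (M\<^sup>2) * ennreal ?A) = ennreal ((?A * M)\<^sup>2)"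
    by (simp only: ennreal_mult[symmetric] zero_le_power2 zero_le_power pi_ge_zero mult_nonneg_nonneg
      zero_le_numeral)
      (simp add: power2_eq_square mult_ac)
  finally show ?thesis .
qed

lemma multiplier_add:
  assumes \<mu>: "bdd_bsupp \<mu>" and f: "bdd_bsupp f" and g: "bdd_bsupp g"
  shows "multiplier \<mu> (\<lambda>x. f x + g x) x = multiplier \<mu> f x + multiplier \<mu> g x"
proof -
  have "fourier (\<lambda>x. f x + g x) \<xi> = fourier f \<xi> + fourier g \<xi>" for \<xi>
    unfolding fourier_def ring_distribs
    by (intro Bochner_Integration.integral_add fourier_integrable bdd_bsupp_integrable f g)
  moreover have "fourier (\<lambda>\<xi>. \<mu> \<xi> * fourier f \<xi> + \<mu> \<xi> * fourier g \<xi>) (-x) =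
     fourier (\<lambda>\<xi>. \<mu> \<xi> * fourier f \<xi>) (-x) + fourier (\<lambda>\<xi>. \<mu> \<xi> * fourier g \<xi>) (-x)"
    unfolding fourier_def[of _ "-x"] ring_distribs
    by (intro Bochner_Integration.integral_add fourier_integrable bdd_bsupp_integrable
      bdd_bsupp_mult_fourier \<mu> f g)
  ultimately show ?thesis by (simp add: multiplier_def ring_distribs)
qed

lemma nn_integral_powr_0:
  assumes "a > -1" "c \<ge> 0"
  shows "(\<integral>\<^sup>+z. indicator {0..c} z * ennreal (z powr a) \<partial>lborel) = ennreal (c powr (a + 1) / (a + 1))"
  using nn_integral_has_integral_lebesgue'[OF _ has_integral_powr_from_0[OF assms]]
  by (simp add: mult.commute)

lemma layer_cake:
  fixes F :: "real ^ 'n \<Rightarrow> complex"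
  assumes [measurable]: "F \<in> borel_measurable borel" and q: "q > 0"
  shows "(\<integral>\<^sup>+x. ennreal (norm (F x) powr q) \<partial>lborel) =
    (\<integral>\<^sup>+z. \<integral>\<^sup>+x. ennreal (q * z powr (q - 1)) * indicator {0..norm (F x)} z \<partial>lborel \<partial>lborel)"
proof -
  let ?I = "\<lambda>x z. ennreal (q * z powr (q - 1)) * indicator {0..norm (F x)} z"
  have "(\<integral>\<^sup>+x. ennreal (norm (F x) powr q) \<partial>lborel) =
    (\<integral>\<^sup>+x. \<integral>\<^sup>+z. ?I x z \<partial>lborel \<partial>lborel)"
  proof (intro nn_integral_cong)
    fix x
    have "(\<integral>\<^sup>+z. ?I x z \<partial>lborel) =
      (\<integral>\<^sup>+z. ennreal q * (indicator {0..norm (F x)} z * ennreal (z powr (q - 1))) \<partial>lborel)"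
      using q by (intro nn_integral_cong) (simp add: ennreal_mult mult_ac)
    also have "\<dots> = ennreal q * ennreal (norm (F x) powr q / q)"
      using nn_integral_powr_0[of "q - 1" "norm (F x)"] q by (simp add: nn_integral_cmult)
    also have "\<dots> = ennreal (norm (F x) powr q)" using q by (simp add: ennreal_mult[symmetric])
    finally show "ennreal (norm (F x) powr q) = (\<integral>\<^sup>+z. ?I x z \<partial>lborel)" ..
  qed
  also have "\<dots> = (\<integral>\<^sup>+z. \<integral>\<^sup>+x. ?I x z \<partial>lborel \<partial>lborel)"
  proof (rule lborel_pair.Fubini'[symmetric])
    have "(\<lambda>(x, z). ?I x z) =
      (\<lambda>(x, z). if 0 \<le> z \<and> z \<le> norm (F x) then ennreal (q * z powr (q - 1)) else 0)"
      by (auto simp: fun_eq_iff indicator_def)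
    also have "\<dots> \<in> borel_measurable (lborel \<Otimes>\<^sub>M lborel)" by measurable
    finally show "(\<lambda>(x, z). ?I x z) \<in> borel_measurable (lborel \<Otimes>\<^sub>M lborel)" .
  qed
  finally show ?thesis .
qed

text \<open>The argument of Marcinkiewicz. To measure the set where the image exceeds \<open>z\<close>, the function is
  cut at a height \<open>\<gamma> z\<close>: the part above it has small mass, so that its image is at most \<open>z / 2\<close>
  everywhere by the supremum bound, and the part below it is treated by Chebyshev's inequality and
  the bound for exponent 2. Integration over \<open>z\<close> then gives strong type, since the endpoint at
  infinity is an everywhere bound.\<close>

lemma multiplier_interpolation:
  fixes f :: "real ^ 'n \<Rightarrow> complex"
  assumes \<mu>: "bdd_bsupp \<mu>" and f: "bdd_bsupp f" and M0: "\<And>\<xi>. norm (\<mu> \<xi>) \<le> M0"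
    and M1: "(LINT \<xi>|lborel. norm (\<mu> \<xi>)) \<le> M1" "M1 > 0" and p: "1 < p" "p < 2" and q: "q = p / (p - 1)"
    and I: "I = (LINT x|lborel. norm (f x) powr p)" "I > 0"
  shows "(\<integral>\<^sup>+x. ennreal (norm (multiplier \<mu> f x) powr q) \<partial>lborel)
     \<le> ennreal (4 * q * 2 powr (q - 2) / (q - 2) * ((2 * pi) ^ CARD('n) * M0)\<^sup>2 * M1 powr (q - 2) * I
       powr (q - 1))"
proof -
  let ?A = "((2 * pi) ^ CARD('n) * M0)\<^sup>2"
  let ?I = "\<lambda>x z. ennreal (q * z powr (q - 1)) * indicator {0..norm (multiplier \<mu> f x)} z"
  define \<kappa> where "\<kappa> = 2 * M1 * I"
  have \<kappa>: "\<kappa> > 0" using M1 I by (simp add: \<kappa>_def)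
  have q2: "q > 2" using p by (simp add: q field_simps)
  have pq: "(1 - p) * (q - 2) + 2 = p" using p by (simp add: q field_simps)
  have fm [measurable]: "f \<in> borel_measurable borel" by (rule bdd_bsupp_measurable[OF f])
  have [measurable]: "multiplier \<mu> f \<in> borel_measurable borel" by (rule multiplier_measurable[OF \<mu> f])
  \<comment> \<open>the height at which the large part of \<open>f\<close> has mass at most \<open>z / (2 M1)\<close>\<close>
  define \<gamma> where "\<gamma> z = (\<kappa> / z) powr (1 / (p - 1))" for z
  have [measurable]: "\<gamma> \<in> borel_measurable borel" unfolding \<gamma>_def[abs_def] by measurable
  define H where "H x z = (if 0 < z \<and> norm (f x)
    \<le> \<gamma> z then ennreal (z powr (q - 3)) * ennreal ((norm (f x))\<^sup>2) else 0)" for x z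
  have [measurable]: "case_prod H \<in> borel_measurable (lborel \<Otimes>\<^sub>M lborel)" unfolding H_def[abs_def]
    by measurable
  define big where "big z x = f x * (if norm (f x) > \<gamma> z then 1 else 0)" for z x
  define small where "small z x = f x * (if norm (f x) \<le> \<gamma> z then 1 else 0)" for z x
  have bb: "bdd_bsupp (big z)" "bdd_bsupp (small z)" for z
    unfolding big_def[abs_def] small_def[abs_def] by (rule bdd_bsupp_mult[OF f, where B = 1]; simp)+
  have split: "multiplier \<mu> f x = multiplier \<mu> (big z) x + multiplier \<mu> (small z) x" for z x
  proof -
    have "f = (\<lambda>x. big z x + small z x)" by (auto simp: big_def small_def fun_eq_iff)
    then show ?thesis using multiplier_add[OF \<mu> bb(1) bb(2), of z z x] by simp
  qed
  have bigsup: "norm (multiplier \<mu> (big z) x) \<le> z / 2" if z: "z > 0" for z x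
  proof -
    have g: "\<gamma> z > 0" and gp: "\<gamma> z powr (p - 1) = \<kappa> / z"
      using z \<kappa> p by (auto simp: \<gamma>_def powr_powr)
    have "(LINT x|lborel. norm (big z x)) \<le> (LINT x|lborel. (z / \<kappa>) * norm (f x) powr p)"
    proof (intro integral_mono)
      show "integrable lborel (\<lambda>x. norm (big z x))" by (intro integrable_norm bdd_bsupp_integrable bb)
      show "integrable lborel (\<lambda>x. (z / \<kappa>) * norm (f x) powr p)"
        using bdd_bsupp_powr_integrable[OF f, of p] p by simp
      fix x show "norm (big z x) \<le> (z / \<kappa>) * norm (f x) powr p"
      proof (cases "norm (f x) > \<gamma> z")
        case True
        then have "\<kappa> / z \<le> norm (f x) powr (p - 1)"
          unfolding gp[symmetric] using g p by (intro powr_mono2) auto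
        then have "norm (f x) * 1 \<le> norm (f x) * ((z / \<kappa>) * norm (f x) powr (p - 1))"
          using z \<kappa> by (intro mult_left_mono) (auto simp: field_simps)
        also have "\<dots> = (z / \<kappa>) * norm (f x) powr p"
          using True g by (simp add: powr_mult_base)
        finally show ?thesis using True by (simp add: big_def)
      qed (use z \<kappa> in \<open>auto simp: big_def\<close>)
    qed
    also have "\<dots> = z / (2 * M1)" using M1 I \<kappa> by (simp add: I(1)[symmetric] \<kappa>_def)
    finally have b: "(LINT x|lborel. norm (big z x)) \<le> z / (2 * M1)" .
    have "norm (multiplier \<mu> (big z) x) \<le> M1 * (LINT x|lborel. norm (big z x))"
      by (rule multiplier_sup[OF \<mu> bb(1) M1(1)])
    also have "\<dots> \<le> M1 * (z / (2 * M1))" using b M1 by (intro mult_left_mono) auto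
    finally show ?thesis using M1 by simp
  qed
  have "(\<integral>\<^sup>+x. ennreal (norm (multiplier \<mu> f x) powr q) \<partial>lborel) =
    (\<integral>\<^sup>+z. \<integral>\<^sup>+x. ?I x z \<partial>lborel \<partial>lborel)"
    using q2 by (intro layer_cake) auto
  also have "\<dots> \<le> (\<integral>\<^sup>+z. \<integral>\<^sup>+x. ennreal (4 * q * ?A) * H x z \<partial>lborel \<partial>lborel)"
  proof (rule nn_integral_mono)
    fix z :: real
    show "(\<integral>\<^sup>+x. ?I x z \<partial>lborel)
      \<le> (\<integral>\<^sup>+x. ennreal (4 * q * ?A) * H x z \<partial>lborel)"
    proof (cases "z > 0")
      case False
      then show ?thesis by (cases "z = 0") auto
    next
      case z: True
      have [measurable]: "multiplier \<mu> (small z) \<in> borel_measurable borel"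
        by (rule multiplier_measurable[OF \<mu> bb(2)])
      have zz: "z powr (q - 1) = z powr (q - 3) * z\<^sup>2"
      proof -
        have "z powr (q - 1) = z powr (q - 3) * z powr 2" unfolding powr_add[symmetric] by simp
        then show ?thesis using z by simp
      qed
      have "(\<integral>\<^sup>+x. ?I x z \<partial>lborel)
        \<le> (\<integral>\<^sup>+x. ennreal (4 * q * z powr (q - 3)) * ennreal ((norm (multiplier \<mu> (small z) x))\<^sup>2) \<partial>lborel)"
      proof (rule nn_integral_mono)
        fix x
        show "?I x z \<le>
          ennreal (4 * q * z powr (q - 3)) * ennreal ((norm (multiplier \<mu> (small z) x))\<^sup>2)"
        proof (cases "z \<le> norm (multiplier \<mu> f x)")
          case True
          have "z / 2 \<le> norm (multiplier \<mu> (small z) x)"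
            using True bigsup[OF z, of x]
              norm_triangle_ineq[of "multiplier \<mu> (big z) x" "multiplier \<mu> (small z) x"]
            unfolding split[of x z] by linarith
          then have "(z / 2)\<^sup>2 \<le> (norm (multiplier \<mu> (small z) x))\<^sup>2" using z by (intro power_mono) auto
          then have "4 * q * z powr (q - 3) * (z / 2)\<^sup>2
            \<le> 4 * q * z powr (q - 3) * (norm (multiplier \<mu> (small z) x))\<^sup>2"
            using q2 by (intro mult_left_mono) auto
          then have "q * z powr (q - 1) \<le> 4 * q * z powr (q - 3) * (norm (multiplier \<mu> (small z) x))\<^sup>2"
            unfolding zz by (simp add: power2_eq_square)
          then show ?thesis using True z q2 by (simp add: ennreal_mult[symmetric] ennreal_leI)
        qed auto
      qed
      also have "\<dots> = ennreal (4 * q * z powr (q - 3)) *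
        (\<integral>\<^sup>+x. ennreal ((norm (multiplier \<mu> (small z) x))\<^sup>2) \<partial>lborel)"
        by (simp add: nn_integral_cmult)
      also have "\<dots> \<le> ennreal (4 * q * z powr (q - 3)) *
        (ennreal ?A * (\<integral>\<^sup>+x. ennreal ((norm (small z x))\<^sup>2) \<partial>lborel))"
        by (intro mult_left_mono multiplier_L2[OF \<mu> bb(2) M0]) simp
      also have "\<dots> = (\<integral>\<^sup>+x. (ennreal (4 * q * z powr (q - 3)) * ennreal ?A) * ennreal
        ((norm (small z x))\<^sup>2) \<partial>lborel)"
        using bdd_bsupp_measurable[OF bb(2)] by (simp add: nn_integral_cmult mult.assoc)
      also have "\<dots> = (\<integral>\<^sup>+x. ennreal (4 * q * ?A) * H x z \<partial>lborel)"
        using z q2 by (intro nn_integral_cong) (auto simp: small_def H_def ennreal_mult[symmetric] mult_ac)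
      finally show ?thesis .
    qed
  qed
  also have "\<dots> = (\<integral>\<^sup>+x. \<integral>\<^sup>+z. ennreal (4 * q * ?A) * H x z \<partial>lborel \<partial>lborel)"
    by (rule lborel_pair.Fubini') measurable
  also have "\<dots> \<le> (\<integral>\<^sup>+x. ennreal (4 * q * ?A * \<kappa> powr (q - 2) / (q - 2)) * ennreal
    (norm (f x) powr p) \<partial>lborel)"
  proof (rule nn_integral_mono)
    fix x
    show "(\<integral>\<^sup>+z. ennreal (4 * q * ?A) * H x z \<partial>lborel)
      \<le> ennreal (4 * q * ?A * \<kappa> powr (q - 2) / (q - 2)) * ennreal (norm (f x) powr p)"
    proof (cases "f x = 0")
      case True
      have "(\<integral>\<^sup>+z. ennreal (4 * q * ?A) * H x z \<partial>lborel) = (\<integral>\<^sup>+z. 0 \<partial>(lborel :: real measure))"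
        using True by (intro nn_integral_cong) (auto simp: H_def)
      then show ?thesis by simp
    next
      case False
      let ?c = "\<kappa> * norm (f x) powr (1 - p)"
      \<comment> \<open>\<open>z\<close> contributes at \<open>x\<close> only as long as \<open>f x\<close> lies below the cut\<close>
      have le: "z \<le> ?c" if "0 < z" "norm (f x) \<le> \<gamma> z" for z
      proof -
        have "norm (f x) powr (p - 1) \<le> \<gamma> z powr (p - 1)" using that p by (intro powr_mono2) auto
        also have "\<dots> = \<kappa> / z" using that \<kappa> p by (auto simp: \<gamma>_def powr_powr)
        finally have "z * norm (f x) powr (p - 1) \<le> \<kappa>" using that by (simp add: field_simps)
        then have "z * norm (f x) powr (p - 1) * norm (f x) powr (1 - p) \<le> \<kappa> * norm (f x) powr (1 - p)"
          by (intro mult_right_mono) auto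
        then show ?thesis using False by (simp add: mult.assoc powr_add[symmetric])
      qed
      have "(\<integral>\<^sup>+z. ennreal (4 * q * ?A) * H x z \<partial>lborel)
       \<le> (\<integral>\<^sup>+z. (ennreal (4 * q * ?A) * ennreal ((norm (f x))\<^sup>2)) *
         (indicator {0..?c} z * ennreal (z powr (q - 3))) \<partial>lborel)"
        using le by (intro nn_integral_mono) (auto simp: H_def indicator_def mult_ac)
      also have "\<dots> = (ennreal (4 * q * ?A) * ennreal ((norm (f x))\<^sup>2)) * ennreal (?c powr (q - 2) / (q - 2))"
        using nn_integral_powr_0[of "q - 3" ?c] q2 \<kappa> by (simp add: nn_integral_cmult)
      also have "\<dots> = ennreal (4 * q * ?A * (norm (f x))\<^sup>2 * (?c powr (q - 2) / (q - 2)))"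
        using q2 by (simp add: ennreal_mult[symmetric])
      also have "4 * q * ?A * (norm (f x))\<^sup>2 * (?c powr (q - 2) / (q - 2))
        = 4 * q * ?A * \<kappa> powr (q - 2) / (q - 2) * norm (f x) powr p"
      proof -
        have "?c powr (q - 2) = \<kappa> powr (q - 2) * norm (f x) powr ((1 - p) * (q - 2))"
          using \<kappa> by (simp add: powr_mult powr_powr)
        moreover have "(norm (f x))\<^sup>2 * norm (f x) powr ((1 - p) * (q - 2)) = norm (f x) powr p"
        proof -
          have "norm (f x) powr p = norm (f x) powr ((1 - p) * (q - 2)) * norm (f x) powr 2"
            unfolding powr_add[symmetric] pq ..
          then show ?thesis using False by simp
        qed
        ultimately show ?thesis by (simp add: field_simps)
      qed
      also have "ennreal \<dots> = ennreal (4 * q * ?A * \<kappa> powr (q - 2) / (q - 2)) * ennreal (norm (f x) powr p)"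
        by (rule ennreal_mult) (use q2 in auto)
      finally show ?thesis .
    qed
  qed
  also have "\<dots> = ennreal (4 * q * ?A * \<kappa> powr (q - 2) / (q - 2)) * ennreal I"
    using nn_integral_eq_integral[OF bdd_bsupp_powr_integrable[OF f, of p]] p
      by (simp add: nn_integral_cmult I(1))
  also have "\<dots> = ennreal (4 * q * 2 powr (q - 2) / (q - 2) * ?A * M1 powr (q - 2) * I powr (q - 1))"
  proof -
    have "\<kappa> powr (q - 2) * I = 2 powr (q - 2) * M1 powr (q - 2) * I powr (q - 1)"
      using M1 I(2) powr_mult_base[of I "q - 2"] by (simp add: \<kappa>_def powr_mult mult_ac)
    then have "4 * q * ?A * \<kappa> powr (q - 2) / (q - 2) * I
      = 4 * q * 2 powr (q - 2) / (q - 2) * ?A * M1 powr (q - 2) * I powr (q - 1)"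
      by (simp add: field_simps)
    then show ?thesis using q2 I(2) by (subst ennreal_mult[symmetric]) auto
  qed
  finally show ?thesis .
qed

lemma Lp_norm_le:
  assumes "g \<in> borel_measurable borel" "P > 0" "J \<ge> 0"
    "(\<integral>\<^sup>+x. ennreal (norm (g x) powr P) \<partial>lborel) \<le> ennreal J"
  shows "Lp_norm (ennreal P) g \<le> ennreal (J powr (1 / P))"
proof -
  let ?I = "\<integral>\<^sup>+x. ennreal (norm (g x) powr P) \<partial>lborel"
  have "?I \<noteq> top" using assms(4) by (auto simp: top_unique)
  moreover have "enn2real ?I \<le> J" using assms(3,4) by (simp add: enn2real_leI)
  ultimately show ?thesis
    using assms by (simp add: Lp_norm_def Let_def powr_mono2 ennreal_leI)
qed

lemma Lp_norm_bdd_bsupp: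
  assumes "bdd_bsupp f" "P > 0"
  shows "Lp_norm (ennreal P) f = ennreal ((LINT x|lborel. norm (f x) powr P) powr (1 / P))"
proof -
  have "(\<integral>\<^sup>+x. ennreal (norm (f x) powr P) \<partial>lborel) = ennreal (LINT x|lborel. norm (f x) powr P)"
    by (rule nn_integral_eq_integral[OF bdd_bsupp_powr_integrable[OF assms]]) simp
  moreover have "(LINT x|lborel. norm (f x) powr P) \<ge> 0" by (rule Bochner_Integration.integral_nonneg) simp
  ultimately show ?thesis
    using assms by (simp add: Lp_norm_def Let_def bdd_bsupp_measurable)
qed

text \<open>For \<open>1 < p \<le> 2\<close> both exponents are finite and can be handled as real numbers.\<close>

lemma conjugate_exponents:
  assumes "1 \<le> (p::ennreal)" "p \<le> 2" "1 / p + 1 / q = 1"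
  obtains "p = ennreal 1" "q = top" "enn2real (1 / p) - enn2real (1 / q) = 1"
  | P Q where "1 < P" "P \<le> 2" "Q = P / (P - 1)" "p = ennreal P" "q = ennreal Q"
    "enn2real (1 / p) - enn2real (1 / q) = 1 - 2 / Q"
proof -
  obtain P where P: "p = ennreal P" "P \<ge> 0"
    using assms(2) by (cases p) (auto simp: top_unique)
  have P12: "1 \<le> P" "P \<le> 2"
    using assms(1,2) P ennreal_le_iff[of 2 P] ennreal_le_iff[of P 1] by auto
  have p1: "1 / p = ennreal (1 / P)"
    using P P12 divide_ennreal[of 1 P] by simp
  show ?thesis
  proof (cases "P = 1")
    case True
    then have "1 + 1 / q = 1 + 0" using assms(3) p1 by simp
    then have q0: "1 / q = 0" by (simp only: ennreal_add_left_cancel) auto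
    then have "q = top" by (simp add: ennreal_divide_eq_0_iff)
    then show ?thesis using that(1) P True p1 q0 by simp
  next
    case False
    then have P1: "P > 1" using P12 by simp
    have "q \<noteq> top"
    proof
      assume "q = top"
      then have "ennreal (1 / P) = ennreal 1" using assms(3) p1 by simp
      then show False using P1 by (subst (asm) ennreal_inj) auto
    qed
    then obtain Q where Q: "q = ennreal Q" "Q \<ge> 0" by (cases q) auto
    have "Q \<noteq> 0" using assms(3) Q by (auto simp: ennreal_divide_zero)
    then have Q0: "Q > 0" using Q by simp
    have q1: "1 / q = ennreal (1 / Q)" using Q Q0 divide_ennreal[of 1 Q] by simp
    have "ennreal (1 / P + 1 / Q) = ennreal 1" using assms(3) P1 Q0 unfolding p1 q1 by simp
    then have e: "1 / P + 1 / Q = 1" using P1 Q0 by (subst (asm) ennreal_inj) auto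
    then have "Q = P / (P - 1)" using P1 Q0 by (simp add: field_simps)
    moreover have "enn2real (1 / p) - enn2real (1 / q) = 1 - 2 / Q"
      using e P1 Q0 unfolding p1 q1 by simp
    ultimately show ?thesis using that(2) P1 P12 P Q by blast
  qed
qed

lemma multiplier_null:
  assumes f: "bdd_bsupp f" and 0: "(LINT x|lborel. norm (f x) powr p) = 0" "p > 0"
  shows "multiplier \<mu> f x = 0"
proof -
  have "AE x in lborel. norm (f x) powr p = 0"
    using 0 integral_nonneg_eq_0_iff_AE[OF bdd_bsupp_powr_integrable[OF f \<open>p > 0\<close>]] by simp
  then have "AE x in lborel. f x = 0" by simp
  then have "fourier f \<xi> = 0" for \<xi>
    unfolding fourier_def by (subst integral_eq_zero_AE) auto
  then show ?thesis unfolding multiplier_def fourier_def[of _ "-x"] by simp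
qed

text \<open>Since \<open>2 / q = 1 - \<theta>\<close> and \<open>1 - 2 / q = \<theta>\<close>, the interpolated bound has exactly the powers of
  the two endpoint norms given by convexity; this is what preserves the decay rate.\<close>

lemma multiplier_Lp_Lq:
  assumes pq: "1 \<le> (p::ennreal)" "p \<le> 2" "1 / p + 1 / q = 1"
  defines "\<theta> \<equiv> enn2real (1 / p) - enn2real (1 / q)"
  shows "\<exists>K\<ge>0. \<forall>\<mu> (f :: real ^ 'n \<Rightarrow> complex) M0 M1. bdd_bsupp \<mu> \<longrightarrow> bdd_bsupp f \<longrightarrow> (\<forall>\<xi>. norm (\<mu> \<xi>) \<le> M0) \<longrightarrow>
    (LINT \<xi>|lborel. norm (\<mu> \<xi>)) \<le> M1 \<longrightarrow> 0 < M0 \<longrightarrow> 0 < M1 \<longrightarrow>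
    Lp_norm q (multiplier \<mu> f) \<le> ennreal (K * M0 powr (1 - \<theta>) * M1 powr \<theta>) * Lp_norm p f"
  using pq
proof (cases rule: conjugate_exponents)
  case 1
  show ?thesis
  proof (intro exI[of _ 1] conjI allI impI)
    fix \<mu> f :: "real ^ 'n \<Rightarrow> complex" and M0 M1 :: real
    assume a: "bdd_bsupp \<mu>" "bdd_bsupp f" "\<forall>\<xi>. norm (\<mu> \<xi>) \<le> M0" "(LINT \<xi>|lborel. norm (\<mu> \<xi>)) \<le> M1"
      "0 < M0" "0 < M1"
    have n: "(LINT x|lborel. norm (f x)) \<ge> 0" by (rule Bochner_Integration.integral_nonneg) simp
    have [measurable]: "multiplier \<mu> f \<in> borel_measurable borel" by (rule multiplier_measurable[OF a(1,2)])
    have "Lp_norm q (multiplier \<mu> f) = esssup lborel (\<lambda>x. ennreal (norm (multiplier \<mu> f x)))"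
      by (simp add: Lp_norm_def 1)
    also have "\<dots> \<le> ennreal (M1 * (LINT x|lborel. norm (f x)))"
      using multiplier_sup[OF a(1,2,4)] by (intro esssup_I) (auto intro!: AE_I2 ennreal_leI)
    also have "\<dots> = ennreal (1 * M0 powr (1 - \<theta>) * M1 powr \<theta>) * Lp_norm p f"
      using a n Lp_norm_bdd_bsupp[OF a(2), of 1] by (simp add: 1 \<theta>_def ennreal_mult)
    finally show "Lp_norm q (multiplier \<mu> f) \<le> ennreal (1 * M0 powr (1 - \<theta>) * M1 powr \<theta>) * Lp_norm p f" .
  qed simp
next
  case (2 P Q)
  have Q2: "Q \<ge> 2" using 2(1,2) unfolding 2(3) by (simp add: field_simps)
  have t: "\<theta> = 1 - 2 / Q" unfolding \<theta>_def by (rule 2(6))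
  have PQ: "(Q - 1) / Q = 1 / P" using 2(1) unfolding 2(3) by (simp add: field_simps)
  let ?A = "(2 * pi) ^ CARD('n)"
  define c where "c = (if P = 2 then 1 else 4 * Q * 2 powr (Q - 2) / (Q - 2))"
  have c: "c \<ge> 0" using Q2 by (auto simp: c_def)
  define K where "K = (c * ?A\<^sup>2) powr (1 / Q)"
  show ?thesis
  proof (intro exI[of _ K] conjI allI impI)
    fix \<mu> f :: "real ^ 'n \<Rightarrow> complex" and M0 M1 :: real
    assume a: "bdd_bsupp \<mu>" "bdd_bsupp f" "\<forall>\<xi>. norm (\<mu> \<xi>) \<le> M0" "(LINT \<xi>|lborel. norm (\<mu> \<xi>)) \<le> M1"
      "0 < M0" "0 < M1"
    define I where "I = (LINT x|lborel. norm (f x) powr P)"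
    have I0: "I \<ge> 0" unfolding I_def by (rule Bochner_Integration.integral_nonneg) simp
    let ?J = "c * (?A * M0)\<^sup>2 * M1 powr (Q - 2) * I powr (Q - 1)"
    have "(\<integral>\<^sup>+x. ennreal (norm (multiplier \<mu> f x) powr Q) \<partial>lborel) \<le> ennreal ?J"
    proof (cases "I = 0")
      case True
      then show ?thesis using multiplier_null[OF a(2), of P] 2 by (simp add: I_def)
    next
      case False
      show ?thesis
      proof (cases "P = 2")
        case True
        then have Q: "Q = 2" using 2 by simp
        have "(\<integral>\<^sup>+x. ennreal ((norm (f x))\<^sup>2) \<partial>lborel) = ennreal I"
          using nn_integral_eq_integral[OF bdd_bsupp_powr_integrable[OF a(2), of P]] True by (simp add: I_def)
        then show ?thesis
          using multiplier_L2[OF a(1,2), of M0] a I0 False by (simp add: Q True c_def ennreal_mult)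
      next
        case F: False
        then show ?thesis
          using multiplier_interpolation[OF a(1,2) spec[OF a(3)] a(4,6) 2(1) _ 2(3) I_def] 2 I0 False
          by (simp add: c_def)
      qed
    qed
    then have "Lp_norm q (multiplier \<mu> f) \<le> ennreal (?J powr (1 / Q))"
      unfolding 2 using Q2 c a(1,2) 2 by (intro Lp_norm_le multiplier_measurable) auto
    also have "?J powr (1 / Q) = K * M0 powr (1 - \<theta>) * M1 powr \<theta> * I powr (1 / P)"
    proof -
      have "?J = (c * ?A\<^sup>2) * M0\<^sup>2 * M1 powr (Q - 2) * I powr (Q - 1)" by (simp add: power_mult_distrib)
      also have "\<dots> powr (1 / Q) = K * (M0 powr 2) powr (1 / Q) * (M1 powr (Q - 2)) powr (1 / Q) *
        (I powr (Q - 1)) powr (1 / Q)"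
        using c a by (simp add: powr_mult K_def)
      also have "\<dots> = K * M0 powr (1 - \<theta>) * M1 powr \<theta> * I powr (1 / P)"
        using Q2 by (simp add: powr_powr t PQ[symmetric] diff_divide_distrib)
      finally show ?thesis .
    qed
    also have "ennreal \<dots> = ennreal (K * M0 powr (1 - \<theta>) * M1 powr \<theta>) * Lp_norm p f"
      using Lp_norm_bdd_bsupp[OF a(2), of P] 2 by (simp add: I_def K_def ennreal_mult)
    finally show "Lp_norm q (multiplier \<mu> f) \<le> ennreal (K * M0 powr (1 - \<theta>) * M1 powr \<theta>) * Lp_norm p f" .
  qed (simp add: K_def)
qed

section \<open>Differentiation of multiplier operators in space and time\<close>

lemma has_vector_derivative_iff_slope:
  fixes f :: "real \<Rightarrow> 'b::real_normed_vector"
  shows "(f has_vector_derivative D) (at x) \<longleftrightarrow> ((\<lambda>y. (f y - f x) /\<^sub>R (y - x)) \<longlongrightarrow> D) (at x)"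
proof -
  have eq: "norm ((f y - f x) - (y - x) *\<^sub>R D) / norm (y - x) = norm ((f y - f x) /\<^sub>R (y - x) - D)"
    if "y \<noteq> x" for y
  proof -
    have "(f y - f x) /\<^sub>R (y - x) - D = (f y - f x - (y - x) *\<^sub>R D) /\<^sub>R (y - x)"
      using that by (simp add: scaleR_diff_right)
    then show ?thesis by (simp add: divide_inverse mult.commute)
  qed
  have "(f has_vector_derivative D) (at x) \<longleftrightarrow>
    ((\<lambda>y. norm ((f y - f x) - (y - x) *\<^sub>R D) / norm (y - x)) \<longlongrightarrow> 0) (at x)"
    unfolding has_vector_derivative_def has_derivative_iff_norm by (simp add: bounded_linear_scaleR_left)
  also have "\<dots> \<longleftrightarrow> ((\<lambda>y. norm ((f y - f x) /\<^sub>R (y - x) - D)) \<longlongrightarrow> 0) (at x)"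
    unfolding eventually_at_filter by (intro tendsto_cong)
      (simp only: eventually_at_filter, intro always_eventually allI impI eq)
  also have "\<dots> \<longleftrightarrow> ((\<lambda>y. (f y - f x) /\<^sub>R (y - x)) \<longlongrightarrow> D) (at x)"
    unfolding tendsto_norm_zero_iff by (rule LIM_zero_iff)
  finally show ?thesis .
qed

text \<open>Dominated convergence for difference quotients, which the mean value inequality bounds by \<open>w\<close>.\<close>

lemma has_vector_derivative_integral:
  fixes g :: "real \<Rightarrow> 'a \<Rightarrow> complex"
  assumes int: "\<And>h. integrable M (g h)"
    and d: "\<And>h \<xi>. \<bar>h - h0\<bar> < 1 \<Longrightarrow> ((\<lambda>h. g h \<xi>) has_vector_derivative g' h \<xi>) (at h)"
    and b: "\<And>h \<xi>. \<bar>h - h0\<bar> < 1 \<Longrightarrow> norm (g' h \<xi>) \<le> w \<xi>"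
    and w: "integrable M w" and m: "g' h0 \<in> borel_measurable M"
  shows "((\<lambda>h. LINT \<xi>|M. g h \<xi>) has_vector_derivative (LINT \<xi>|M. g' h0 \<xi>)) (at h0)"
  unfolding has_vector_derivative_iff_slope tendsto_at_iff_sequentially comp_def
proof (intro allI impI)
  fix X :: "nat \<Rightarrow> real"
  assume X: "\<forall>i. X i \<in> UNIV - {h0}" "X \<longlonglongrightarrow> h0"
  \<comment> \<open>the finitely many terms outside the range of domination are moved into it\<close>
  define Y where "Y i = (if \<bar>X i - h0\<bar> < 1 then X i else h0 + 1/2)" for i
  have Y: "Y i \<noteq> h0" "\<bar>Y i - h0\<bar> < 1" for i using X(1) by (auto simp: Y_def)
  have ev: "eventually (\<lambda>i. Y i = X i) sequentially"
    using tendstoD[OF X(2), of 1] by (auto simp: Y_def dist_real_def elim!: eventually_mono)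
  have Yl: "Y \<longlonglongrightarrow> h0" using X(2) ev by (simp add: tendsto_cong[OF ev])
  let ?q = "\<lambda>i \<xi>. (g (Y i) \<xi> - g h0 \<xi>) /\<^sub>R (Y i - h0)"
  have "(\<lambda>i. LINT \<xi>|M. ?q i \<xi>) \<longlonglongrightarrow> (LINT \<xi>|M. g' h0 \<xi>)"
  proof (rule integral_dominated_convergence[OF m _ w])
    show "(\<lambda>\<xi>. ?q i \<xi>) \<in> borel_measurable M" for i
      using borel_measurable_integrable[OF int] by measurable
    show "AE \<xi> in M. (\<lambda>i. ?q i \<xi>) \<longlonglongrightarrow> g' h0 \<xi>"
    proof (rule AE_I2)
      fix \<xi>
      have "((\<lambda>h. (g h \<xi> - g h0 \<xi>) /\<^sub>R (h - h0)) \<longlongrightarrow> g' h0 \<xi>) (at h0)"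
        using d[of h0 \<xi>] by (simp add: has_vector_derivative_iff_slope)
      then show "(\<lambda>i. ?q i \<xi>) \<longlonglongrightarrow> g' h0 \<xi>"
        using Y(1) Yl unfolding tendsto_at_iff_sequentially by (auto simp: comp_def)
    qed
    show "AE \<xi> in M. norm (?q i \<xi>) \<le> w \<xi>" for i
    proof (rule AE_I2)
      fix \<xi>
      have "norm (g (Y i) \<xi> - g h0 \<xi>) \<le> w \<xi> * norm (Y i - h0)"
      proof (rule differentiable_bound[where S = "ball h0 1" and f' = "\<lambda>h u. u *\<^sub>R g' h \<xi>"])
        fix h assume "h \<in> ball h0 1"
        then have h: "\<bar>h - h0\<bar> < 1" by (simp add: dist_real_def abs_minus_commute)
        show "((\<lambda>h. g h \<xi>) has_derivative (\<lambda>u. u *\<^sub>R g' h \<xi>)) (at h within ball h0 1)"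
          using has_vector_derivative_at_within[OF d[OF h]] by (simp add: has_vector_derivative_def)
        show "onorm (\<lambda>u. u *\<^sub>R g' h \<xi>) \<le> w \<xi>"
          using mult_left_mono[OF b[OF h, of \<xi>]] order_trans[OF norm_ge_zero b[OF h, of \<xi>]]
          by (intro onorm_bound) (simp_all add: mult.commute)
      qed (use Y(2)[of i] in \<open>auto simp: dist_real_def abs_minus_commute\<close>)
      then show "norm (?q i \<xi>) \<le> w \<xi>"
        using Y(1)[of i] by (simp add: divide_inverse[symmetric] pos_divide_le_eq
          mult.commute[of "inverse _"])
    qed
  qed
  then have "(\<lambda>i. ((LINT \<xi>|M. g (Y i) \<xi>) - (LINT \<xi>|M. g h0 \<xi>)) /\<^sub>R (Y i - h0)) \<longlonglongrightarrow> (LINT \<xi>|M. g' h0 \<xi>)"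
    using int by (simp add: Bochner_Integration.integral_diff)
  then show "(\<lambda>i. ((LINT \<xi>|M. g (X i) \<xi>) - (LINT \<xi>|M. g h0 \<xi>)) /\<^sub>R (X i - h0)) \<longlonglongrightarrow> (LINT \<xi>|M. g' h0 \<xi>)"
    by (rule Lim_transform_eventually) (use ev in \<open>auto elim!: eventually_mono\<close>)
qed

lemma multiplier_eq: "multiplier \<mu> f x = (LINT \<xi>|lborel. iexp (x \<bullet> \<xi>) * (\<mu> \<xi> * fourier f \<xi>))"
  unfolding multiplier_def fourier_def[of _ "-x"] by (simp add: inner_commute)

lemma exp_ix_integrable:
  assumes "bdd_bsupp \<phi>" shows "integrable lborel (\<lambda>\<xi>. iexp (x \<bullet> \<xi>) * \<phi> \<xi>)"
  by (rule exp_i_integrable[OF bdd_bsupp_integrable[OF assms]]) auto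

lemma bdd_bsupp_coord:
  assumes "bdd_bsupp \<phi>" shows "bdd_bsupp (\<lambda>\<xi>. of_real (\<xi> $ k) * \<phi> \<xi>)"
proof -
  have [measurable]: "\<phi> \<in> borel_measurable borel" by (rule bdd_bsupp_measurable[OF assms])
  have [measurable]: "(\<lambda>\<xi>. of_real (\<xi> $ k) :: complex) \<in> borel_measurable borel"
    by (intro borel_measurable_continuous_onI continuous_intros)
  obtain B R where b: "B \<ge> 0" "\<And>x. norm (\<phi> x) \<le> B * indicator (cball 0 R) x"
    using bdd_bsuppE[OF assms] by metis
  have "norm (of_real (\<xi> $ k) * \<phi> \<xi>) \<le> \<bar>R\<bar> * B" for \<xi>
    using b(1) b(2)[of \<xi>] component_le_norm_cart[of \<xi> k]
    by (cases "\<xi> \<in> cball 0 R") (auto simp: norm_mult indicator_def intro!: mult_mono)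
  moreover have "bounded {x. of_real (x $ k) * \<phi> x \<noteq> 0}"
    by (rule bounded_subset[of "{x. \<phi> x \<noteq> 0}"]) (use assms in \<open>auto simp: bdd_bsupp_def\<close>)
  ultimately show ?thesis unfolding bdd_bsupp_def bounded_iff by auto
qed

lemma Dx_multiplier:
  fixes f :: "real ^ 'n \<Rightarrow> complex"
  assumes "bdd_bsupp \<mu>" "bdd_bsupp f"
  shows "Dx k (multiplier \<mu> f) = multiplier (\<lambda>\<xi>. of_real (\<xi> $ k) * \<mu> \<xi>) f"
proof
  fix x :: "real ^ 'n"
  let ?\<phi> = "\<lambda>\<xi>. \<mu> \<xi> * fourier f \<xi>"
  let ?\<psi> = "\<lambda>\<xi>. of_real (\<xi> $ k) * \<mu> \<xi> * fourier f \<xi>"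
  have \<phi>: "bdd_bsupp ?\<phi>" and \<psi>: "bdd_bsupp ?\<psi>" by (intro bdd_bsupp_mult_fourier bdd_bsupp_coord assms)+
  have e: "((\<lambda>h. iexp ((x + h *\<^sub>R axis k 1) \<bullet> \<xi>) * ?\<phi> \<xi>) has_vector_derivative
     \<i> * (iexp ((x + h *\<^sub>R axis k 1) \<bullet> \<xi>) * ?\<psi> \<xi>)) (at h)" for h \<xi>
  proof -
    have "((\<lambda>h. exp (\<i> * (of_real (x \<bullet> \<xi>) + of_real (\<xi> $ k) * h)) * ?\<phi> \<xi>) has_field_derivative
      (exp (\<i> * (of_real (x \<bullet> \<xi>) + of_real (\<xi> $ k) * of_real h)) * (\<i> * of_real (\<xi> $ k)) * ?\<phi> \<xi>))
        (at (of_real h))"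
      by (auto intro!: derivative_eq_intros)
    from has_vector_derivative_real_field[OF this]
    show ?thesis by (simp add: inner_add_left inner_axis' mult_ac)
  qed
  have "((\<lambda>h. multiplier \<mu> f (x + h *\<^sub>R axis k 1)) has_vector_derivative
     (LINT \<xi>|lborel. \<i> * (iexp ((x + 0 *\<^sub>R axis k 1) \<bullet> \<xi>) * ?\<psi> \<xi>))) (at 0)"
    unfolding multiplier_eq
  proof (rule has_vector_derivative_integral[where w = "\<lambda>\<xi>. norm (?\<psi> \<xi>)" and g'
    = "\<lambda>h \<xi>. \<i> * (iexp ((x + h *\<^sub>R axis k 1) \<bullet> \<xi>) * ?\<psi> \<xi>)"])
    show "(\<lambda>\<xi>. \<i> * (iexp ((x + 0 *\<^sub>R axis k 1) \<bullet> \<xi>) * ?\<psi> \<xi>)) \<in> borel_measurable lborel"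
      using borel_measurable_integrable[OF exp_ix_integrable[OF \<psi>, of x]] by simp
    show "integrable lborel (\<lambda>\<xi>. norm (?\<psi> \<xi>))" by (rule integrable_norm[OF bdd_bsupp_integrable[OF \<psi>]])
    show "norm (\<i> * (iexp ((x + h *\<^sub>R axis k 1) \<bullet> \<xi>) * ?\<psi> \<xi>)) \<le> norm (?\<psi> \<xi>)" for h \<xi>
      by (simp add: norm_mult)
  qed (use e exp_ix_integrable[OF \<phi>] in auto)
  from vector_derivative_at[OF this]
  show "Dx k (multiplier \<mu> f) x = multiplier (\<lambda>\<xi>. of_real (\<xi> $ k) * \<mu> \<xi>) f x"
    unfolding Dx_def by (simp add: multiplier_eq)
qed

lemma Dx_pow_multiplier:
  assumes "bdd_bsupp \<mu>" "bdd_bsupp f"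
  shows "(Dx k ^^ r) (multiplier \<mu> f) = multiplier (\<lambda>\<xi>. of_real (\<xi> $ k) ^ r * \<mu> \<xi>) f \<and>
    bdd_bsupp (\<lambda>\<xi>. of_real (\<xi> $ k) ^ r * \<mu> \<xi>)"
proof (induction r)
  case (Suc r)
  then show ?case using Dx_multiplier[OF conjunct2[OF Suc] assms(2), of k]
    bdd_bsupp_coord[OF conjunct2[OF Suc], of k]
    by (simp add: mult.assoc)
qed (use assms in simp)

text \<open>The factor \<open>P\<close> is \<open>\<xi>\<^sup>\<alpha>\<close>, with its coordinates in the unspecified order in which the
  derivatives are taken.\<close>

lemma Dx_multi_multiplier:
  fixes \<alpha> :: "'n::finite multi_index"
  shows "\<exists>P. continuous_on UNIV P \<and> (\<forall>\<mu> f. bdd_bsupp \<mu> \<longrightarrow> bdd_bsupp f \<longrightarrow>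
    Dx_multi \<alpha> (multiplier \<mu> f) = multiplier (\<lambda>\<xi>. P \<xi> * \<mu> \<xi>) f \<and> bdd_bsupp (\<lambda>\<xi>. P \<xi> * \<mu> \<xi>))"
proof -
  have "\<exists>P. continuous_on UNIV P \<and> (\<forall>\<mu> f. bdd_bsupp \<mu> \<longrightarrow> bdd_bsupp f \<longrightarrow>
    foldr (\<lambda>k. Dx k ^^ \<alpha> k) ks (multiplier \<mu> f)
      = multiplier (\<lambda>\<xi>. P \<xi> * \<mu> \<xi>) f \<and> bdd_bsupp (\<lambda>\<xi>. P \<xi> * \<mu> \<xi>))" for ks
  proof (induction ks)
    case Nil
    show ?case by (intro exI[of _ "\<lambda>_. 1"]) auto
  next
    case (Cons k ks)
    then obtain P where P: "continuous_on UNIV P" "\<And>\<mu> f. bdd_bsupp \<mu> \<Longrightarrow> bdd_bsupp f \<Longrightarrow>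
      foldr (\<lambda>k. Dx k ^^ \<alpha> k) ks (multiplier \<mu> f) = multiplier (\<lambda>\<xi>. P \<xi> * \<mu> \<xi>) f \<and> bdd_bsupp (\<lambda>\<xi>. P \<xi> * \<mu> \<xi>)"
      by blast
    show ?case
    proof (intro exI[of _ "\<lambda>\<xi>. of_real (\<xi> $ k) ^ \<alpha> k * P \<xi>"] conjI allI impI)
      show "continuous_on UNIV (\<lambda>\<xi>. of_real (\<xi> $ k) ^ \<alpha> k * P \<xi>)"
        by (intro continuous_intros P)
      fix \<mu> f :: "real ^ 'n \<Rightarrow> complex" assume a: "bdd_bsupp \<mu>" "bdd_bsupp f"
      have Pm: "bdd_bsupp (\<lambda>\<xi>. P \<xi> * \<mu> \<xi>)" using P(2)[OF a] by blast
      show "foldr (\<lambda>k. Dx k ^^ \<alpha> k) (k # ks) (multiplier \<mu> f)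
        = multiplier (\<lambda>\<xi>. of_real (\<xi> $ k) ^ \<alpha> k * P \<xi> * \<mu> \<xi>) f"
        "bdd_bsupp (\<lambda>\<xi>. of_real (\<xi> $ k) ^ \<alpha> k * P \<xi> * \<mu> \<xi>)"
        using Dx_pow_multiplier[OF Pm a(2), where k = k and r = "\<alpha> k"] P(2)[OF a]
          by (simp_all add: mult.assoc)
    qed
  qed
  then show ?thesis unfolding Dx_multi_def .
qed

lemma jet_fun_norm_le:
  assumes "\<And>n. norm (w n) \<le> B * \<rho> ^ n"
  shows "norm (jet_fun w t) \<le> B * exp (\<rho> * \<bar>t\<bar>)"
proof -
  have e: "(\<lambda>n. B * ((\<rho> * \<bar>t\<bar>) ^ n /\<^sub>R fact n)) sums (B * exp (\<rho> * \<bar>t\<bar>))"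
    by (intro sums_mult exp_converges)
  have "norm ((\<i> * of_real t) ^ n / fact n * w n) \<le> B * ((\<rho> * \<bar>t\<bar>) ^ n /\<^sub>R fact n)" for n
    using mult_left_mono[OF assms[of n], of "\<bar>t\<bar> ^ n / fact n"]
    by (simp add: norm_mult norm_divide norm_power power_mult_distrib field_simps)
  then show ?thesis
    unfolding jet_fun_def sums_unique[OF e] by (intro norm_suminf_le) (use e in \<open>auto simp: sums_iff\<close>)
qed

text \<open>Uniformity in \<open>\<xi>\<close> supplies the domination needed to differentiate in \<open>t\<close> under the integral.\<close>

definition geometric_family :: "('a::topological_space \<Rightarrow> nat \<Rightarrow> complex) \<Rightarrow> bool" where
  "geometric_family u \<longleftrightarrow> (\<exists>B \<rho>. \<forall>\<xi> n. norm (u \<xi> n) \<le> B * \<rho> ^ n) \<and> (\<forall>n. (\<lambda>\<xi>. u \<xi> n) \<in> borel_measurable borel)"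

lemma geometric_family_shift: assumes "geometric_family u" shows "geometric_family (\<lambda>\<xi> n. u \<xi> (n + r))"
proof -
  obtain B \<rho> where b: "\<And>\<xi> n. norm (u \<xi> n) \<le> B * \<rho> ^ n" using assms by (auto simp: geometric_family_def)
  have "norm (u \<xi> (n + r)) \<le> (B * \<rho> ^ r) * \<rho> ^ n" for \<xi> n
    using b[of \<xi> "n + r"] by (simp add: power_add mult_ac)
  then show ?thesis using assms unfolding geometric_family_def by blast
qed

lemma geometric_family_geometric: "geometric_family u \<Longrightarrow> geometric (u \<xi>)"
  unfolding geometric_family_def geometric_def by blast

lemma geometric_family_measurable:
  assumes "geometric_family u" shows "(\<lambda>\<xi>. jet_fun (u \<xi>) t) \<in> borel_measurable borel"
proof -
  have [measurable]: "(\<lambda>\<xi>. u \<xi> n) \<in> borel_measurable borel" for n using assms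
    by (simp add: geometric_family_def)
  show ?thesis unfolding jet_fun_def by measurable
qed

lemma bdd_bsupp_mult_jet_fun:
  fixes u :: "real ^ 'n \<Rightarrow> nat \<Rightarrow> complex"
  assumes "bdd_bsupp b" "geometric_family u" shows "bdd_bsupp (\<lambda>\<xi>. b \<xi> * jet_fun (u \<xi>) t)"
proof -
  obtain B \<rho> where b: "\<And>\<xi> n. norm (u \<xi> n) \<le> B * \<rho> ^ n" using assms by (auto simp: geometric_family_def)
  show ?thesis
    by (rule bdd_bsupp_mult[OF assms(1) geometric_family_measurable[OF assms(2)]])
      (rule jet_fun_norm_le[OF b])
qed

lemma Dt_multiplier:
  fixes f :: "real ^ 'n \<Rightarrow> complex"
  assumes b: "bdd_bsupp b" and u: "geometric_family u" and f: "bdd_bsupp f"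
  shows "Dt (\<lambda>t. multiplier (\<lambda>\<xi>. b \<xi> * jet_fun (u \<xi>) t) f x)
    = (\<lambda>t. multiplier (\<lambda>\<xi>. b \<xi> * jet_fun (\<lambda>n. u \<xi> (Suc n)) t) f x)"
proof
  fix t0 :: real
  let ?u = "\<lambda>\<xi> n. u \<xi> (Suc n)"
  have u': "geometric_family ?u" using geometric_family_shift[OF u, of 1] by simp
  obtain B \<rho> where B: "\<And>\<xi> n. norm (?u \<xi> n) \<le> B * \<rho> ^ n" using u' by (auto simp: geometric_family_def)
  have B0: "B \<ge> 0" using order_trans[OF norm_ge_zero B[of undefined 0]] by simp
  let ?g = "\<lambda>t \<xi>. iexp (x \<bullet> \<xi>) * (b \<xi> * jet_fun (u \<xi>) t * fourier f \<xi>)"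
  let ?g' = "\<lambda>t \<xi>. iexp (x \<bullet> \<xi>) * (b \<xi> * (\<i> * jet_fun (?u \<xi>) t) * fourier f \<xi>)"
  have \<phi>: "bdd_bsupp (\<lambda>\<xi>. b \<xi> * jet_fun (u \<xi>) t * fourier f \<xi>)"
    "bdd_bsupp (\<lambda>\<xi>. b \<xi> * jet_fun (?u \<xi>) t * fourier f \<xi>)" for t
    by (intro bdd_bsupp_mult_fourier bdd_bsupp_mult_jet_fun b u u' f)+
  have d: "((\<lambda>t. ?g t \<xi>) has_vector_derivative ?g' t \<xi>) (at t)" for t \<xi>
    using has_vector_derivative_mult_right[OF
      jet_fun_has_vector_derivative[OF geometric_family_geometric[OF u, of \<xi>], of t],
        of "iexp (x \<bullet> \<xi>) * b \<xi> * fourier f \<xi>"]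
    by (simp only: mult_ac)
  have "((\<lambda>t. LINT \<xi>|lborel. ?g t \<xi>) has_vector_derivative (LINT \<xi>|lborel. ?g' t0 \<xi>)) (at t0)"
  proof (rule has_vector_derivative_integral[where w
    = "\<lambda>\<xi>. norm (b \<xi> * fourier f \<xi>) * (B * exp (\<bar>\<rho>\<bar> * (\<bar>t0\<bar> + 1)))"])
    show "integrable lborel (?g h)" for h by (rule exp_ix_integrable[OF \<phi>(1)])
    show "((\<lambda>h. ?g h \<xi>) has_vector_derivative ?g' h \<xi>) (at h)" for h \<xi> by (rule d)
    show "integrable lborel (\<lambda>\<xi>. norm (b \<xi> * fourier f \<xi>) * (B * exp (\<bar>\<rho>\<bar> * (\<bar>t0\<bar> + 1))))"
      by (intro integrable_mult_left integrable_norm bdd_bsupp_integrable bdd_bsupp_mult_fourier b f)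
    have "integrable lborel (\<lambda>\<xi>. \<i> * (iexp (x \<bullet> \<xi>) * (b \<xi> * jet_fun (?u \<xi>) t0 * fourier f \<xi>)))"
      by (intro integrable_mult_right exp_ix_integrable \<phi>)
    from borel_measurable_integrable[OF this]
    show "?g' t0 \<in> borel_measurable lborel" by (simp add: mult_ac)
    fix h \<xi> assume h: "\<bar>h - t0\<bar> < 1"
    have "norm (jet_fun (?u \<xi>) h) \<le> B * exp (\<rho> * \<bar>h\<bar>)" by (rule jet_fun_norm_le[OF B])
    also have "\<dots> \<le> B * exp (\<bar>\<rho>\<bar> * (\<bar>t0\<bar> + 1))"
      using h B0 by (intro mult_left_mono) (auto intro: mult_mono)
    finally have "norm (b \<xi> * fourier f \<xi>) * norm (jet_fun (?u \<xi>) h)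
      \<le> norm (b \<xi> * fourier f \<xi>) * (B * exp (\<bar>\<rho>\<bar> * (\<bar>t0\<bar> + 1)))"
      by (rule mult_left_mono) simp
    then show "norm (?g' h \<xi>) \<le> norm (b \<xi> * fourier f \<xi>) * (B * exp (\<bar>\<rho>\<bar> * (\<bar>t0\<bar> + 1)))"
      by (simp add: norm_mult mult_ac)
  qed
  from vector_derivative_at[OF this]
  show "Dt (\<lambda>t. multiplier (\<lambda>\<xi>. b \<xi> * jet_fun (u \<xi>) t) f x) t0 = multiplier (\<lambda>\<xi>. b \<xi> * jet_fun (?u \<xi>) t0) f x"
    unfolding Dt_def multiplier_eq by (simp add: mult_ac)
qed

lemma Dt_pow_multiplier:
  fixes f :: "real ^ 'n \<Rightarrow> complex"
  assumes b: "bdd_bsupp b" and u: "geometric_family u" and f: "bdd_bsupp f"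
  shows "(Dt ^^ r) (\<lambda>t. multiplier (\<lambda>\<xi>. b \<xi> * jet_fun (u \<xi>) t) f x)
    = (\<lambda>t. multiplier (\<lambda>\<xi>. b \<xi> * jet_fun (\<lambda>n. u \<xi> (n + r)) t) f x)"
proof (induction r)
  case (Suc r)
  then show ?case using Dt_multiplier[OF b geometric_family_shift[OF u, of r] f, of x] by simp
qed simp

lemma test_functions_bdd_bsupp:
  assumes "f \<in> test_functions U" shows "bdd_bsupp f" "\<And>x. x \<notin> U \<Longrightarrow> f x = 0" "continuous_on UNIV f"
proof -
  show c: "continuous_on UNIV f" using assms Ck.simps(1)[of f]
    by (auto simp: test_functions_def simp del: Ck.simps)
  have s: "compact (closure {x. f x \<noteq> 0})" "closure {x. f x \<noteq> 0} \<subseteq> U" using assms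
    by (auto simp: test_functions_def)
  show "f x = 0" if "x \<notin> U" for x using s(2) closure_subset[of "{x. f x \<noteq> 0}"] that by auto
  have "compact (f ` closure {x. f x \<noteq> 0})"
    by (intro compact_continuous_image s continuous_on_subset[OF c]) auto
  then have "bounded (insert 0 (f ` closure {x. f x \<noteq> 0}))" by (simp add: compact_imp_bounded)
  moreover have "range f \<subseteq> insert 0 (f ` closure {x. f x \<noteq> 0})"
    using closure_subset[of "{x. f x \<noteq> 0}"] by auto
  ultimately have "bounded (range f)" by (rule bounded_subset)
  moreover have "bounded {x. f x \<noteq> 0}"
    using compact_imp_bounded[OF s(1)] closure_subset by (rule bounded_subset)
  ultimately show "bdd_bsupp f" using borel_measurable_continuous_onI[OF c] by (simp add: bdd_bsupp_def)
qed

section \<open>Integrals over tubes around a set of given codimension\<close>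

text \<open>These are the weights of the shells in the proof of \<open>tube_integral\<close>.\<close>

lemma shell_weights_summable:
  assumes "s > 0" "c > 0"
  shows "summable (\<lambda>k. (real k + 1) ^ l * exp (- c * real k powr s))"
proof (rule summable_comparison_test_bigo)
  show "summable (\<lambda>k. norm (1 / real k ^ 2))"
    using inverse_power_summable[of 2, where 'a = real] by (simp add: divide_inverse)
  have "(\<lambda>k. (real k + 1) powr real l * exp (- c * real k powr s)) \<in> O(\<lambda>k. 1 / real k ^ 2)"
    using assms by real_asymp
  then show "(\<lambda>k. (real k + 1) ^ l * exp (- c * real k powr s)) \<in> O(\<lambda>k. 1 / real k ^ 2)"
    by (simp add: powr_realpow add_nonneg_pos)
qed

text \<open>For \<open>\<delta>\<close> beyond the range of the codimension bound, the set no longer grows with \<open>\<delta>\<close>, so that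
  the estimate at radius \<open>2 \<epsilon>\<close> suffices.\<close>

lemma tube_measure:
  fixes M :: "(real ^ 'n) set"
  assumes "M \<noteq> {}" "codim_bound M l"
  shows "\<exists>C\<ge>0. \<exists>\<epsilon>\<^sub>0>0. \<forall>\<epsilon> \<delta>. 0 < \<epsilon> \<longrightarrow> \<epsilon> < \<epsilon>\<^sub>0 \<longrightarrow> 0 < \<delta> \<longrightarrow>
    emeasure lborel {\<xi>. infdist \<xi> M \<le> \<epsilon> \<and> infdist \<xi> M < \<delta>} \<le> ennreal (C * \<delta> ^ l)"
proof -
  obtain C \<epsilon>\<^sub>1 where e: "\<epsilon>\<^sub>1 > 0" and C:
    "\<And>\<epsilon>. 0 < \<epsilon> \<Longrightarrow> \<epsilon> < \<epsilon>\<^sub>1 \<Longrightarrow> emeasure lborel (nbhd M \<epsilon>) \<le> ennreal (C * \<epsilon> ^ l)"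
    using assms(2) by (auto simp: codim_bound_def)
  have op: "nbhd M \<epsilon> \<in> sets borel" for \<epsilon>
    unfolding nbhd_def by (intro borel_open) (simp add: assms(1) open_Collect_less continuous_on_infdist)
  have "emeasure lborel {\<xi>. infdist \<xi> M \<le> \<epsilon> \<and> infdist \<xi> M < \<delta>} \<le> ennreal (\<bar>C\<bar> * \<delta> ^ l)"
    if "0 < \<epsilon>" "\<epsilon> < \<epsilon>\<^sub>1 / 2" "0 < \<delta>" for \<epsilon> \<delta>
  proof -
    define d where "d = min \<delta> (2 * \<epsilon>)"
    have d: "0 < d" "d < \<epsilon>\<^sub>1" "d \<le> \<delta>" using that by (auto simp: d_def)
    have "{\<xi>. infdist \<xi> M \<le> \<epsilon> \<and> infdist \<xi> M < \<delta>} \<subseteq> nbhd M d"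
      using that assms(1) by (auto simp: nbhd_def d_def)
    then have "emeasure lborel {\<xi>. infdist \<xi> M \<le> \<epsilon> \<and> infdist \<xi> M < \<delta>} \<le> emeasure lborel (nbhd M d)"
      using op by (intro emeasure_mono) auto
    also have "\<dots> \<le> ennreal (C * d ^ l)" by (rule C[OF d(1,2)])
    also have "C * d ^ l \<le> \<bar>C\<bar> * \<delta> ^ l" using d by (intro mult_mono power_mono) auto
    finally show ?thesis by (simp add: ennreal_leI)
  qed
  then show ?thesis using e by (intro exI[of _ "\<bar>C\<bar>"] conjI exI[of _ "\<epsilon>\<^sub>1 / 2"]) auto
qed

text \<open>With \<open>r = (1 + t)\<^bsup>-1/s\<^esup>\<close>, the exponential is at most a constant times \<open>exp (- c k\<^sup>s)\<close> on the
  shell of points at distance between \<open>k r\<close> and \<open>(k + 1) r\<close>, whose measure is \<open>O(((k + 1) r)\<^sup>l)\<close>;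
  the sum over \<open>k\<close> is of order \<open>r\<^sup>l\<close>.\<close>

lemma tube_integral:
  fixes M :: "(real ^ 'n) set"
  assumes M: "M \<noteq> {}" "codim_bound M l" and s: "s > 0" and c: "c > 0"
  shows "\<exists>\<epsilon>\<^sub>0>0. \<forall>\<epsilon>. 0 < \<epsilon> \<longrightarrow> \<epsilon> < \<epsilon>\<^sub>0 \<longrightarrow> (\<exists>C>0. \<forall>t\<ge>0.
    (\<integral>\<^sup>+\<xi>. ennreal (indicator {\<xi>. infdist \<xi> M \<le> \<epsilon>} \<xi> * exp (- (c * infdist \<xi> M powr s) * t)) \<partial>lborel)
      \<le> ennreal (C * (1 + t) powr (- (real l / s))))"
proof -
  let ?E = "\<lambda>\<epsilon> t \<xi>. ennreal (indicator {\<xi>. infdist \<xi> M \<le> \<epsilon>} \<xi> * exp (- (c * infdist \<xi> M powr s) * t))"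
  obtain C0 \<epsilon>\<^sub>0 where C0: "C0 \<ge> 0" "\<epsilon>\<^sub>0 > 0" and meas: "\<And>\<epsilon> \<delta>. 0 < \<epsilon> \<Longrightarrow> \<epsilon> < \<epsilon>\<^sub>0 \<Longrightarrow> 0 < \<delta> \<Longrightarrow>
    emeasure lborel {\<xi>. infdist \<xi> M \<le> \<epsilon> \<and> infdist \<xi> M < \<delta>} \<le> ennreal (C0 * \<delta> ^ l)"
    using tube_measure[OF M] by blast
  define S where "S = (\<Sum>k. (real k + 1) ^ l * exp (- c * real k powr s))"
  have S: "(\<lambda>k. (real k + 1) ^ l * exp (- c * real k powr s)) sums S"
    unfolding S_def by (intro summable_sums shell_weights_summable s c)
  have S0: "S \<ge> 0" unfolding S_def by (intro suminf_nonneg shell_weights_summable s c) auto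
  have bm [measurable]: "(\<lambda>\<xi> :: real ^ 'n. infdist \<xi> M) \<in> borel_measurable borel"
    by (intro borel_measurable_continuous_onI continuous_on_infdist continuous_on_id)
  show ?thesis
  proof (rule exI[of _ \<epsilon>\<^sub>0], intro conjI C0 allI impI)
    fix \<epsilon> :: real assume \<epsilon>: "0 < \<epsilon>" "\<epsilon> < \<epsilon>\<^sub>0"
    define C where "C = exp (c * \<epsilon> powr s) * C0 * S + 1"
    have "(\<integral>\<^sup>+\<xi>. ?E \<epsilon> t \<xi> \<partial>lborel)
      \<le> ennreal (C * (1 + t) powr (- (real l / s)))" if t: "t \<ge> 0" for t
    proof -
      define r where "r = (1 + t) powr (- (1 / s))"
      have r: "r > 0" "r powr s * (1 + t) = 1" "r ^ l = (1 + t) powr (- (real l / s))"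
      proof -
        show "r > 0" using t by (simp add: r_def)
        have "r powr s = (1 + t) powr (- 1)" using s by (simp add: r_def powr_powr)
        then show "r powr s * (1 + t) = 1" using t by (simp add: powr_minus)
        have "r ^ l = r powr real l" using \<open>r > 0\<close> by (simp add: powr_realpow)
        then show "r ^ l = (1 + t) powr (- (real l / s))" by (simp add: r_def powr_powr)
      qed
      let ?A = "\<lambda>k. {\<xi>. infdist \<xi> M \<le> \<epsilon> \<and> infdist \<xi> M < (real k + 1) * r}"
      let ?g = "\<lambda>k \<xi>. ennreal (exp (c * \<epsilon> powr s) * exp (- c * real k powr s)) * indicator (?A k) \<xi>"
      have pt: "?E \<epsilon> t \<xi> \<le> (\<Sum>k. ?g k \<xi>)" for \<xi>
      proof (cases "infdist \<xi> M \<le> \<epsilon>")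
        case True
        define d where "d = infdist \<xi> M"
        have d: "0 \<le> d" "d \<le> \<epsilon>" using True by (auto simp: d_def infdist_nonneg)
        \<comment> \<open>the index of the shell that contains the point\<close>
        define k where "k = nat \<lfloor>d / r\<rfloor>"
        have k: "real k \<le> d / r" "d / r < real k + 1" using d r(1) by (auto simp: k_def)
        then have k': "real k * r \<le> d" "d < (real k + 1) * r" using r(1) by (auto simp: field_simps)
        have "real k powr s = (real k powr s * r powr s) * (1 + t)" using r(2) by (simp add: mult.assoc)
        also have "real k powr s * r powr s = (real k * r) powr s" using r(1) by (simp add: powr_mult)
        also have "(real k * r) powr s * (1 + t) \<le> d powr s * (1 + t)"
          using k' r(1) s t by (intro mult_right_mono powr_mono2) auto
        finally have "c * real k powr s \<le> c * d powr s * (1 + t)" using c by (simp add: mult.assoc)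
        \<comment> \<open>the price for having \<open>1 + t\<close> in place of \<open>t\<close>, bounded on the tube\<close>
        moreover have "c * d powr s \<le> c * \<epsilon> powr s" using d s c by (intro mult_left_mono powr_mono2) auto
        ultimately have "- (c * d powr s) * t \<le> c * \<epsilon> powr s + - c * real k powr s"
          by (simp add: algebra_simps)
        then have "ennreal (exp (- (c * d powr s) * t)) \<le> ?g k \<xi>"
          using d k' by (auto simp: exp_add[symmetric] d_def intro!: ennreal_leI)
        also have "\<dots> \<le> (\<Sum>k. ?g k \<xi>)"
        proof -
          have le: "G k \<le> suminf G" for G :: "nat \<Rightarrow> ennreal"
            using sum_le_suminf[of G "{k}"] by simp
          show ?thesis by (rule le)
        qed
        finally show ?thesis using True by (simp add: d_def)
      qed auto
      have [measurable]: "?A k \<in> sets borel" for k by measurable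
      have "(\<integral>\<^sup>+\<xi>. ?E \<epsilon> t \<xi> \<partial>lborel)
        \<le> (\<integral>\<^sup>+\<xi>. (\<Sum>k. ?g k \<xi>) \<partial>lborel)" by (intro nn_integral_mono pt)
      also have "\<dots> = (\<Sum>k. \<integral>\<^sup>+\<xi>. ?g k \<xi> \<partial>lborel)" by (rule nn_integral_suminf) measurable
      also have "\<dots> = (\<Sum>k. ennreal (exp (c * \<epsilon> powr s) * exp (- c * real k powr s)) * emeasure lborel (?A k))"
        by (intro suminf_cong nn_integral_cmult_indicator) auto
      also have "\<dots> \<le> (\<Sum>k. ennreal (exp (c * \<epsilon> powr s) * exp (- c * real k powr s)) * ennreal
        (C0 * ((real k + 1) * r) ^ l))"
        using r(1) by (intro suminf_le mult_left_mono meas \<epsilon>) auto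
      also have "\<dots> = (\<Sum>k. ennreal (exp (c * \<epsilon> powr s) * C0 * r ^ l *
        ((real k + 1) ^ l * exp (- c * real k powr s))))"
        using C0 r(1) by (intro suminf_cong) (simp add: ennreal_mult[symmetric] power_mult_distrib mult_ac)
      also have "\<dots> = ennreal (exp (c * \<epsilon> powr s) * C0 * r ^ l * S)"
        using C0 r(1) by (intro suminf_ennreal_eq sums_mult S) auto
      also have "exp (c * \<epsilon> powr s) * C0 * r ^ l * S \<le> C * r ^ l"
        using r(1) by (simp add: C_def algebra_simps)
      finally show ?thesis unfolding r(3) by (simp add: ennreal_leI)
    qed
    moreover have "C > 0" using C0 S0 by (simp add: C_def add_nonneg_pos)
    ultimately show "\<exists>C>0. \<forall>t\<ge>0.
      (\<integral>\<^sup>+\<xi>. ?E \<epsilon> t \<xi> \<partial>lborel)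
      \<le> ennreal (C * (1 + t) powr (- (real l / s)))" by blast
  qed
qed

section \<open>Continuity and uniform bounds for the root group\<close>

lemma continuous_on_hom_poly: "continuous_on UNIV (hom_poly j b)"
  unfolding hom_poly_def mi_power_def by (intro continuous_intros)

lemma continuous_on_full_symbol_coeff:
  fixes A :: "(real ^ 'n::finite) set"
  shows "continuous_on A (\<lambda>\<xi>. coeff (full_symbol m a c \<xi>) i)"
proof -
  have 1: "continuous_on A (\<lambda>\<xi>. if P then g \<xi> else 0)" if "continuous_on A g"
    for P and g :: "real ^ 'n \<Rightarrow> complex"
    using that by (cases P) auto
  have 2: "continuous_on A (\<lambda>\<xi>. hom_poly j b \<xi>)" for j b
    using continuous_on_subset[OF continuous_on_hom_poly] by blast
  show ?thesis
    unfolding full_symbol_def principal_symbol_def coeff_add coeff_sum coeff_monom case_prod_unfold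
    unfolding mi_power_def
    by (intro continuous_intros 1 2)
qed

text \<open>By Lagrange interpolation at \<open>0, \<dots>, n\<close> the coefficients are fixed linear combinations of
  values.\<close>

lemma continuous_on_coeff:
  fixes p :: "'a::topological_space \<Rightarrow> complex poly"
  assumes deg: "\<And>\<xi>. degree (p \<xi>) \<le> n" and cont: "\<And>z. continuous_on U (\<lambda>\<xi>. poly (p \<xi>) z)"
  shows "continuous_on U (\<lambda>\<xi>. coeff (p \<xi>) i)"
proof -
  define lagrange :: "nat \<Rightarrow> complex poly" where
    "lagrange j = (\<Prod>i\<in>{..n} - {j}. smult (1 / (of_nat j - of_nat i)) [:- of_nat i, 1:])" for j
  have val: "poly (lagrange j) (of_nat k) = (if j = k then 1 else 0)" if "j \<le> n" "k \<le> n" for j k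
  proof (cases "j = k")
    case True
    then show ?thesis unfolding lagrange_def poly_prod
      by (auto intro!: prod.neutral simp: diff_divide_distrib[symmetric])
  next
    case False
    then have "\<exists>i\<in>{..n} - {j}. poly (smult (1 / (of_nat j - of_nat i)) [:- of_nat i, 1:])
      (of_nat k :: complex) = 0"
      using that by (intro bexI[of _ k]) auto
    then show ?thesis using False unfolding lagrange_def poly_prod by (simp add: prod_zero_iff)
  qed
  have dl: "degree (lagrange j) \<le> n" if "j \<le> n" for j
  proof -
    have "degree (lagrange j) \<le> sum (degree \<circ>
      (\<lambda>i. smult (1 / (of_nat j - of_nat i)) [:- of_nat i, 1:] :: complex poly)) ({..n} - {j})"
      unfolding lagrange_def by (rule degree_prod_sum_le) simp
    also have "\<dots> \<le> (\<Sum>i\<in>{..n} - {j}. 1)" by (intro sum_mono) simp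
    also have "\<dots> = n" using that by (simp add: card_Diff_singleton)
    finally show ?thesis .
  qed
  let ?s = "\<lambda>\<xi>. \<Sum>j\<le>n. smult (poly (p \<xi>) (of_nat j)) (lagrange j)"
  have rep: "p \<xi> = (?s \<xi>)" for \<xi>
  proof (rule poly_eqI_degree[where A = "of_nat ` {..n}"])
    fix x :: complex assume "x \<in> of_nat ` {..n}"
    then obtain k where k: "k \<le> n" "x = of_nat k" by auto
    have "poly (?s \<xi>) x = (\<Sum>j\<le>n. if j = k then poly (p \<xi>) (of_nat j) else 0)"
      unfolding poly_sum using k by (intro sum.cong) (auto simp: val)
    then show "poly (p \<xi>) x = poly (?s \<xi>) x"
      using k by simp
  next
    have c: "card (of_nat ` {..n} :: complex set) = n + 1"
      by (subst card_image) (auto simp: inj_on_def)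
    show "degree (p \<xi>) < card (of_nat ` {..n} :: complex set)" unfolding c using deg[of \<xi>] by simp
    have "degree (?s \<xi>) \<le> n"
      by (rule degree_sum_le) (auto intro: dl)
    then show "degree (?s \<xi>) < card (of_nat ` {..n} :: complex set)" unfolding c by simp
  qed
  have "coeff (p \<xi>) i = (\<Sum>j\<le>n. poly (p \<xi>) (of_nat j) * coeff (lagrange j) i)" for \<xi>
    by (subst rep) (simp add: coeff_sum)
  then show ?thesis by (simp only:) (intro continuous_intros cont)
qed

text \<open>Division by a monic polynomial determines the coefficients of the quotient from the top
  downwards, each as a polynomial in the given coefficients and those already found.\<close>

lemma continuous_on_cofactor_coeff:
  fixes P Q R :: "'a::topological_space \<Rightarrow> complex poly"
  assumes PQ: "\<And>\<xi>. P \<xi> = Q \<xi> * R \<xi>" and q: "\<And>\<xi>. degree (Q \<xi>) = q" "\<And>\<xi>. coeff (Q \<xi>) q = 1"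
    and d: "\<And>\<xi>. degree (R \<xi>) \<le> d"
    and cP: "\<And>i. continuous_on U (\<lambda>\<xi>. coeff (P \<xi>) i)" and cQ: "\<And>i. continuous_on U (\<lambda>\<xi>. coeff (Q \<xi>) i)"
  shows "continuous_on U (\<lambda>\<xi>. coeff (R \<xi>) i)"
proof (induction "Suc d - i" arbitrary: i rule: less_induct)
  case less
  let ?c = "\<lambda>b \<xi>. if b \<le> q + i then coeff (Q \<xi>) (q + i - b) else 0"
  show ?case
  proof (cases "i \<le> d")
    case False
    then have "coeff (R \<xi>) i = 0" for \<xi> using d[of \<xi>] by (intro coeff_eq_0) simp
    then show ?thesis by simp
  next
    case True
    have "coeff (R \<xi>) i = coeff (P \<xi>) (q + i) - (\<Sum>b\<in>{i<..d}. coeff (R \<xi>) b * ?c b \<xi>)" for \<xi>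
    proof -
      have "coeff (P \<xi>) (q + i) = (\<Sum>b\<le>q + i. coeff (R \<xi>) b * coeff (Q \<xi>) (q + i - b))"
        unfolding PQ by (subst mult.commute) (simp add: coeff_mult)
      also have "\<dots> = (\<Sum>b\<in>{i..d} \<inter> {..q + i}. coeff (R \<xi>) b * coeff (Q \<xi>) (q + i - b))"
      proof (rule sum.mono_neutral_right)
        show "\<forall>b\<in>{..q + i} - {i..d} \<inter> {..q + i}. coeff (R \<xi>) b * coeff (Q \<xi>) (q + i - b) = 0"
        proof
          fix b assume "b \<in> {..q + i} - {i..d} \<inter> {..q + i}"
          then have "b < i \<and> b \<le> q + i \<or> d < b" by auto
          then show "coeff (R \<xi>) b * coeff (Q \<xi>) (q + i - b) = 0"
            using d[of \<xi>] q(1)[of \<xi>] by (auto simp: coeff_eq_0)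
        qed
      qed auto
      also have "\<dots> = (\<Sum>b\<in>{i..d}. coeff (R \<xi>) b * ?c b \<xi>)"
        by (subst sum.inter_restrict) (auto intro!: sum.cong)
      also have "{i..d} = insert i {i<..d}" using True by auto
      also have "(\<Sum>b\<in>insert i {i<..d}. coeff (R \<xi>) b * ?c b \<xi>)
        = coeff (R \<xi>) i + (\<Sum>b\<in>{i<..d}. coeff (R \<xi>) b * ?c b \<xi>)"
        using q(2)[of \<xi>] by simp
      finally show ?thesis by simp
    qed
    moreover have "continuous_on U (\<lambda>\<xi>. coeff (P \<xi>) (q + i) - (\<Sum>b\<in>{i<..d}. coeff (R \<xi>) b * ?c b \<xi>))"
    proof (intro continuous_on_diff continuous_on_sum continuous_on_mult cP)
      show "continuous_on U (\<lambda>\<xi>. coeff (R \<xi>) b)" if "b \<in> {i<..d}" for b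
        by (rule less) (use that True in auto)
      show "continuous_on U (?c b)" for b
        using cQ by (cases "b \<le> q + i") auto
    qed
    ultimately show ?thesis by (simp only:)
  qed
qed

lemma monic_root_bound:
  fixes p :: "complex poly"
  assumes "degree p = m" "coeff p m = 1" "poly p z = 0" "(\<Sum>i<m. norm (coeff p i)) \<le> \<rho>" "\<rho> \<ge> 1"
  shows "norm z \<le> \<rho>"
proof (rule ccontr)
  assume "\<not> norm z \<le> \<rho>"
  then have z: "norm z > \<rho>" "norm z \<ge> 1" using assms(5) by auto
  have m: "m > 0"
  proof (rule ccontr)
    assume "\<not> m > 0"
    then have "poly p z = 1" using assms(1,2) by (simp add: poly_altdef)
    then show False using assms(3) by simp
  qed
  have "0 = (\<Sum>i\<le>m. coeff p i * z ^ i)" using assms(1,3) by (simp add: poly_altdef)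
  also have "{..m} = insert m {..<m}" by auto
  finally have "z ^ m = - (\<Sum>i<m. coeff p i * z ^ i)" using assms(2) by (simp add: eq_neg_iff_add_eq_0)
  then have "norm z ^ m = norm (\<Sum>i<m. coeff p i * z ^ i)" by (metis norm_minus_cancel norm_power)
  also have "\<dots> \<le> (\<Sum>i<m. norm (coeff p i) * norm z ^ (m - 1))"
    using z by (intro sum_norm_le) (auto simp: norm_mult norm_power intro!: mult_left_mono power_increasing)
  also have "\<dots> \<le> \<rho> * norm z ^ (m - 1)"
    unfolding sum_distrib_right[symmetric] using assms(4) by (intro mult_right_mono) auto
  also have "\<dots> < norm z * norm z ^ (m - 1)" using z assms(5)
    by (intro mult_strict_right_mono zero_less_power) auto
  also have "\<dots> = norm z ^ m" using m by (cases m) auto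
  finally show False by simp
qed

lemma recurrence_growth:
  fixes p :: "complex poly"
  assumes p: "degree p = m" "coeff p m = 1" "(\<Sum>i<m. norm (coeff p i)) \<le> \<rho>" "\<rho> \<ge> 1"
    and e: "shift_poly p e = (\<lambda>n. 0)" "\<And>l. l < m \<Longrightarrow> norm (e l) \<le> 1" "m > 0"
  shows "norm (e n) \<le> \<rho> ^ n"
proof (induction n rule: less_induct)
  case (less n)
  show ?case
  proof (cases "n < m")
    case True
    then show ?thesis using e(2)[OF True] one_le_power[OF p(4), of n] by linarith
  next
    case False
    then obtain k where k: "n = k + m" by (metis add.commute le_Suc_ex not_less)
    have "0 = (\<Sum>i\<le>m. coeff p i * e (k + i))" using fun_cong[OF e(1), of k] p(1) by (simp add: shift_poly_def)
    also have "{..m} = insert m {..<m}" by auto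
    finally have "e n = - (\<Sum>i<m. coeff p i * e (k + i))" using p(2) by (simp add: k eq_neg_iff_add_eq_0)
    then have "norm (e n) = norm (\<Sum>i<m. coeff p i * e (k + i))" by (metis norm_minus_cancel)
    also have "\<dots> \<le> (\<Sum>i<m. norm (coeff p i) * \<rho> ^ (n - 1))"
    proof (intro sum_norm_le)
      fix i assume i: "i \<in> {..<m}"
      then have "norm (e (k + i)) \<le> \<rho> ^ (k + i)" by (intro less) (simp add: k)
      also have "\<dots> \<le> \<rho> ^ (n - 1)" using p(4) i by (intro power_increasing) (auto simp: k)
      finally show "norm (coeff p i * e (k + i)) \<le> norm (coeff p i) * \<rho> ^ (n - 1)"
        by (simp add: norm_mult mult_left_mono)
    qed
    also have "\<dots> \<le> \<rho> * \<rho> ^ (n - 1)"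
      unfolding sum_distrib_right[symmetric] using p(3,4) by (intro mult_right_mono) auto
    also have "\<dots> = \<rho> ^ n" using e(3) k power_minus_mult[of n \<rho>] by (simp add: mult.commute)
    finally show ?thesis .
  qed
qed

text \<open>The closed graph criterion for maps into a compact set.\<close>

lemma continuous_on_if_unique_limits:
  fixes f :: "'a::metric_space \<Rightarrow> 'b::metric_space"
  assumes T: "compact T" "\<And>x. x \<in> S \<Longrightarrow> f x \<in> T"
    and lim: "\<And>X x y. (\<And>i. X i \<in> S) \<Longrightarrow> X \<longlonglongrightarrow> x \<Longrightarrow> x \<in> S \<Longrightarrow> (\<lambda>i. f (X i)) \<longlonglongrightarrow> y \<Longrightarrow> y = f x"
  shows "continuous_on S f"
  unfolding continuous_on_sequentially comp_def
proof (intro allI ballI impI, elim conjE)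
  fix X x assume x: "x \<in> S" and X: "\<forall>n. X n \<in> S" "X \<longlonglongrightarrow> x"
  show "(\<lambda>n. f (X n)) \<longlonglongrightarrow> f x"
  proof (rule ccontr)
    assume "\<not> ?thesis"
    then obtain e where e: "e > 0" "\<not> eventually (\<lambda>n. dist (f (X n)) (f x) < e) sequentially"
      unfolding tendsto_iff by blast
    then have "infinite {n. \<not> dist (f (X n)) (f x) < e}"
      by (simp add: eventually_cofinite[symmetric] cofinite_eq_sequentially)
    then obtain r :: "nat \<Rightarrow> nat" where r: "strict_mono r" "\<And>n. r n \<in> {n. \<not> dist (f (X n)) (f x) < e}"
      using infinite_enumerate by blast
    have fT: "f (X (r n)) \<in> T" for n using T(2) X(1) by blast
    obtain y r' where y: "y \<in> T" "strict_mono r'" "((\<lambda>n. f (X (r n))) \<circ> r') \<longlonglongrightarrow> y"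
      using seq_compactE[OF compact_imp_seq_compact[OF T(1)], of "\<lambda>n. f (X (r n))"] fT by metis
    have "y = f x"
    proof (rule lim[of "\<lambda>n. X (r (r' n))" x y])
      show "X (r (r' n)) \<in> S" for n using X(1) by blast
      show "(\<lambda>n. f (X (r (r' n)))) \<longlonglongrightarrow> y" using y(3) by (simp only: comp_def)
      show "(\<lambda>n. X (r (r' n))) \<longlonglongrightarrow> x"
        using LIMSEQ_subseq_LIMSEQ[OF X(2) strict_mono_o[OF r(1) y(2)]] by (simp add: comp_def)
    qed (rule x)
    then have "eventually (\<lambda>n. dist (f (X (r (r' n)))) (f x) < e) sequentially"
      using tendstoD[OF y(3) e(1)] by (simp add: comp_def)
    then obtain n where "dist (f (X (r (r' n)))) (f x) < e" by (auto simp: eventually_sequentially)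
    then show False using r(2)[of "r' n"] by simp
  qed
qed

text \<open>Bounded sequences indexed by \<open>\<xi>\<close> take values in a compact product space, and the equations for
  \<open>w\<close> and \<open>e - w\<close> pass to limits. Coprimality makes their solution unique, so that the closed graph
  criterion applies.\<close>

lemma continuous_on_group_sequence:
  fixes w :: "'a::metric_space \<Rightarrow> nat \<Rightarrow> complex"
  assumes deg: "\<And>\<xi>. degree (Q \<xi>) \<le> N" "\<And>\<xi>. degree (R \<xi>) \<le> N"
    and cont: "\<And>i. continuous_on K (\<lambda>\<xi>. coeff (Q \<xi>) i)" "\<And>i. continuous_on K (\<lambda>\<xi>. coeff (R \<xi>) i)"
      "\<And>n. continuous_on K (\<lambda>\<xi>. e \<xi> n)"
    and cop: "\<And>\<xi>. \<xi> \<in> K \<Longrightarrow> coprime (Q \<xi>) (R \<xi>)"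
    and w: "\<And>\<xi>. \<xi> \<in> K \<Longrightarrow> shift_poly (Q \<xi>) (w \<xi>) = (\<lambda>n. 0)"
      "\<And>\<xi>. \<xi> \<in> K \<Longrightarrow> shift_poly (R \<xi>) (\<lambda>n. e \<xi> n - w \<xi> n) = (\<lambda>n. 0)"
    and bd: "\<And>\<xi> n. \<xi> \<in> K \<Longrightarrow> norm (w \<xi> n) \<le> B n"
  shows "continuous_on K (\<lambda>\<xi>. w \<xi> n)"
proof -
  have "compactin (product_topology (\<lambda>_::nat. euclidean :: complex topology) UNIV)
    (PiE UNIV (\<lambda>n. cball 0 (B n)))"
    by (simp add: compactin_PiE)
  then have cpt: "compact (PiE UNIV (\<lambda>n. cball 0 (B n)) :: (nat \<Rightarrow> complex) set)"
    by (simp add: euclidean_product_topology)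
  have "continuous_on K w"
  proof (rule continuous_on_if_unique_limits[OF cpt])
    show "w \<xi> \<in> PiE UNIV (\<lambda>n. cball 0 (B n))" if "\<xi> \<in> K" for \<xi> using bd[OF that] by (simp add: PiE_def)
    fix X x y assume X: "\<And>i. X i \<in> K" "X \<longlonglongrightarrow> x" "x \<in> K" "(\<lambda>i. w (X i)) \<longlonglongrightarrow> y"
    have wy: "(\<lambda>i. w (X i) n) \<longlonglongrightarrow> y n" for n
      using continuous_on_tendsto_compose[OF continuous_on_product_coordinates[of n] X(4)] by simp
    have cl: "(\<lambda>i. g (X i)) \<longlonglongrightarrow> g x" if "continuous_on K g" for g :: "'a \<Rightarrow> complex"
      using continuous_on_tendsto_compose[OF that X(2,3)] X(1) by simp
    have Q0: "shift_poly (Q x) y = (\<lambda>n. 0)"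
    proof
      fix n
      have "(\<lambda>i. \<Sum>j\<le>N. coeff (Q (X i)) j * w (X i) (n + j)) \<longlonglongrightarrow> (\<Sum>j\<le>N. coeff (Q x) j * y (n + j))"
        by (intro tendsto_sum tendsto_mult cl cont wy)
      also have "(\<lambda>i. \<Sum>j\<le>N. coeff (Q (X i)) j * w (X i) (n + j)) = (\<lambda>i. 0)"
        using w(1)[OF X(1)] by (auto simp: fun_eq_iff shift_poly_eq[OF deg(1), symmetric])
      finally show "shift_poly (Q x) y n = 0"
        by (simp add: shift_poly_eq[OF deg(1)] LIMSEQ_const_iff)
    qed
    have R0: "shift_poly (R x) (\<lambda>n. e x n - y n) = (\<lambda>n. 0)"
    proof
      fix n
      have "(\<lambda>i. \<Sum>j\<le>N. coeff (R (X i)) j * (e (X i) (n + j) - w (X i) (n + j)))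
        \<longlonglongrightarrow> (\<Sum>j\<le>N. coeff (R x) j * (e x (n + j) - y (n + j)))"
        by (intro tendsto_sum tendsto_mult tendsto_diff cl cont wy)
      also have "(\<lambda>i. \<Sum>j\<le>N. coeff (R (X i)) j * (e (X i) (n + j) - w (X i) (n + j))) = (\<lambda>i. 0)"
        using w(2)[OF X(1)] by (auto simp: fun_eq_iff shift_poly_eq[OF deg(2)])
      finally show "shift_poly (R x) (\<lambda>n. e x n - y n) n = 0"
        by (simp add: shift_poly_eq[OF deg(2)] LIMSEQ_const_iff)
    qed
    have "(\<lambda>n. y n - w x n) = (\<lambda>n. 0)"
    proof (rule shift_poly_coprime[OF cop[OF X(3)]])
      show "shift_poly (Q x) (\<lambda>n. y n - w x n) = (\<lambda>n. 0)"
        using Q0 w(1)[OF X(3)] by (simp add: fun_eq_iff shift_poly_seq_diff)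
      have "(\<lambda>n. y n - w x n) = (\<lambda>n. (e x n - w x n) - (e x n - y n))" by auto
      then show "shift_poly (R x) (\<lambda>n. y n - w x n) = (\<lambda>n. 0)"
        using R0 w(2)[OF X(3)] by (simp add: fun_eq_iff shift_poly_seq_diff del: diff_diff_eq2)
    qed
    then show "y = w x" by (auto simp: fun_eq_iff)
  qed
  then show ?thesis
    using continuous_on_compose2[OF continuous_on_product_coordinates[of n]] by blast
qed

lemma monic_linear_prod:
  fixes \<tau> :: "nat \<Rightarrow> complex"
  assumes "finite S"
  shows "degree (\<Prod>k\<in>S. [:- \<tau> k, 1:]) = card S" "coeff (\<Prod>k\<in>S. [:- \<tau> k, 1:]) (card S) = 1"
proof -
  show d: "degree (\<Prod>k\<in>S. [:- \<tau> k, 1:]) = card S"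
    by (subst degree_prod_eq_sum_degree) auto
  have "lead_coeff (\<Prod>k\<in>S. [:- \<tau> k, 1:]) = 1" by (simp add: lead_coeff_prod)
  then show "coeff (\<Prod>k\<in>S. [:- \<tau> k, 1:]) (card S) = 1" by (simp add: d)
qed

lemma shift_poly_sum_killed:
  assumes "finite S" "\<And>k. k \<in> S \<Longrightarrow> shift_poly ([:- \<tau> k, 1:] ^ N k) (s k) = (\<lambda>n. 0)"
  shows "shift_poly ((\<Prod>k\<in>S. [:- \<tau> k, 1:]) ^ (\<Sum>k\<in>S. N k)) (\<lambda>n. \<Sum>k\<in>S. s k n) = (\<lambda>n. 0)"
proof
  fix n
  have "shift_poly ((\<Prod>k\<in>S. [:- \<tau> k, 1:]) ^ (\<Sum>k\<in>S. N k)) (s k) = (\<lambda>n. 0)" if k: "k \<in> S" for k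
  proof (rule shift_poly_dvd[OF _ assms(2)[OF k]])
    have "[:- \<tau> k, 1:] ^ N k dvd [:- \<tau> k, 1:] ^ (\<Sum>k\<in>S. N k)"
      by (rule le_imp_power_dvd) (rule member_le_sum[OF k _ assms(1)], simp)
    also have "\<dots> dvd (\<Prod>k\<in>S. [:- \<tau> k, 1:]) ^ (\<Sum>k\<in>S. N k)"
      by (rule dvd_power_same) (rule dvd_prodI[OF assms(1) k])
    finally show "[:- \<tau> k, 1:] ^ N k dvd (\<Prod>k\<in>S. [:- \<tau> k, 1:]) ^ (\<Sum>k\<in>S. N k)" .
  qed
  then show "shift_poly ((\<Prod>k\<in>S. [:- \<tau> k, 1:]) ^ (\<Sum>k\<in>S. N k)) (\<lambda>n. \<Sum>k\<in>S. s k n) n = 0"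
    by (simp add: shift_poly_seq_sum)
qed

lemma compact_bound_above:
  fixes g :: "'a::metric_space \<Rightarrow> real"
  assumes "compact K" "continuous_on K g"
  obtains B where "B \<ge> 1" "\<And>\<xi>. \<xi> \<in> K \<Longrightarrow> g \<xi> \<le> B"
proof -
  have "bounded (g ` K)" by (intro compact_imp_bounded compact_continuous_image assms)
  then obtain B where "\<And>\<xi>. \<xi> \<in> K \<Longrightarrow> \<bar>g \<xi>\<bar> \<le> B" by (auto simp: bounded_iff)
  then have "g \<xi> \<le> max 1 B" if "\<xi> \<in> K" for \<xi> using that by (meson abs_ge_self max.coboundedI2 order_trans)
  then show ?thesis by (intro that[of "max 1 B"]) auto
qed

lemma poly_sum_le: "degree (p :: complex poly) \<le> N \<Longrightarrow> poly p z = (\<Sum>i\<le>N. coeff p i * z ^ i)"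
  unfolding poly_altdef by (intro sum.mono_neutral_left) (auto simp: coeff_eq_0)

text \<open>The pairs of a parameter and a root of \<open>Q\<close> form a compact set, on which \<open>R\<close> has no zero. This
  set is closed because the coefficients are continuous, even where the roots cannot be numbered
  continuously.\<close>

lemma separated_roots_lower_bound:
  fixes Q R :: "'a::metric_space \<Rightarrow> complex poly"
  assumes K: "compact K"
    and deg: "\<And>\<xi>. degree (Q \<xi>) \<le> N" "\<And>\<xi>. degree (R \<xi>) \<le> N"
    and cont: "\<And>i. continuous_on K (\<lambda>\<xi>. coeff (Q \<xi>) i)" "\<And>i. continuous_on K (\<lambda>\<xi>. coeff (R \<xi>) i)"
    and sep: "\<And>\<xi> z. \<xi> \<in> K \<Longrightarrow> poly (Q \<xi>) z = 0 \<Longrightarrow> poly (R \<xi>) z \<noteq> 0"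
    and bd: "\<And>\<xi> z. \<xi> \<in> K \<Longrightarrow> poly (Q \<xi>) z = 0 \<Longrightarrow> norm z \<le> \<rho>"
  obtains \<delta> where "\<delta> > 0" "\<And>\<xi> z. \<xi> \<in> K \<Longrightarrow> poly (Q \<xi>) z = 0 \<Longrightarrow> \<delta> \<le> norm (poly (R \<xi>) z)"
proof -
  let ?S = "K \<times> cball 0 \<rho> :: ('a \<times> complex) set"
  have pc: "continuous_on ?S (\<lambda>p. poly (F (fst p)) (snd p))"
    if "\<And>\<xi>. degree (F \<xi>) \<le> N" "\<And>i. continuous_on K (\<lambda>\<xi>. coeff (F \<xi>) i)" for F :: "'a \<Rightarrow> complex poly"
  proof -
    have "continuous_on ?S (\<lambda>p. \<Sum>i\<le>N. coeff (F (fst p)) i * snd p ^ i)"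
      by (intro continuous_intros continuous_on_compose2[OF that(2)]) auto
    then show ?thesis by (simp add: poly_sum_le[OF that(1)])
  qed
  define Z where "Z = {p \<in> ?S. poly (Q (fst p)) (snd p) = 0}"
  have S: "compact ?S" by (intro compact_Times K) simp
  have "closed Z" unfolding Z_def
    by (rule continuous_closed_preimage_constant[OF pc[OF deg(1) cont(1)] compact_imp_closed[OF S]])
  then have "compact (?S \<inter> Z)" by (rule compact_Int_closed[OF S])
  moreover have "?S \<inter> Z = Z" by (auto simp: Z_def)
  ultimately have Z: "compact Z" by simp
  have cR: "continuous_on Z (\<lambda>p. norm (poly (R (fst p)) (snd p)))"
    by (intro continuous_on_norm continuous_on_subset[OF pc[OF deg(2) cont(2)]]) (auto simp: Z_def)
  show ?thesis
  proof (cases "Z = {}")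
    case True
    have "(\<xi>, z) \<in> Z" if "\<xi> \<in> K" "poly (Q \<xi>) z = 0" for \<xi> z using that bd by (simp add: Z_def)
    then show ?thesis using True by (intro that[of 1]) auto
  next
    case False
    then obtain p where p: "p \<in> Z" "\<And>q. q \<in> Z \<Longrightarrow> norm (poly (R (fst p)) (snd p))
      \<le> norm (poly (R (fst q)) (snd q))"
      using continuous_attains_inf[OF Z False cR] by blast
    show ?thesis
    proof (rule that[of "norm (poly (R (fst p)) (snd p))"])
      show "norm (poly (R (fst p)) (snd p)) > 0" using p(1) sep by (auto simp: Z_def)
      fix \<xi> z assume "\<xi> \<in> K" "poly (Q \<xi>) z = 0"
      then show "norm (poly (R (fst p)) (snd p)) \<le> norm (poly (R \<xi>) z)" using p(2)[of "(\<xi>, z)"] bd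
        by (simp add: Z_def)
    qed
  qed
qed

text \<open>The growth rate \<open>\<rho>\<close> is kept and each factor multiplies the constant by at most \<open>D\<close>.\<close>

lemma projection_growth:
  assumes R: "degree R \<le> N" "(\<Sum>i\<le>N. norm (coeff R i)) \<le> C" and \<rho>: "\<rho> \<ge> 1" and D: "D = 1 + b * C * \<rho> ^ N"
    and u: "\<And>n. norm (u n) \<le> B * \<rho> ^ n" and S: "finite S" "\<And>k. k \<in> S \<Longrightarrow> norm (\<beta> k) \<le> b" and b: "b \<ge> 0" "B \<ge> 0"
  shows "norm (shift_poly (\<Prod>k\<in>S. 1 - smult (\<beta> k) R) u n) \<le> B * D ^ card S * \<rho> ^ n"
  using S(1,2)
proof (induction S arbitrary: n rule: finite_induct)
  case empty
  then show ?case using u by simp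
next
  case (insert k S)
  let ?v = "shift_poly (\<Prod>k\<in>S. 1 - smult (\<beta> k) R) u"
  have C: "C \<ge> 0" using R(2) by (rule order_trans[rotated]) (auto intro: sum_nonneg)
  have D1: "D \<ge> 1" unfolding D using b C \<rho> by simp
  have v: "norm (?v n) \<le> (B * D ^ card S) * \<rho> ^ n" for n using insert by simp
  have BD: "B * D ^ card S \<ge> 0" using b D1 by simp
  have "norm (\<Sum>i\<le>N. coeff R i * ?v (n + i)) \<le> (\<Sum>i\<le>N. norm (coeff R i) * ((B * D ^ card S) * \<rho> ^ (n + N)))"
  proof (intro sum_norm_le)
    fix i assume i: "i \<in> {..N}"
    have "norm (?v (n + i)) \<le> (B * D ^ card S) * \<rho> ^ (n + i)" by (rule v)
    also have "\<dots> \<le> (B * D ^ card S) * \<rho> ^ (n + N)"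
      using i \<rho> BD by (intro mult_left_mono power_increasing) auto
    finally show "norm (coeff R i * ?v (n + i)) \<le> norm (coeff R i) * ((B * D ^ card S) * \<rho> ^ (n + N))"
      unfolding norm_mult by (rule mult_left_mono) simp
  qed
  also have "\<dots> \<le> C * ((B * D ^ card S) * \<rho> ^ (n + N))"
    unfolding sum_distrib_right[symmetric] using R(2) BD \<rho> by (intro mult_right_mono) auto
  finally have Rv: "norm (shift_poly R ?v n) \<le> C * ((B * D ^ card S) * \<rho> ^ (n + N))"
    by (simp add: shift_poly_eq[OF R(1)])
  have "shift_poly (\<Prod>k\<in>insert k S. 1 - smult (\<beta> k) R) u n = ?v n - \<beta> k * shift_poly R ?v n"
    using insert.hyps by (simp add: shift_poly_mult shift_poly_diff shift_poly_smult)
  also have "norm \<dots> \<le> norm (?v n) + norm (\<beta> k) * norm (shift_poly R ?v n)"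
    by (metis norm_mult norm_triangle_ineq4)
  also have "\<dots> \<le> (B * D ^ card S) * \<rho> ^ n + b * (C * ((B * D ^ card S) * \<rho> ^ (n + N)))"
    using insert.prems b by (intro add_mono v mult_mono Rv) auto
  also have "\<dots> = B * D ^ card (insert k S) * \<rho> ^ n"
    using insert.hyps by (simp add: D power_add algebra_simps)
  finally show ?case .
qed

lemma continuous_on_recurrence:
  fixes e :: "'a::metric_space \<Rightarrow> nat \<Rightarrow> complex"
  assumes P: "\<And>\<xi>. degree (P \<xi>) = m" "\<And>\<xi>. coeff (P \<xi>) m = 1" "\<And>i. continuous_on K (\<lambda>\<xi>. coeff (P \<xi>) i)"
    and e: "\<And>\<xi>. shift_poly (P \<xi>) (e \<xi>) = (\<lambda>n. 0)" "\<And>l \<xi>. l < m \<Longrightarrow> e \<xi> l = d l" and "m > 0"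
  shows "continuous_on K (\<lambda>\<xi>. e \<xi> n)"
proof (induction n rule: less_induct)
  case (less n)
  show ?case
  proof (cases "n < m")
    case False
    then obtain k where k: "n = k + m" by (metis add.commute le_Suc_ex not_less)
    have "e \<xi> n = - (\<Sum>i<m. coeff (P \<xi>) i * e \<xi> (k + i))" for \<xi>
    proof -
      have "0 = (\<Sum>i\<le>m. coeff (P \<xi>) i * e \<xi> (k + i))" using fun_cong[OF e(1)[of \<xi>], of k] P(1)[of \<xi>]
        by (simp add: shift_poly_def)
      also have "{..m} = insert m {..<m}" by auto
      finally show ?thesis using P(2)[of \<xi>] by (simp add: k eq_neg_iff_add_eq_0)
    qed
    moreover have "continuous_on K (\<lambda>\<xi>. - (\<Sum>i<m. coeff (P \<xi>) i * e \<xi> (k + i)))"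
      by (intro continuous_intros P less) (simp add: k)
    ultimately show ?thesis by simp
  qed (simp add: e(2))
qed

text \<open>The derivatives at 0 are bounded for \<open>E\<^sub>j\<close> by the recurrence from its fixed initial data, then
  for \<open>V\<close> by the projection formula, and finally for \<open>W = E\<^sub>j - V\<close>.\<close>

lemma group_wave_sequence:
  fixes a :: "nat \<Rightarrow> 'n::finite multi_index \<Rightarrow> complex" and K :: "(real ^ 'n) set"
  assumes roots: "char_roots m a c \<tau>" and ampl: "amplitudes m a c \<tau> A"
    and L: "1 \<le> L" "L \<le> m" and j: "j < m"
    and K: "compact K" "K \<subseteq> U" and cont: "continuous_root_group U L \<tau>"
    and sep: "\<And>\<xi> k k'. \<xi> \<in> K \<Longrightarrow> k \<in> {1..L} \<Longrightarrow> k' \<in> {L+1..m} \<Longrightarrow> \<tau> k \<xi> \<noteq> \<tau> k' \<xi>"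
  obtains w :: "real ^ 'n \<Rightarrow> nat \<Rightarrow> complex" and B \<rho> where "\<rho> \<ge> 1" "B > 0"
    "\<And>\<xi> n. \<xi> \<in> K \<Longrightarrow> norm (w \<xi> n) \<le> B * \<rho> ^ n"
    "\<And>n. continuous_on K (\<lambda>\<xi>. w \<xi> n)"
    "\<And>\<xi>. \<xi> \<in> K \<Longrightarrow> shift_poly (\<Prod>k=1..L. [:- \<tau> k \<xi>, 1:]) (w \<xi>) = (\<lambda>n. 0)"
    "\<And>\<xi> k. \<xi> \<in> K \<Longrightarrow> k \<in> {1..L} \<Longrightarrow> norm (\<tau> k \<xi>) \<le> \<rho>"
    "\<And>\<xi> t. jet_fun (w \<xi>) t = (\<Sum>k=1..L. exp (\<i> * \<tau> k \<xi> * of_real t) * poly (A j k \<xi>) (of_real t))"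
proof -
  let ?a = "\<lambda>k \<xi> t. exp (\<i> * \<tau> k \<xi> * of_real t) * poly (A j k \<xi>) (of_real t)"
  define P where "P \<xi> = full_symbol m a c \<xi>" for \<xi>
  define Q where "Q \<xi> = (\<Prod>k=1..L. [:- \<tau> k \<xi>, 1:])" for \<xi>
  define R where "R \<xi> = (\<Prod>k\<in>{L+1..m}. [:- \<tau> k \<xi>, 1:])" for \<xi>
  have un: "{1..m} = {1..L} \<union> {L+1..m}" using L by auto
  have Pp: "P \<xi> = (\<Prod>k=1..m. [:- \<tau> k \<xi>, 1:])" for \<xi> using roots by (simp add: P_def char_roots_def)
  have PQ: "P \<xi> = Q \<xi> * R \<xi>" for \<xi> unfolding Pp Q_def R_def un by (rule prod.union_disjoint) auto
  have dP: "degree (P \<xi>) = m" "coeff (P \<xi>) m = 1" for \<xi>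
    using monic_linear_prod[of "{1..m}" "\<lambda>k. \<tau> k \<xi>"] by (simp_all add: Pp)
  have dQ: "degree (Q \<xi>) = L" "coeff (Q \<xi>) L = 1" for \<xi>
    using monic_linear_prod[of "{1..L}" "\<lambda>k. \<tau> k \<xi>"] by (simp_all add: Q_def)
  have dR: "degree (R \<xi>) = m - L" for \<xi>
    using monic_linear_prod[of "{L+1..m}" "\<lambda>k. \<tau> k \<xi>"] by (simp add: R_def)
  have cP: "continuous_on K (\<lambda>\<xi>. coeff (P \<xi>) i)" for i
    unfolding P_def by (rule continuous_on_full_symbol_coeff)
  have "continuous_on U (\<lambda>\<xi>. coeff (Q \<xi>) i)" for i
    using cont dQ(1) by (intro continuous_on_coeff[where n = L]) (auto simp: continuous_root_group_def Q_def)
  then have cQ: "continuous_on K (\<lambda>\<xi>. coeff (Q \<xi>) i)" for i using K(2) continuous_on_subset by blast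
  have cR: "continuous_on K (\<lambda>\<xi>. coeff (R \<xi>) i)" for i
    by (rule continuous_on_cofactor_coeff[OF PQ dQ eq_imp_le[OF dR] cP cQ])
  have Qroot: "poly (Q \<xi>) z = 0 \<longleftrightarrow> (\<exists>k\<in>{1..L}. z = \<tau> k \<xi>)" for \<xi> z
    by (auto simp: Q_def poly_prod prod_zero_iff)
  have Rroot: "poly (R \<xi>) z = 0 \<longleftrightarrow> (\<exists>k\<in>{L+1..m}. z = \<tau> k \<xi>)" for \<xi> z
    by (auto simp: R_def poly_prod prod_zero_iff)
  have sepQ: "poly (R \<xi>) z \<noteq> 0" if "\<xi> \<in> K" "poly (Q \<xi>) z = 0" for \<xi> z
    using that sep[OF that(1)] unfolding Qroot Rroot by metis
  have Q0: "poly (Q \<xi>) (\<tau> k \<xi>) = 0" if "k \<in> {1..L}" for \<xi> k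
    unfolding Qroot using that by blast
  have cop: "coprime (Q \<xi>) (R \<xi>)" if "\<xi> \<in> K" for \<xi>
    unfolding Q_def
  proof (rule prod_coprime_left)
    fix k assume "k \<in> {1..L}"
    then show "coprime [:- \<tau> k \<xi>, 1:] (R \<xi>)" by (intro coprime_linear sepQ[OF that] Q0)
  qed
  \<comment> \<open>one sequence for each single term; only the sums over the two groups are well behaved in \<open>\<xi>\<close>\<close>
  obtain s N where s: "\<And>k \<xi>. geometric (s k \<xi>)" "\<And>k \<xi> t. jet_fun (s k \<xi>) t = ?a k \<xi> t"
    "\<And>k \<xi>. shift_poly ([:- \<tau> k \<xi>, 1:] ^ N k \<xi>) (s k \<xi>) = (\<lambda>n. 0)"
  proof -
    define good where "good x y \<longleftrightarrow> geometric (fst y) \<and>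
        (\<forall>t. jet_fun (fst y) t = exp (\<i> * \<tau> (fst x) (snd x) * of_real t) * poly (A j (fst x) (snd x))
          (of_real t)) \<and>
        shift_poly ([:- \<tau> (fst x) (snd x), 1:] ^ snd y) (fst y) = (\<lambda>n. 0)" for x y
    have "\<exists>y. good x y" for x
      using exp_poly_seq[of "\<tau> (fst x) (snd x)" "A j (fst x) (snd x)"] unfolding good_def by auto
    then obtain F where F: "\<And>x. good x (F x)" by metis
    show ?thesis
    proof (rule that)
      fix k \<xi> t
      show "geometric (fst (F (k, \<xi>)))" "jet_fun (fst (F (k, \<xi>))) t = ?a k \<xi> t"
        "shift_poly ([:- \<tau> k \<xi>, 1:] ^ snd (F (k, \<xi>))) (fst (F (k, \<xi>))) = (\<lambda>n. 0)"
        using F[of "(k, \<xi>)"] by (simp_all add: good_def)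
    qed
  qed
  define w where "w \<xi> n = (\<Sum>k=1..L. s k \<xi> n)" for \<xi> n
  define v where "v \<xi> n = (\<Sum>k=L+1..m. s k \<xi> n)" for \<xi> n
  define e where "e \<xi> n = w \<xi> n + v \<xi> n" for \<xi> n
  have tw: "geometric (w \<xi>)" and tv: "geometric (v \<xi>)" for \<xi>
    unfolding w_def[abs_def] v_def[abs_def] by (intro geometric_sum s)+
  then have te: "geometric (e \<xi>)" for \<xi> unfolding e_def[abs_def] by (intro geometric_add)
  have fw: "jet_fun (w \<xi>) t = (\<Sum>k=1..L. ?a k \<xi> t)" for \<xi> t
    unfolding w_def[abs_def] by (subst jet_fun_sum) (simp_all add: s)
  have fv: "jet_fun (v \<xi>) t = (\<Sum>k=L+1..m. ?a k \<xi> t)" for \<xi> t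
    unfolding v_def[abs_def] by (subst jet_fun_sum) (simp_all add: s)
  have fe: "jet_fun (e \<xi>) = (\<lambda>t. \<Sum>k=1..m. ?a k \<xi> t)" for \<xi>
  proof
    fix t
    have "jet_fun (e \<xi>) t = jet_fun (w \<xi>) t + jet_fun (v \<xi>) t" unfolding e_def[abs_def]
      by (rule jet_fun_add[OF tw tv])
    also have "\<dots> = (\<Sum>k=1..m. ?a k \<xi> t)"
      unfolding fw fv un by (rule sum.union_disjoint[symmetric]) auto
    finally show "jet_fun (e \<xi>) t = (\<Sum>k=1..m. ?a k \<xi> t)" .
  qed
  have sol: "solves_mode m a c j \<xi> (jet_fun (e \<xi>))" for \<xi>
    using ampl j unfolding amplitudes_def fe by blast
  have Pe: "shift_poly (P \<xi>) (e \<xi>) = (\<lambda>n. 0)" for \<xi>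
  proof (rule jet_fun_inject[OF geometric_shift_poly[OF te] geometric_zero])
    show "jet_fun (shift_poly (P \<xi>) (e \<xi>)) = jet_fun (\<lambda>n. 0)"
      using sol[of \<xi>] by (auto simp: fun_eq_iff solves_mode_def P_def jet_fun_zero poly_Dt_jet_fun[OF te])
  qed
  have e0: "e \<xi> l = (if l = j then 1 else 0)" if "l < m" for \<xi> l
    using sol[of \<xi>] that by (simp add: solves_mode_def Dt_pow_jet_fun_0[OF te])
  have split: "shift_poly (Q \<xi>) (w \<xi>) = (\<lambda>n. 0)" "shift_poly (R \<xi>) (v \<xi>) = (\<lambda>n. 0)" if "\<xi> \<in> K" for \<xi>
  proof -
    have "shift_poly (Q \<xi> * R \<xi>) (\<lambda>n. w \<xi> n + v \<xi> n) = (\<lambda>n. 0)"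
      using Pe[of \<xi>] unfolding PQ e_def[abs_def] .
    moreover have "shift_poly (Q \<xi> ^ (\<Sum>k=1..L. N k \<xi>)) (w \<xi>) = (\<lambda>n. 0)"
      unfolding Q_def w_def[abs_def] by (intro shift_poly_sum_killed s) simp
    moreover have "shift_poly (R \<xi> ^ (\<Sum>k=L+1..m. N k \<xi>)) (v \<xi>) = (\<lambda>n. 0)"
      unfolding R_def v_def[abs_def] by (intro shift_poly_sum_killed s) simp
    ultimately show "shift_poly (Q \<xi>) (w \<xi>) = (\<lambda>n. 0)" "shift_poly (R \<xi>) (v \<xi>) = (\<lambda>n. 0)"
      using group_splitting[OF cop[OF that]] by blast+
  qed
  obtain \<rho> where \<rho>: "\<rho> \<ge> 1" "\<And>\<xi>. \<xi> \<in> K \<Longrightarrow> (\<Sum>i<m. norm (coeff (P \<xi>) i)) \<le> \<rho>"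
    by (rule compact_bound_above[OF K(1), of "\<lambda>\<xi>. \<Sum>i<m. norm (coeff (P \<xi>) i)"])
      (intro continuous_intros cP, blast)
  obtain C where C: "C \<ge> 1" "\<And>\<xi>. \<xi> \<in> K \<Longrightarrow> (\<Sum>i\<le>m. norm (coeff (R \<xi>) i)) \<le> C"
    by (rule compact_bound_above[OF K(1), of "\<lambda>\<xi>. \<Sum>i\<le>m. norm (coeff (R \<xi>) i)"])
      (intro continuous_intros cR, blast)
  have rb: "norm z \<le> \<rho>" if "\<xi> \<in> K" "poly (Q \<xi>) z = 0" for \<xi> z
    using that \<rho> dP by (intro monic_root_bound[of "P \<xi>" m z \<rho>]) (auto simp: PQ)
  obtain \<delta> where \<delta>: "\<delta> > 0" "\<And>\<xi> z. \<xi> \<in> K \<Longrightarrow> poly (Q \<xi>) z = 0 \<Longrightarrow> \<delta> \<le> norm (poly (R \<xi>) z)"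
    by (rule separated_roots_lower_bound[OF K(1) _ _ cQ cR sepQ rb, where N = m]) (use L dQ dR in auto)
  have eb: "norm (e \<xi> n) \<le> 1 * \<rho> ^ n" if "\<xi> \<in> K" for \<xi> n
    using recurrence_growth[OF dP \<rho>(2)[OF that] \<rho>(1) Pe, of n] e0 j by auto
  define D where "D = 1 + (1 / \<delta>) * C * \<rho> ^ m"
  have D0: "D \<ge> 0" unfolding D_def using \<delta>(1) C(1) \<rho>(1) by (intro add_nonneg_nonneg mult_nonneg_nonneg) auto
  have vb: "norm (v \<xi> n) \<le> 1 * D ^ card {1..L} * \<rho> ^ n" if \<xi>: "\<xi> \<in> K" for \<xi> n
  proof -
    have vp: "v \<xi> = shift_poly (\<Prod>k=1..L. 1 - smult (1 / poly (R \<xi>) (\<tau> k \<xi>)) (R \<xi>)) (e \<xi>)"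
      unfolding e_def[abs_def]
    proof (rule group_projection[symmetric])
      show "poly (R \<xi>) (\<tau> k \<xi>) \<noteq> 0" if "k \<in> {1..L}" for k by (intro sepQ[OF \<xi>] Q0 that)
    qed (use split[OF \<xi>] in \<open>auto simp: Q_def\<close>)
    show ?thesis unfolding vp
    proof (rule projection_growth[OF _ C(2)[OF \<xi>] \<rho>(1) D_def eb[OF \<xi>]])
      fix k assume "k \<in> {1..L}"
      then have "\<delta> \<le> norm (poly (R \<xi>) (\<tau> k \<xi>))" by (intro \<delta>(2)[OF \<xi>] Q0)
      then show "norm (1 / poly (R \<xi>) (\<tau> k \<xi>)) \<le> 1 / \<delta>" using \<delta>(1) by (simp add: norm_divide frac_le)
    qed (use \<delta>(1) dR in auto)
  qed
  define B where "B = 1 + D ^ L"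
  have wb: "norm (w \<xi> n) \<le> B * \<rho> ^ n" if "\<xi> \<in> K" for \<xi> n
  proof -
    have "w \<xi> n = e \<xi> n - v \<xi> n" by (simp add: e_def)
    then have "norm (w \<xi> n) \<le> norm (e \<xi> n) + norm (v \<xi> n)" by (metis norm_triangle_ineq4)
    also have "\<dots> \<le> B * \<rho> ^ n" using eb[OF that, of n] vb[OF that, of n] by (simp add: B_def algebra_simps)
    finally show ?thesis .
  qed
  have ec: "continuous_on K (\<lambda>\<xi>. e \<xi> n)" for n
    by (rule continuous_on_recurrence[OF dP cP Pe e0]) (use j in auto)
  have wc: "continuous_on K (\<lambda>\<xi>. w \<xi> n)" for n
  proof (rule continuous_on_group_sequence[OF _ _ cQ cR ec cop split(1) _ wb])
    show "shift_poly (R \<xi>) (\<lambda>n. e \<xi> n - w \<xi> n) = (\<lambda>n. 0)" if "\<xi> \<in> K" for \<xi>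
      using split(2)[OF that] by (simp add: e_def)
  qed (use L dQ dR in \<open>auto intro: order_trans[of _ m]\<close>)
  show ?thesis
  proof (rule that[OF \<rho>(1) _ wb wc _ _ fw])
    show "B > 0" using D0 by (simp add: B_def add_pos_nonneg)
    show "shift_poly (\<Prod>k=1..L. [:- \<tau> k \<xi>, 1:]) (w \<xi>) = (\<lambda>n. 0)" if "\<xi> \<in> K" for \<xi>
      using split(1)[OF that] unfolding Q_def .
    show "norm (\<tau> k \<xi>) \<le> \<rho>" if "\<xi> \<in> K" "k \<in> {1..L}" for \<xi> k
      by (rule rb[OF that(1) Q0[OF that(2)]])
  qed
qed

section \<open>The decay estimate\<close>

text \<open>All neighbourhoods of the empty set are empty, so every exponent is admissible for it and
  there is no largest one.\<close>

lemma has_codim_nonempty: "has_codim M l \<Longrightarrow> M \<noteq> {}"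
proof
  assume h: "has_codim M l" and "M = {}"
  then have "codim_bound M (Suc l)" by (auto simp: codim_bound_def nbhd_def intro!: exI[of _ 1])
  then show False using h by (auto simp: has_codim_def)
qed

lemma compact_closed_tube:
  fixes M :: "(real ^ 'n) set"
  assumes "bounded M" "M \<noteq> {}" shows "compact {\<xi>. infdist \<xi> M \<le> \<epsilon>}"
proof -
  obtain x0 b where b: "\<And>y. y \<in> M \<Longrightarrow> dist x0 y \<le> b" using assms(1) by (auto simp: bounded_def)
  have "dist x0 \<xi> \<le> b + (\<epsilon> + 1)" if "infdist \<xi> M \<le> \<epsilon>" for \<xi>
  proof -
    have "infdist \<xi> M < \<epsilon> + 1" using that by simp
    then obtain y where "y \<in> M" "dist \<xi> y < \<epsilon> + 1"
      using assms(2) cINF_less_iff[of M "dist \<xi>" "\<epsilon> + 1"]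
        by (auto simp: infdist_def intro: bdd_belowI2[of _ 0])
    then show ?thesis using b[of y] dist_triangle[of x0 \<xi> y] by (simp add: dist_commute)
  qed
  then have "bounded {\<xi>. infdist \<xi> M \<le> \<epsilon>}" unfolding bounded_def by blast
  moreover have "closed {\<xi>. infdist \<xi> M \<le> \<epsilon>}"
    by (intro closed_Collect_le continuous_intros)
  ultimately show ?thesis by (simp add: compact_eq_bounded_closed)
qed

theorem theorem2p15:
  fixes m L l :: nat and s c\<^sub>0 :: real
    and a :: "nat \<Rightarrow> 'n::finite multi_index \<Rightarrow> complex"
    and c :: "'n multi_index \<Rightarrow> nat \<Rightarrow> complex"
    and \<tau> :: "nat \<Rightarrow> real ^ 'n \<Rightarrow> complex"
    and A :: "nat \<Rightarrow> nat \<Rightarrow> real ^ 'n \<Rightarrow> complex poly"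
    and M :: "(real ^ 'n) set"
  assumes hyp: "strictly_hyperbolic m a"
    and roots: "char_roots m a c \<tau>"
    and stable: "\<And>\<xi> k. k \<in> {1..m} \<Longrightarrow> Im (\<tau> k \<xi>) \<ge> 0"
    and ampl: "amplitudes m a c \<tau> A"
    and L: "1 \<le> L" "L \<le> m"
    and M: "bounded M" "C1_set M" "has_codim M l"
    and meet: "\<And>\<xi> k k'. \<lbrakk>\<xi> \<in> M; k \<in> {1..L}; k' \<in> {1..L}\<rbrakk> \<Longrightarrow> \<tau> k \<xi> = \<tau> k' \<xi>"
    and cont: "\<exists>\<epsilon>>0. continuous_root_group (nbhd M \<epsilon>) L \<tau>"
    and separated: "\<exists>\<epsilon>>0. \<forall>\<xi>\<in>nbhd M \<epsilon>. \<forall>k\<in>{1..L}. \<forall>k'\<in>{L+1..m}. \<tau> k \<xi> \<noteq> \<tau> k' \<xi>"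
    and order: "s > 0" "c\<^sub>0 > 0"
      "\<exists>\<epsilon>>0. \<forall>\<xi>\<in>nbhd M \<epsilon>. \<forall>k\<in>{1..L}. c\<^sub>0 * infdist \<xi> M powr s \<le> Im (\<tau> k \<xi>)"
  shows "\<exists>\<epsilon>\<^sub>0>0. \<forall>\<epsilon>. 0 < \<epsilon> \<and> \<epsilon> < \<epsilon>\<^sub>0 \<longrightarrow>
    (\<forall>\<eta>\<in>test_functions (nbhd M \<epsilon>). \<forall>p q :: ennreal. \<forall>j r. \<forall>\<alpha> :: 'n multi_index.
       1 \<le> p \<and> p \<le> 2 \<and> 1 / p + 1 / q = 1 \<and> j < m \<longrightarrow>
       (\<exists>C::real. \<forall>f\<in>test_functions UNIV. \<forall>t\<ge>0.
          Lp_norm q (\<lambda>x. (Dt ^^ r) (\<lambda>t. Dx_multi \<alpha> (localized_wave (nbhd M \<epsilon>) L \<tau> (A j) \<eta> f t) x) t)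
          \<le> ennreal (C * (1 + t) powr
                (- (real l / s) * (enn2real (1 / p) - enn2real (1 / q)) + real L - 1))
             * Lp_norm p f))"
proof -
  let ?a = "\<lambda>j k \<xi> t. exp (\<i> * \<tau> k \<xi> * of_real t) * poly (A j k \<xi>) (of_real t)"
    and ?d = "\<lambda>\<xi> t. exp (- (c\<^sub>0 * infdist \<xi> M powr s) * t)"
  have M0: "M \<noteq> {}" by (rule has_codim_nonempty[OF M(3)])
  obtain \<epsilon>1 where e1: "\<epsilon>1 > 0" "continuous_root_group (nbhd M \<epsilon>1) L \<tau>" using cont by blast
  obtain \<epsilon>2 where e2: "\<epsilon>2 > 0" "\<And>\<xi> k k'. \<xi> \<in> nbhd M \<epsilon>2 \<Longrightarrow> k \<in> {1..L} \<Longrightarrow> k' \<in> {L+1..m} \<Longrightarrow> \<tau> k \<xi> \<noteq> \<tau> k' \<xi>"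
    using separated by blast
  obtain \<epsilon>3 where e3: "\<epsilon>3 > 0" "\<And>\<xi> k. \<xi> \<in> nbhd M \<epsilon>3 \<Longrightarrow> k \<in> {1..L} \<Longrightarrow> c\<^sub>0 * infdist \<xi> M powr s \<le> Im (\<tau> k \<xi>)"
    using order(3) by blast
  have cb: "codim_bound M l" using M(3) by (simp add: has_codim_def)
  obtain \<epsilon>4 where e4: "\<epsilon>4 > 0" "\<And>\<epsilon>. 0 < \<epsilon> \<Longrightarrow> \<epsilon> < \<epsilon>4 \<Longrightarrow> \<exists>C>0. \<forall>t\<ge>0.
    (\<integral>\<^sup>+\<xi>. ennreal (indicator {\<xi>. infdist \<xi> M \<le> \<epsilon>} \<xi> * ?d \<xi> t) \<partial>lborel)
      \<le> ennreal (C * (1 + t) powr (- (real l / s)))"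
    using tube_integral[OF M0 cb order(1,2)] by blast
  show ?thesis
  proof (rule exI[of _ "min (min \<epsilon>1 \<epsilon>2) (min \<epsilon>3 \<epsilon>4)"], intro conjI allI impI ballI)
    show "0 < min (min \<epsilon>1 \<epsilon>2) (min \<epsilon>3 \<epsilon>4)" using e1 e2 e3 e4 by simp
    fix \<epsilon> and \<eta> :: "real ^ 'n \<Rightarrow> complex" and p q :: ennreal and j r :: nat and \<alpha> :: "'n multi_index"
    assume \<epsilon>: "0 < \<epsilon> \<and> \<epsilon> < min (min \<epsilon>1 \<epsilon>2) (min \<epsilon>3 \<epsilon>4)" and \<eta>: "\<eta> \<in> test_functions (nbhd M \<epsilon>)"
      and pq: "1 \<le> p \<and> p \<le> 2 \<and> 1 / p + 1 / q = 1 \<and> j < m"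
    define K where "K = {\<xi>. infdist \<xi> M \<le> \<epsilon>}"
    have Ksub: "K \<subseteq> nbhd M \<epsilon>1" "K \<subseteq> nbhd M \<epsilon>2" "K \<subseteq> nbhd M \<epsilon>3" and nK: "nbhd M \<epsilon> \<subseteq> K"
      using \<epsilon> M0 by (auto simp: K_def nbhd_def)
    have Kc: "compact K" unfolding K_def by (rule compact_closed_tube[OF M(1) M0])
    then have Kb: "K \<in> sets borel" by (intro borel_closed compact_imp_closed)
    have jm: "j < m" using pq by blast
    obtain w B \<rho> where w: "\<rho> \<ge> 1" "B > 0" "\<And>\<xi> n. \<xi> \<in> K \<Longrightarrow> norm (w \<xi> n) \<le> B * \<rho> ^ n"
      "\<And>n. continuous_on K (\<lambda>\<xi>. w \<xi> n)"
      "\<And>\<xi>. \<xi> \<in> K \<Longrightarrow> shift_poly (\<Prod>k=1..L. [:- \<tau> k \<xi>, 1:]) (w \<xi>) = (\<lambda>n. 0)"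
      "\<And>\<xi> k. \<xi> \<in> K \<Longrightarrow> k \<in> {1..L} \<Longrightarrow> norm (\<tau> k \<xi>) \<le> \<rho>"
      "\<And>\<xi> t. jet_fun (w \<xi>) t = (\<Sum>k=1..L. ?a j k \<xi> t)"
    proof (rule group_wave_sequence[OF roots ampl L jm Kc Ksub(1) e1(2)])
      show "\<tau> k \<xi> \<noteq> \<tau> k' \<xi>" if "\<xi> \<in> K" "k \<in> {1..L}" "k' \<in> {L+1..m}" for \<xi> k k'
        using e2(2) that Ksub by blast
    next
      fix w B \<rho>
      assume "1 \<le> \<rho>" "0 < B" "\<And>\<xi> n. \<xi> \<in> K \<Longrightarrow> norm (w \<xi> n) \<le> B * \<rho> ^ n"
        "\<And>n. continuous_on K (\<lambda>\<xi>. w \<xi> n)"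
        "\<And>\<xi>. \<xi> \<in> K \<Longrightarrow> shift_poly (\<Prod>k=1..L. [:- \<tau> k \<xi>, 1:]) (w \<xi>) = (\<lambda>n. 0)"
        "\<And>\<xi> k. \<xi> \<in> K \<Longrightarrow> k \<in> {1..L} \<Longrightarrow> norm (\<tau> k \<xi>) \<le> \<rho>"
        "\<And>\<xi> t. jet_fun (w \<xi>) t = (\<Sum>k=1..L. ?a j k \<xi> t)"
      then show thesis by (rule that)
    qed
    \<comment> \<open>extension by 0, which is harmless because \<open>\<eta>\<close> vanishes outside \<open>K\<close>\<close>
    define u where "u \<xi> n = indicator K \<xi> *\<^sub>R w \<xi> n" for \<xi> n
    have uK: "u \<xi> = w \<xi>" if "\<xi> \<in> K" for \<xi> using that by (simp add: u_def fun_eq_iff)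
    have uN: "u \<xi> = (\<lambda>n. 0)" if "\<xi> \<notin> K" for \<xi> using that by (simp add: u_def fun_eq_iff)
    have ub: "norm (u \<xi> n) \<le> B * \<rho> ^ n" for \<xi> n
      using w(1-3) by (cases "\<xi> \<in> K") (auto simp: uK uN)
    have um: "(\<lambda>\<xi>. u \<xi> n) \<in> borel_measurable borel" for n
      unfolding u_def by (rule borel_measurable_continuous_on_indicator[OF Kb w(4)])
    have u: "geometric_family u" unfolding geometric_family_def using ub um by blast
    have \<eta>b: "bdd_bsupp \<eta>" and \<eta>0: "\<And>x. x \<notin> nbhd M \<epsilon> \<Longrightarrow> \<eta> x = 0" using test_functions_bdd_bsupp[OF \<eta>] by blast+
    obtain P where P: "continuous_on UNIV P" "\<And>\<mu> f. bdd_bsupp \<mu> \<Longrightarrow> bdd_bsupp f \<Longrightarrow>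
      Dx_multi \<alpha> (multiplier \<mu> f) = multiplier (\<lambda>\<xi>. P \<xi> * \<mu> \<xi>) f \<and> bdd_bsupp (\<lambda>\<xi>. P \<xi> * \<mu> \<xi>)"
      using Dx_multi_multiplier[of \<alpha>] by blast
    define b where "b \<xi> = P \<xi> * \<eta> \<xi>" for \<xi>
    have b: "bdd_bsupp b" unfolding b_def[abs_def] using P(2)[OF \<eta>b \<eta>b] by blast
    obtain Bb where Bb: "\<And>\<xi>. norm (b \<xi>) \<le> Bb" "Bb \<ge> 0"
    proof -
      obtain B' where "\<And>\<xi>. norm (b \<xi>) \<le> B'" using b by (auto simp: bdd_bsupp_def bounded_iff)
      then show ?thesis using that[of B'] norm_ge_zero order_trans by blast
    qed
    define \<mu> where "\<mu> t \<xi> = b \<xi> * jet_fun (\<lambda>n. u \<xi> (n + r)) t" for t \<xi>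
    have wave: "(Dt ^^ r) (\<lambda>t. Dx_multi \<alpha> (localized_wave (nbhd M \<epsilon>) L \<tau> (A j) \<eta> f t) x) t
      = multiplier (\<mu> t) f x"
      if f: "bdd_bsupp f" for f t x
    proof -
      have 1: "localized_wave (nbhd M \<epsilon>) L \<tau> (A j) \<eta> f t = multiplier (\<lambda>\<xi>. \<eta> \<xi> * jet_fun (u \<xi>) t) f" for t
      proof
        fix x
        show "localized_wave (nbhd M \<epsilon>) L \<tau> (A j) \<eta> f t x = multiplier (\<lambda>\<xi>. \<eta> \<xi> * jet_fun (u \<xi>) t) f x"
          unfolding localized_wave_def multiplier_eq set_lebesgue_integral_def
        proof (rule Bochner_Integration.integral_cong[OF refl])
          fix \<xi>
          show "indicator (nbhd M \<epsilon>) \<xi> *\<^sub>R (iexp (x \<bullet> \<xi>) *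
              (\<Sum>k=1..L. ?a j k \<xi> t) * \<eta> \<xi> * fourier f \<xi>)
            = iexp (x \<bullet> \<xi>) * (\<eta> \<xi> * jet_fun (u \<xi>) t * fourier f \<xi>)"
          proof (cases "\<xi> \<in> nbhd M \<epsilon>")
            case True
            then have "\<xi> \<in> K" using nK by blast
            then have "jet_fun (u \<xi>) t = (\<Sum>k=1..L. ?a j k \<xi> t)"
              by (simp only: uK w(7))
            then show ?thesis using True by simp
          qed (simp add: \<eta>0)
        qed
      qed
      have 2: "Dx_multi \<alpha> (localized_wave (nbhd M \<epsilon>) L \<tau> (A j) \<eta> f t) x
        = multiplier (\<lambda>\<xi>. b \<xi> * jet_fun (u \<xi>) t) f x" for t
        unfolding 1 using P(2)[OF bdd_bsupp_mult_jet_fun[OF \<eta>b u, of t] f] by (simp add: b_def mult.assoc)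
      show ?thesis unfolding 2 Dt_pow_multiplier[OF b u f] \<mu>_def[abs_def] ..
    qed
    have \<mu>b: "bdd_bsupp (\<mu> t)" for t
      unfolding \<mu>_def[abs_def] by (rule bdd_bsupp_mult_jet_fun[OF b geometric_family_shift[OF u]])
    have "\<rho> \<ge> 0" using w(1) by simp
    from root_group_decay[OF this, of "L - 1"]
    obtain C1 where C1: "0 \<le> C1 \<and> (\<forall>w \<tau> \<nu> G t. (\<forall>n. norm (w n) \<le> G * \<rho> ^ n) \<longrightarrow>
      (\<forall>k\<in>{1..Suc (L - 1)}. norm (\<tau> k) \<le> \<rho> \<and> \<nu> \<le> Im (\<tau> k)) \<longrightarrow>
      shift_poly (\<Prod>k=1..Suc (L - 1). [:- \<tau> k, 1:]) w = (\<lambda>n. 0) \<longrightarrow> t \<ge> 0 \<longrightarrow>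
      norm (jet_fun w t) \<le> C1 * G * (1 + t) ^ (L - 1) * exp (- \<nu> * t))"
      by (rule exE)
    note C1_ge = conjunct1[OF C1] and C1_bound = conjunct2[OF C1, rule_format]
    \<comment> \<open>the summands 1 make the bounds positive, as the real powers below require\<close>
    define G where "G = (Bb + 1) * ((C1 + 1) * (B * \<rho> ^ r))"
    have G: "G > 0" unfolding G_def using Bb(2) C1_ge w(1,2) by (intro mult_pos_pos add_nonneg_pos) auto
    have \<mu>le: "norm (\<mu> t \<xi>) \<le> G * (1 + t) ^ (L - 1) * (indicator K \<xi> * ?d \<xi> t)"
      if t: "t \<ge> 0" for t \<xi>
    proof (cases "\<xi> \<in> K")
      case True
      have sh: "shift_poly p (\<lambda>n. w \<xi> (n + r)) n = shift_poly p (w \<xi>) (n + r)" for p n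
        by (simp add: shift_poly_def add_ac)
      have "norm (jet_fun (\<lambda>n. w \<xi> (n + r)) t) \<le> C1 * (B * \<rho> ^ r) * (1 + t) ^ (L - 1) * ?d \<xi> t"
      proof (rule C1_bound[where \<tau> = "\<lambda>k. \<tau> k \<xi>"])
        show "norm (w \<xi> (n + r)) \<le> B * \<rho> ^ r * \<rho> ^ n" for n
          using w(3)[OF True, of "n + r"] by (simp add: power_add mult_ac)
        show "norm (\<tau> k \<xi>) \<le> \<rho> \<and> c\<^sub>0 * infdist \<xi> M powr s \<le> Im (\<tau> k \<xi>)" if "k \<in> {1..Suc (L - 1)}" for k
        proof -
          have "k \<in> {1..L}" using that L(1) by simp
          then show ?thesis using w(6)[OF True] e3(2) Ksub(3) True by blast
        qed
        show "shift_poly (\<Prod>k=1..Suc (L - 1). [:- \<tau> k \<xi>, 1:]) (\<lambda>n. w \<xi> (n + r)) = (\<lambda>n. 0)"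
          using w(5)[OF True] L(1) by (simp add: sh fun_eq_iff)
      qed (rule t)
      also have "\<dots> \<le> (C1 + 1) * (B * \<rho> ^ r) * (1 + t) ^ (L - 1) * ?d \<xi> t"
        using w(1,2) t by (intro mult_right_mono) auto
      finally have "norm (b \<xi>) * norm (jet_fun (\<lambda>n. w \<xi> (n + r)) t) \<le>
          (Bb + 1) * ((C1 + 1) * (B * \<rho> ^ r) * (1 + t) ^ (L - 1) * ?d \<xi> t)"
        using Bb(1)[of \<xi>] Bb(2) by (intro mult_mono) auto
      then show ?thesis using True by (simp add: \<mu>_def uK norm_mult G_def mult_ac)
    qed (simp add: \<mu>_def uN jet_fun_zero)
    obtain Ct where Ct: "Ct > 0" "\<And>t. t \<ge> 0 \<Longrightarrow>
      (\<integral>\<^sup>+\<xi>. ennreal (indicator K \<xi> * ?d \<xi> t) \<partial>lborel)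
      \<le> ennreal (Ct * (1 + t) powr (- (real l / s)))"
      using e4(2)[of \<epsilon>] \<epsilon> unfolding K_def by auto
    define \<theta> where "\<theta> = enn2real (1 / p) - enn2real (1 / q)"
    have p1: "1 \<le> p" and p2: "p \<le> 2" and pq1: "1 / p + 1 / q = 1" using pq by blast+
    from multiplier_Lp_Lq[OF p1 p2 pq1, where 'n = 'n, folded \<theta>_def]
    obtain C2 where C2: "0 \<le> C2 \<and> (\<forall>\<mu> (f :: real ^ 'n \<Rightarrow> complex) M0 M1. bdd_bsupp \<mu> \<longrightarrow> bdd_bsupp f
      \<longrightarrow> (\<forall>\<xi>. norm (\<mu> \<xi>) \<le> M0) \<longrightarrow>
      (LINT \<xi>|lborel. norm (\<mu> \<xi>)) \<le> M1 \<longrightarrow> 0 < M0 \<longrightarrow> 0 < M1 \<longrightarrow>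
      Lp_norm q (multiplier \<mu> f) \<le> ennreal (C2 * M0 powr (1 - \<theta>) * M1 powr \<theta>) * Lp_norm p f)"
      by (rule exE)
    note C2_bound = conjunct2[OF C2, rule_format]
    show "\<exists>C::real. \<forall>f\<in>test_functions UNIV. \<forall>t\<ge>0.
          Lp_norm q (\<lambda>x. (Dt ^^ r) (\<lambda>t. Dx_multi \<alpha> (localized_wave (nbhd M \<epsilon>) L \<tau> (A j) \<eta> f t) x) t)
          \<le> ennreal (C * (1 + t) powr
                (- (real l / s) * (enn2real (1 / p) - enn2real (1 / q)) + real L - 1))
             * Lp_norm p f"
    proof (intro exI[of _ "C2 * G * Ct powr \<theta>"] ballI allI impI)
      fix f :: "real ^ 'n \<Rightarrow> complex" and t :: real assume f: "f \<in> test_functions UNIV" and t: "0 \<le> t"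
      have fb: "bdd_bsupp f" by (rule test_functions_bdd_bsupp[OF f])
      let ?M0 = "G * (1 + t) ^ (L - 1)" and ?M1
        = "G * (1 + t) ^ (L - 1) * (Ct * (1 + t) powr (- (real l / s)))"
      have M0': "?M0 > 0" and M1': "?M1 > 0" using G Ct(1) t by auto
      have sup: "norm (\<mu> t \<xi>) \<le> ?M0" for \<xi>
      proof -
        have "indicat_real K \<xi> * ?d \<xi> t \<le> 1 * 1"
          using order(2) t by (intro mult_mono) (auto simp: indicator_def)
        from mult_left_mono[OF this less_imp_le[OF M0']] \<mu>le[OF t, of \<xi>]
        show ?thesis by linarith
      qed
      have int: "(LINT \<xi>|lborel. norm (\<mu> t \<xi>)) \<le> ?M1"
      proof -
        have "ennreal (LINT \<xi>|lborel. norm (\<mu> t \<xi>)) = (\<integral>\<^sup>+\<xi>. ennreal (norm (\<mu> t \<xi>)) \<partial>lborel)"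
          by (rule nn_integral_eq_integral[symmetric]) (auto intro: integrable_norm bdd_bsupp_integrable \<mu>b)
        also have "\<dots> \<le> (\<integral>\<^sup>+\<xi>. ennreal ?M0 * ennreal (indicator K \<xi> * ?d \<xi> t) \<partial>lborel)"
        proof (rule nn_integral_mono)
          fix \<xi>
          show "ennreal (norm (\<mu> t \<xi>)) \<le> ennreal ?M0 * ennreal (indicator K \<xi> * ?d \<xi> t)"
            using \<mu>le[OF t, of \<xi>] M0' by (subst ennreal_mult[symmetric]) (auto intro: ennreal_leI)
        qed
        also have "\<dots> = ennreal ?M0 * (\<integral>\<^sup>+\<xi>. ennreal (indicator K \<xi> * ?d \<xi> t) \<partial>lborel)"
        proof (rule nn_integral_cmult)
          have [measurable]: "(\<lambda>\<xi> :: real ^ 'n. infdist \<xi> M) \<in> borel_measurable borel"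
            by (intro borel_measurable_continuous_onI continuous_on_infdist continuous_on_id)
          show "(\<lambda>\<xi>. ennreal (indicator K \<xi> * ?d \<xi> t)) \<in> borel_measurable lborel"
            using Kb by measurable
        qed
        also have "\<dots> \<le> ennreal ?M0 * ennreal (Ct * (1 + t) powr (- (real l / s)))"
          by (intro mult_left_mono Ct(2) t) simp
        also have "\<dots> = ennreal ?M1" using M0' Ct(1) by (intro ennreal_mult[symmetric]) auto
        finally show ?thesis using M1' by (subst (asm) ennreal_le_iff) auto
      qed
      have "?M0 powr (1 - \<theta>) * ?M1 powr \<theta> = G * Ct powr \<theta> * (1 + t) powr (- (real l / s) * \<theta> + real L - 1)"
      proof -
        have "?M1 powr \<theta> = ?M0 powr \<theta> * (Ct powr \<theta> * ((1 + t) powr (- (real l / s))) powr \<theta>)"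
          using M0' Ct(1) by (simp add: powr_mult)
        then have e1: "?M0 powr (1 - \<theta>) * ?M1 powr \<theta>
          = (?M0 powr (1 - \<theta>) * ?M0 powr \<theta>) * (Ct powr \<theta> * (1 + t) powr (- (real l / s) * \<theta>))"
          by (simp add: powr_powr)
        have h1: "?M0 powr (1 - \<theta>) * ?M0 powr \<theta> = ?M0" using M0' by (simp add: powr_add[symmetric])
        have h2: "?M0 = G * (1 + t) powr (real L - 1)"
          using t L(1) powr_realpow[of "1 + t" "L - 1"] by (simp add: of_nat_diff)
        have "?M0 * (Ct powr \<theta> * (1 + t) powr (- (real l / s) * \<theta>))
          = G * (1 + t) powr (real L - 1) * (Ct powr \<theta> * (1 + t) powr (- (real l / s) * \<theta>))"
          by (simp only: h2)
        also have "G * (1 + t) powr (real L - 1) * (Ct powr \<theta> * (1 + t) powr (- (real l / s) * \<theta>))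
          = G * Ct powr \<theta> * ((1 + t) powr (- (real l / s) * \<theta>) * (1 + t) powr (real L - 1))"
            by (simp add: mult_ac)
        also have "\<dots> = G * Ct powr \<theta> * (1 + t) powr (- (real l / s) * \<theta> + real L - 1)"
          by (simp add: powr_add[symmetric] add_diff_eq)
        finally show ?thesis unfolding e1 h1 .
      qed
      then have e: "C2 * ?M0 powr (1 - \<theta>) * ?M1 powr \<theta>
        = C2 * G * Ct powr \<theta> * (1 + t) powr (- (real l / s) * \<theta> + real L - 1)"
        by (simp add: mult.assoc)
      have "Lp_norm q (multiplier (\<mu> t) f) \<le> ennreal (C2 * ?M0 powr (1 - \<theta>) * ?M1 powr \<theta>) * Lp_norm p f"
        by (rule C2_bound[OF \<mu>b fb sup int M0' M1'])
      then have "Lp_norm q (multiplier (\<mu> t) f)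
          \<le> ennreal (C2 * G * Ct powr \<theta> * (1 + t) powr (- (real l / s) * \<theta> + real L - 1)) * Lp_norm p f"
        by (simp only: e)
      then show "Lp_norm q (\<lambda>x. (Dt ^^ r) (\<lambda>t. Dx_multi \<alpha> (localized_wave (nbhd M \<epsilon>) L \<tau> (A j) \<eta> f t) x) t)
          \<le> ennreal (C2 * G * Ct powr \<theta> * (1 + t) powr
                (- (real l / s) * (enn2real (1 / p) - enn2real (1 / q)) + real L - 1))
             * Lp_norm p f"
        unfolding wave[OF fb] \<theta>_def .
    qed
  qed
qed

end
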